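(* Let $\lambda(N)\in\mathbb{GT}_N$ be a regular sequence of signatures with $m[\lambda(N)]\to\mathbf m$ weakly, and fix $0<a<1$; put $M=\lfloor aN\rfloor$. Let $\rho_N$ be the probability measure on $\mathbb{GT}_M$ with Schur generating function $\frac{s_{\lambda(N)}(x_1,\dots,x_M,1^{N-M})}{s_{\lambda(N)}(1^N)}$ (the decomposition measure of the restriction of $\pi^{\lambda(N)}$ to $U(M)$), and $p_k^{(N)}=\sum_{i=1}^M(\mu_i+M-i)^k$ with $\mu\sim\rho_N$. Then $\{N^{-k}(p_k^{(N)}-\mathbf Ep_k^{(N)})\}_{k\ge1}$ converges in the sense of moments to a centered Gaussian vector with covariance $$\lim_{N\to\infty}\frac{\mathrm{cov}(p_{k_1}^{(N)},p_{k_2}^{(N)})}{N^{k_1+k_2}}=\frac{a^{k_1+k_2}}{(2\pi\mathbf i)^2}\oint_{|z|=\epsilon}\oint_{|w|=2\epsilon}\Big(\frac1z+1+\frac{(1+z)H'_{\mathbf m}(1+z)}{a}\Big)^{k_1}\Big(\frac1w+1+\frac{(1+w)H'_{\mathbf m}(1+w)}{a}\Big)^{k_2}$$ $$\times\Big(\partial_z\partial_w\log\Big(1-zw\frac{(1+z)H'_{\mathbf m}(1+z)-(1+w)H'_{\mathbf m}(1+w)}{z-w}\Big)+\frac1{(z-w)^2}\Big)dz\,dw,$$ counter-clockwise contours, $\epsilon>0$ small.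
   Context: Signatures $\lambda=(\lambda_1\ge\dots\ge\lambda_N)\in\mathbb Z^N$ form $\mathbb{GT}_N$; $s_\lambda$ is the Schur function; Schur generating function of $\rho$ on $\mathbb{GT}_M$: $\sum_\mu\rho(\mu)s_\mu/s_\mu(1^M)$. $m[\lambda]=\frac1N\sum_{i=1}^N\delta(\frac{\lambda_i+N-i}N)$. A sequence $\lambda(N)\in\mathbb{GT}_N$ is regular if there are a piecewise-continuous $f$ on $[0,1]$ and $C$ with $\lim_N\frac1N\sum_j|\lambda_j(N)/N-f(j/N)|=0$ and $|\lambda_j(N)/N-f(j/N)|<C$ for all $j,N$. For a compactly supported probability measure $\mathbf m$, $C_{\mathbf m}(z)=\int\frac{d\mathbf m(x)}{z-x}$, $C^{(-1)}_{\mathbf m}$ its functional inverse, and $H'_{\mathbf m}(z)=\frac{C^{(-1)}_{\mathbf m}(\log z)}{z}-\frac1{z-1}$ (holomorphic near $z=1$). *)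

theory Defs
  imports "HOL-Probability.Probability"
begin

definition GT :: "nat \<Rightarrow> (nat \<Rightarrow> int) set" where
  "GT n = {l. (\<forall>i j. 1 \<le> i \<and> i \<le> j \<and> j \<le> n \<longrightarrow> l j \<le> l i) \<and>
              (\<forall>i. (i = 0 \<or> n < i) \<longrightarrow> l i = 0)}"

definition interlace :: "nat \<Rightarrow> (nat \<Rightarrow> int) \<Rightarrow> (nat \<Rightarrow> int) \<Rightarrow> bool" where
  "interlace n \<mu> l \<longleftrightarrow> (\<forall>i. 1 \<le> i \<and> i \<le> n \<longrightarrow> l (i+1) \<le> \<mu> i \<and> \<mu> i \<le> l i)"

definition sig_size :: "nat \<Rightarrow> (nat \<Rightarrow> int) \<Rightarrow> int" where
  "sig_size n l = (\<Sum>i=1..n. l i)"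

(* Schur (Laurent) polynomial s_l(x_1,...,x_n), via the branching rule / Gelfand-Tsetlin patterns *)
fun schur :: "nat \<Rightarrow> (nat \<Rightarrow> int) \<Rightarrow> (nat \<Rightarrow> complex) \<Rightarrow> complex" where
  "schur 0 l x = 1"
| "schur (Suc n) l x =
     (\<Sum>\<mu> \<in> {\<mu> \<in> GT n. interlace n \<mu> l}.
        x (Suc n) powi (sig_size (Suc n) l - sig_size n \<mu>) * schur n \<mu> x)"

definition piecewise_continuous01 :: "(real \<Rightarrow> real) \<Rightarrow> bool" where
  "piecewise_continuous01 f \<longleftrightarrow>
     (\<exists>S. finite S \<and> continuous_on ({0..1} - S) f \<and>
        (\<forall>s\<in>S. (0 < s \<longrightarrow> (\<exists>L. (f \<longlongrightarrow> L) (at_left s))) \<and>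
                 (s < 1 \<longrightarrow> (\<exists>L. (f \<longlongrightarrow> L) (at_right s)))))"

definition regular_seq :: "(nat \<Rightarrow> nat \<Rightarrow> int) \<Rightarrow> bool" where
  "regular_seq lam \<longleftrightarrow>
     (\<exists>f C. piecewise_continuous01 f \<and>
        ((\<lambda>N. (1 / real N) * (\<Sum>j=1..N. \<bar>real_of_int (lam N j) / real N - f (real j / real N)\<bar>))
            \<longlonglongrightarrow> 0) \<and>
        (\<forall>N\<ge>1. \<forall>j\<in>{1..N}. \<bar>real_of_int (lam N j) / real N - f (real j / real N)\<bar> < C))"

definition emp_int :: "nat \<Rightarrow> (nat \<Rightarrow> int) \<Rightarrow> (real \<Rightarrow> real) \<Rightarrow> real" where
  "emp_int N l g = (1 / real N) * (\<Sum>i=1..N. g ((real_of_int (l i) + real N - real i) / real N))"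

definition weak_conv_emp :: "(nat \<Rightarrow> nat \<Rightarrow> int) \<Rightarrow> real measure \<Rightarrow> bool" where
  "weak_conv_emp lam m \<longleftrightarrow>
     (\<forall>g. continuous_on UNIV g \<and> bounded (range g) \<longrightarrow>
        (\<lambda>N. emp_int N (lam N) g) \<longlonglongrightarrow> integral\<^sup>L m g)"

definition stieltjes :: "real measure \<Rightarrow> complex \<Rightarrow> complex" where
  "stieltjes m z = integral\<^sup>L m (\<lambda>x. 1 / (z - complex_of_real x))"

(* H'_m(z) = C^{-1}(log z)/z - 1/(z-1), with Ci a functional inverse of the Stieltjes transform *)
definition Hprime :: "(complex \<Rightarrow> complex) \<Rightarrow> complex \<Rightarrow> complex" where
  "Hprime Ci z = Ci (Ln z) / z - 1 / (z - 1)"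

definition circ_dbl :: "real \<Rightarrow> real \<Rightarrow> (complex \<Rightarrow> complex \<Rightarrow> complex) \<Rightarrow> complex" where
  "circ_dbl r1 r2 F = (1 / (2 * of_real pi * \<i>)^2) *
     integral {0..2*pi} (\<lambda>s. integral {0..2*pi} (\<lambda>t.
        F (of_real r1 * cis s) (of_real r2 * cis t) *
        (\<i> * of_real r1 * cis s) * (\<i> * of_real r2 * cis t)))"

definition cov_kernel :: "real \<Rightarrow> (complex \<Rightarrow> complex) \<Rightarrow> real \<Rightarrow> nat \<Rightarrow> nat \<Rightarrow> complex" where
  "cov_kernel a Ci \<epsilon> k1 k2 = of_real (a ^ (k1 + k2)) *
     circ_dbl \<epsilon> (2 * \<epsilon>) (\<lambda>z w.
       (1 / z + 1 + (1 + z) * Hprime Ci (1 + z) / of_real a) ^ k1 *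
       (1 / w + 1 + (1 + w) * Hprime Ci (1 + w) / of_real a) ^ k2 *
       (deriv (\<lambda>z'. deriv (\<lambda>w'. Ln (1 - z' * w' *
            ((1 + z') * Hprime Ci (1 + z') - (1 + w') * Hprime Ci (1 + w')) / (z' - w'))) w) z
        + 1 / (z - w)^2))"

(* Isserlis/Wick formula: joint moment E[X_{k_1}...X_{k_n}] of a centered Gaussian vector
   with covariance c *)
function wick :: "(nat \<Rightarrow> nat \<Rightarrow> complex) \<Rightarrow> nat list \<Rightarrow> complex" where
  "wick c [] = 1"
| "wick c (k # ks) = (\<Sum>j<length ks. c k (ks ! j) * wick c (take j ks @ drop (Suc j) ks))"
  by pat_completeness auto
termination
  by (relation "Wellfounded.measure (\<lambda>(c, ks). length ks)") auto

definition Mof :: "real \<Rightarrow> nat \<Rightarrow> nat" where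
  "Mof a N = nat \<lfloor>a * real N\<rfloor>"

definition pk :: "nat \<Rightarrow> nat \<Rightarrow> (nat \<Rightarrow> int) \<Rightarrow> real" where
  "pk M k \<mu> = (\<Sum>i=1..M. (real_of_int (\<mu> i) + real M - real i) ^ k)"

definition Ep :: "(nat \<Rightarrow> (nat \<Rightarrow> int) \<Rightarrow> real) \<Rightarrow> real \<Rightarrow> nat \<Rightarrow> nat \<Rightarrow> real" where
  "Ep rho a N k = (\<Sum>\<^sub>\<infinity>\<mu>\<in>GT (Mof a N). rho N \<mu> * pk (Mof a N) k \<mu>)"

definition covN :: "(nat \<Rightarrow> (nat \<Rightarrow> int) \<Rightarrow> real) \<Rightarrow> real \<Rightarrow> nat \<Rightarrow> nat \<Rightarrow> nat \<Rightarrow> real" where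
  "covN rho a N k1 k2 = (\<Sum>\<^sub>\<infinity>\<mu>\<in>GT (Mof a N). rho N \<mu> *
      (pk (Mof a N) k1 \<mu> - Ep rho a N k1) * (pk (Mof a N) k2 \<mu> - Ep rho a N k2))"

definition momN :: "(nat \<Rightarrow> (nat \<Rightarrow> int) \<Rightarrow> real) \<Rightarrow> real \<Rightarrow> nat \<Rightarrow> nat list \<Rightarrow> real" where
  "momN rho a N ks = (\<Sum>\<^sub>\<infinity>\<mu>\<in>GT (Mof a N). rho N \<mu> *
      (\<Prod>k\<leftarrow>ks. (pk (Mof a N) k \<mu> - Ep rho a N k) / real N ^ k))"

end

theory Submission
  imports Defs "HOL-Complex_Analysis.Complex_Analysis" "Jordan_Normal_Form.Determinant"
begin

text \<open>
  Write \<open>l\<^sub>i = \<lambda>\<^sub>i + N - i\<close>, \<open>m\<^sub>j = \<mu>\<^sub>j + M - j\<close>, \<open>r = N - M\<close>, and let \<open>\<nabla>\<close> be the difference operator.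
  Summing over interlacing arrays turns \<open>det \<phi>\<^sub>i(m\<^sub>j)\<close> into a determinant at the points \<open>l\<^sub>i\<close> in which every
  \<open>\<phi>\<^sub>i\<close> is replaced by \<open>\<nabla>\<^sup>-\<^sup>r \<phi>\<^sub>i\<close>.  Hence multiplication by \<open>p\<^sub>k(\<mu>)\<close> becomes the derivation of the Vandermonde
  determinant in \<open>l\<close> induced by the one-variable operator \<open>X\<^sup>k\<close>, where \<open>X = \<nabla>\<^sup>-\<^sup>r x \<nabla>\<^sup>r = x - r - r \<nabla>\<^sup>-\<^sup>1\<close> up to
  polynomials of degree less than \<open>r\<close>.

  Expand polynomials \<open>p\<close> through the Laurent coefficients of \<open>p(Ny) / \<Prod>(y - l\<^sub>i/N)\<close> at \<open>y = \<infinity>\<close>.  In these coordinates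
  the values at \<open>l\<close> only see the negative powers of \<open>y\<close>, the polynomials of degree less than \<open>N\<close> only have negative
  powers, and the moments are vacuum expectations of free fermions.  Splitting each matrix into its raising and lowering
  parts gives an exact recursion for the centred moments that involves finitely many entries near the Fermi level.  There
  \<open>\<nabla>\<close> converges to multiplication by \<open>e\<^sup>C\<^sup>(\<^sup>y\<^sup>) - 1\<close>, so \<open>X/N\<close> converges to multiplication by
  \<open>F(y) = y - (1-a)(1 + 1/(e\<^sup>C\<^sup>(\<^sup>y\<^sup>) - 1))\<close>.  Multiplication operators commute, so only the scalar (Schwinger) terms
  survive, which is Wick's formula with covariance \<open>\<Sum>\<^sub>j j [y\<^sup>j]F\<^sup>k [y\<^sup>-\<^sup>j]F\<^sup>l\<close>.

  Finally \<open>y = C\<^sup>-\<^sup>1(log(1+z))\<close> turns the kernel of the contour integral into \<open>dy dy'/(y - y')\<^sup>2\<close> and its two remaining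
  factors into \<open>F(y)\<^sup>k F(y')\<^sup>l\<close>, and the residues give the same sum.
\<close>

subsection \<open>Determinants\<close>

text \<open>Centring is what keeps the computation finite. The vacuum trace of a power sum runs over
  all \<open>N\<close> filled levels and is of order \<open>N\<close>, but it equals the mean,
  because \<open>cumG\<close> of a single matrix is 0; so it never has to be evaluated. What remains
  involves boundedly many levels around the Fermi level, and there entrywise limits suffice as soon
  as the amount of raising is bounded uniformly in \<open>N\<close>. Three obstacles shape the rest.
  First, powers below y^(-N) correspond to no polynomial, so coordinates are cut there and shift
  identities hold only above the cut. Second, the antidifference involves a choice of constants, and
  the formula for X holds only up to degree less than \<open>r\<close>; such errors live below level
  \<open>r - N\<close>, roughly -aN, and leave every fixed window because \<open>a > 0\<close>.
  Third, the measure is given only through its generating function on the torus, as a possibly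
  infinite Schur expansion; it has to be identified with the normalised array count before any of
  the algebra applies to it.\<close>

definition ddet :: "nat \<Rightarrow> (nat \<Rightarrow> nat \<Rightarrow> complex) \<Rightarrow> complex" where
  "ddet n f = Determinant.det (Matrix.mat n n (\<lambda>(i,j). f i j))"

lemma ddet_Leibniz:
  "ddet n f = (\<Sum>p | p permutes {0..<n}. of_int (sign p) * (\<Prod>i = 0..<n. f i (p i)))"
  unfolding ddet_def
  by (subst det_def'[where n=n])
     (auto intro!: sum.cong prod.cong arg_cong2[where f="(*)"] simp: permutes_in_image)

lemma ddet_Leibniz_transpose:
  "ddet n f = (\<Sum>p | p permutes {0..<n}. of_int (sign p) * (\<Prod>i = 0..<n. f (p i) i))"
proof -
  have "ddet n f = Determinant.det (transpose_mat (Matrix.mat n n (\<lambda>(i,j). f i j)))"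
    unfolding ddet_def by (subst det_transpose[where n=n]) auto
  also have "\<dots> = ddet n (\<lambda>i j. f j i)"
    unfolding ddet_def by (rule arg_cong[where f=Determinant.det]) (auto intro!: eq_matI)
  finally show ?thesis unfolding ddet_Leibniz .
qed

lemma ddet_cong:
  assumes "\<And>i j. i < n \<Longrightarrow> j < n \<Longrightarrow> f i j = g i j"
  shows "ddet n f = ddet n g"
  unfolding ddet_def by (rule arg_cong[where f=Determinant.det]) (auto intro!: eq_matI assms)

lemma ddet_row_linear:
  assumes "i < n"
  shows "ddet n (f(i := \<lambda>j. a * u j + b * v j)) = a * ddet n (f(i := u)) + b * ddet n (f(i := v))"
proof -
  have split: "(\<Prod>k = 0..<n. (f(i := w)) k (p k)) = w (p i) * (\<Prod>k \<in> {0..<n} - {i}. f k (p k))" for w p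
    using assms by (subst prod.remove[where x=i]) (auto intro!: prod.cong)
  show ?thesis
    unfolding ddet_Leibniz split
    by (simp add: sum_distrib_left sum.distrib[symmetric] algebra_simps)
qed

lemma ddet_swap:
  assumes "p < n" "q < n" "p \<noteq> q"
  shows "ddet n (f \<circ> Transposition.transpose p q) = - ddet n f"
proof -
  let ?A = "Matrix.mat n n (\<lambda>(i,j). f i j)"
  have "ddet n (f \<circ> Transposition.transpose p q) = Determinant.det (swaprows p q ?A)"
    unfolding ddet_def
    by (rule arg_cong[where f=Determinant.det])
       (use assms in \<open>auto intro!: eq_matI simp: Transposition.transpose_def\<close>)
  also have "\<dots> = - Determinant.det ?A"
    using assms by (intro det_swaprows) auto
  finally show ?thesis by (simp add: ddet_def)
qed

lemma ddet_mult:
  "ddet n (\<lambda>i j. \<Sum>k<n. f i k * b k j) = ddet n f * ddet n b"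
proof -
  let ?A = "Matrix.mat n n (\<lambda>(i,j). f i j)" and ?B = "Matrix.mat n n (\<lambda>(i,j). b i j)"
  have "Matrix.mat n n (\<lambda>(i,j). \<Sum>k<n. f i k * b k j) = ?A * ?B"
    by (auto intro!: eq_matI simp: scalar_prod_def atLeast0LessThan)
  then show ?thesis
    unfolding ddet_def by (simp add: Determinant.det_mult[where n=n])
qed

text \<open>The reason is \<open>f \<cdot> adj f = det f \<cdot> 1\<close>.\<close>
lemma ddet_trace:
  "(\<Sum>i<n. ddet n (f(i := \<lambda>j. \<Sum>k<n. f i k * a k j))) = (\<Sum>k<n. a k k) * ddet n f"
proof -
  let ?A = "Matrix.mat n n (\<lambda>(i,j). f i j)"
  have A: "?A \<in> carrier_mat n n" by auto
  have exp: "ddet n (f(i := u)) = (\<Sum>j<n. u j * cofactor ?A i j)" if "i < n" for i u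
  proof -
    let ?B = "Matrix.mat n n (\<lambda>(i',j). (f(i := u)) i' j)"
    have "Determinant.det ?B = (\<Sum>j<n. ?B $$ (i,j) * cofactor ?B i j)"
      by (rule laplace_expansion_row[OF _ that]) auto
    also have "\<dots> = (\<Sum>j<n. u j * cofactor ?A i j)"
    proof (intro sum.cong refl)
      fix j assume "j \<in> {..<n}"
      have "mat_delete ?B i j = mat_delete ?A i j"
        using that by (auto intro!: eq_matI simp: mat_delete_def)
      then show "?B $$ (i,j) * cofactor ?B i j = u j * cofactor ?A i j"
        using that \<open>j \<in> _\<close> by (simp add: cofactor_def)
    qed
    finally show ?thesis by (simp add: ddet_def)
  qed
  have adj: "(\<Sum>i<n. f i k * cofactor ?A i j) = (if k = j then ddet n f else 0)"
    if "k < n" "j < n" for k j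
  proof -
    have "(adj_mat ?A * ?A) $$ (j,k) = (Determinant.det ?A \<cdot>\<^sub>m 1\<^sub>m n) $$ (j,k)"
      using adj_mat(3)[OF A] by simp
    moreover have "(adj_mat ?A * ?A) $$ (j,k) = (\<Sum>i<n. f i k * cofactor ?A i j)"
      using that by (simp add: adj_mat_def scalar_prod_def atLeast0LessThan mult.commute)
    ultimately show ?thesis using that by (auto simp: ddet_def)
  qed
  have "(\<Sum>i<n. ddet n (f(i := \<lambda>j. \<Sum>k<n. f i k * a k j)))
      = (\<Sum>i<n. \<Sum>j<n. \<Sum>k<n. a k j * (f i k * cofactor ?A i j))"
    by (intro sum.cong refl) (simp add: exp sum_distrib_right sum_distrib_left mult_ac)
  also have "\<dots> = (\<Sum>j<n. \<Sum>k<n. a k j * (\<Sum>i<n. f i k * cofactor ?A i j))"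
    by (subst sum.swap, rule sum.cong[OF refl], subst sum.swap) (simp add: sum_distrib_left)
  also have "\<dots> = (\<Sum>j<n. \<Sum>k<n. if k = j then a k j * ddet n f else 0)"
    by (intro sum.cong refl) (simp add: adj)
  also have "\<dots> = (\<Sum>k<n. a k k) * ddet n f"
    by (simp add: sum_distrib_right)
  finally show ?thesis .
qed

lemma ddet_last_row:
  assumes "\<And>j. j < n \<Longrightarrow> f n j = 0"
  shows "ddet (Suc n) f = f n n * ddet n f"
proof -
  let ?A = "Matrix.mat (Suc n) (Suc n) (\<lambda>(i,j). f i j)"
  have "Determinant.det ?A = (\<Sum>j<Suc n. ?A $$ (n,j) * cofactor ?A n j)"
    by (rule laplace_expansion_row[where n="Suc n"]) auto
  also have "\<dots> = f n n * cofactor ?A n n"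
    by (simp add: assms)
  also have "cofactor ?A n n = ddet n f"
    unfolding cofactor_def ddet_def
    by (simp, rule arg_cong[where f=Determinant.det]) (auto intro!: eq_matI simp: mat_delete_def)
  finally show ?thesis by (simp add: ddet_def)
qed

text \<open>Subtracting from each column its right neighbour turns the last row of ones into (0,
  ..., 0, 1). Summation over interlacing entries produces exactly such differences of neighbouring
  columns.\<close>

lemma ddet_differences:
  "ddet (Suc n) (\<lambda>i j. if i < n then g i j else 1) = ddet n (\<lambda>i j. g i j - g i (Suc j))"
proof -
  let ?f = "\<lambda>i j. if i < n then g i j else 1"
  let ?b = "\<lambda>k j. if k = j then 1 else if k = Suc j then -1 else (0::complex)"
  have b: "ddet (Suc n) ?b = 1"
  proof -
    let ?B = "Matrix.mat (Suc n) (Suc n) (\<lambda>(i,j). ?b i j)"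
    have "Determinant.det ?B = prod_list (diag_mat ?B)"
      by (rule det_lower_triangular[where n="Suc n"]) auto
    also have "diag_mat ?B = replicate (Suc n) 1"
      by (rule nth_equalityI) (auto simp: diag_mat_def simp del: upt_Suc replicate_Suc)
    also have "prod_list \<dots> = 1" by (simp only: prod_list_replicate power_one)
    finally show ?thesis by (simp add: ddet_def)
  qed
  have sumb: "(\<Sum>k<Suc n. ?f i k * ?b k j) = (if j < n then ?f i j - ?f i (Suc j) else ?f i j)"
    if "j < Suc n" for i j
  proof -
    have "(\<Sum>k<Suc n. ?f i k * ?b k j)
        = (\<Sum>k<Suc n. (if k = j then ?f i k else 0) - (if k = Suc j then ?f i k else 0))"
      by (intro sum.cong) auto
    also have "\<dots> = (\<Sum>k<Suc n. (if k = j then ?f i k else 0)) - (\<Sum>k<Suc n. (if k = Suc j then ?f i k else 0))"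
      by (rule sum_subtractf)
    also have "\<dots> = (if j < n then ?f i j - ?f i (Suc j) else ?f i j)"
      using that by (simp only: sum.delta finite_lessThan) auto
    finally show ?thesis .
  qed
  have "ddet (Suc n) ?f = ddet (Suc n) (\<lambda>i j. \<Sum>k<Suc n. ?f i k * ?b k j)"
    by (simp only: ddet_mult b mult_1_right)
  also have "\<dots> = ddet (Suc n) (\<lambda>i j. if j < n then ?f i j - ?f i (Suc j) else ?f i j)"
    by (rule ddet_cong) (use sumb in auto)
  also have "\<dots> = ddet n (\<lambda>i j. g i j - g i (Suc j))"
    by (subst ddet_last_row) (auto intro!: ddet_cong)
  finally show ?thesis .
qed

subsection \<open>Operators acting on rows of a determinant\<close>

text \<open>Each pair is an operator, acting as a derivation on the rows, with a scalar that centres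
  it. The head of the list reaches the rows first, and the last entry stands next to
  \<open>D\<close>. The type of rows is left open because both polynomials and coordinate vectors
  occur.\<close>

fun theta :: "((nat \<Rightarrow> 'v) \<Rightarrow> complex) \<Rightarrow> nat \<Rightarrow> (('v \<Rightarrow> 'v) \<times> complex) list \<Rightarrow> (nat \<Rightarrow> 'v) \<Rightarrow> complex" where
  "theta D N [] us = D us"
| "theta D N (x # xs) us =
     (\<Sum>i<N. theta D N xs (us(i := fst x (us i)))) - snd x * theta D N xs us"

lemma theta_swap:
  assumes "\<And>us. D (us \<circ> Transposition.transpose p q) = - D us" and "p < N" "q < N"
  shows "theta D N xs (us \<circ> Transposition.transpose p q) = - theta D N xs us"
proof (induction xs arbitrary: us)
  case Nil
  show ?case by (simp only: theta.simps assms(1))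
next
  case (Cons x xs)
  let ?t = "Transposition.transpose p q"
  have bij: "bij_betw ?t {..<N} {..<N}"
    using assms by (intro bij_betwI[where g="?t"]) (auto simp: Transposition.transpose_def)
  have upd: "(us \<circ> ?t)(i := y) = us(?t i := y) \<circ> ?t" for i y
    by (auto simp: fun_eq_iff Transposition.transpose_def)
  have "(\<Sum>i<N. theta D N xs ((us \<circ> ?t)(i := fst x ((us \<circ> ?t) i))))
      = (\<Sum>i<N. - theta D N xs (us(?t i := fst x (us (?t i)))))"
    by (simp only: upd Cons.IH o_apply)
  also have "\<dots> = (\<Sum>i<N. - theta D N xs (us(i := fst x (us i))))"
    by (rule sum.reindex_bij_betw[OF bij, where g="\<lambda>i. - theta D N xs (us(i := fst x (us i)))"])
  also have "\<dots> = - (\<Sum>i<N. theta D N xs (us(i := fst x (us i))))"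
    by (rule sum_negf)
  finally show ?case
    by (simp only: theta.simps Cons.IH) simp
qed

lemma theta_alternating:
  assumes "\<And>us. D (us \<circ> Transposition.transpose p q) = - D us" and "p < N" "q < N" "us p = us q"
  shows "theta D N xs us = 0"
proof -
  have "us \<circ> Transposition.transpose p q = us"
    using assms(4) by (auto simp: fun_eq_iff Transposition.transpose_def)
  then show ?thesis using theta_swap[of D p q N xs us] assms(1-3) by simp
qed

lemma theta_zero_row:
  assumes "\<And>us. us i = z \<Longrightarrow> D us = 0" "\<And>x. x \<in> set xs \<Longrightarrow> fst x z = z" "us i = z"
  shows "theta D N xs us = 0"
  using assms(2,3)
proof (induction xs arbitrary: us)
  case Nil
  then show ?case using assms(1) by simp
next
  case (Cons x xs)
  have fx: "fst x z = z" by (rule Cons.prems(1)) simp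
  have "theta D N xs (us(k := fst x (us k))) = 0" for k
    by (rule Cons.IH, rule Cons.prems(1)) (use fx Cons.prems(2) in auto)
  then show ?case using Cons by simp
qed

text \<open>Operators acting on different rows commute, and so do the scalars. The only discrepancy
  comes from both operators meeting the same row, which is the derivation induced by their
  commutator.\<close>

lemma theta_Cons_Cons:
  "theta D N (x # y # xs) us - theta D N (y # x # xs) us =
   (\<Sum>i<N. theta D N xs (us(i := fst y (fst x (us i)))) - theta D N xs (us(i := fst x (fst y (us i)))))"
proof -
  let ?f = "fst x" and ?g = "fst y"
  let ?T = "theta D N xs"
  have expand: "theta D N (x # y # xs) us =
      (\<Sum>i<N. \<Sum>k<N. ?T (us(i := fst x (us i), k := fst y ((us(i := fst x (us i))) k))))
      - snd y * (\<Sum>i<N. ?T (us(i := fst x (us i))))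
      - snd x * (\<Sum>i<N. ?T (us(i := fst y (us i)))) + snd x * snd y * ?T us" for x y
    by (simp add: sum_subtractf sum_distrib_left algebra_simps)
  have split: "(\<Sum>i<N. \<Sum>k<N. h i k) = (\<Sum>i<N. \<Sum>k<N. if k = i then 0 else h i k) + (\<Sum>i<N. h i i)" 
    for h :: "nat \<Rightarrow> nat \<Rightarrow> complex"
  proof -
    have "(\<Sum>k<N. h i k) = (\<Sum>k<N. if k = i then 0 else h i k) + h i i" if "i < N" for i
    proof -
      have "(\<Sum>k<N. h i k) = (\<Sum>k<N. (if k = i then 0 else h i k) + (if k = i then h i k else 0))"
        by (intro sum.cong) auto
      also have "\<dots> = (\<Sum>k<N. if k = i then 0 else h i k) + h i i"
        using that by (simp add: sum.distrib)
      finally show ?thesis .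
    qed
    then show ?thesis by (simp add: sum.distrib)
  qed
  define F where "F x y = (\<lambda>i k. ?T (us(i := fst x (us i), k := fst y ((us(i := fst x (us i))) k))))" for x y :: "('a \<Rightarrow> 'a) \<times> complex"
  have off: "(\<Sum>i<N. \<Sum>k<N. if k = i then 0 else F x y i k) = (\<Sum>i<N. \<Sum>k<N. if k = i then 0 else F y x i k)"
    unfolding F_def by (subst sum.swap, intro sum.cong refl) (auto simp: fun_upd_twist)
  have "(\<Sum>i<N. \<Sum>k<N. F x y i k) - (\<Sum>i<N. \<Sum>k<N. F y x i k) = (\<Sum>i<N. F x y i i) - (\<Sum>i<N. F y x i i)"
    using split[of "F x y"] split[of "F y x"] off by simp
  moreover have "theta D N (x # y # xs) us - theta D N (y # x # xs) us =
      (\<Sum>i<N. \<Sum>k<N. F x y i k) - (\<Sum>i<N. \<Sum>k<N. F y x i k)"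
    unfolding expand F_def by simp
  ultimately show ?thesis
    unfolding F_def by (simp add: sum_subtractf)
qed

section \<open>Matrices indexed by the energy levels\<close>

type_synonym zmat = "int \<Rightarrow> int \<Rightarrow> complex"

text \<open>Restricting the sum to the joint support keeps the product total; a sum over an infinite
  set is 0, so the laws below ask for finite support. The first index of a matrix is the target
  level, the second the source.\<close>

definition zapply :: "zmat \<Rightarrow> (int \<Rightarrow> complex) \<Rightarrow> int \<Rightarrow> complex" where
  "zapply A u m = (\<Sum>p\<in>{p. A m p \<noteq> 0 \<and> u p \<noteq> 0}. A m p * u p)"

definition zmult :: "zmat \<Rightarrow> zmat \<Rightarrow> zmat" where
  "zmult A B m n = zapply A (\<lambda>p. B p n) m"

definition zcom :: "zmat \<Rightarrow> zmat \<Rightarrow> zmat" where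
  "zcom A B m n = zmult A B m n - zmult B A m n"

definition raising :: "zmat \<Rightarrow> zmat" where
  "raising A m n = (if n < m then A m n else 0)"

text \<open>The diagonal belongs to this half, where the filled rows absorb it into the vacuum
  trace, see \<open>centred_first_lowering\<close>.\<close>

definition lowering :: "zmat \<Rightarrow> zmat" where
  "lowering A m n = (if m \<le> n then A m n else 0)"

text \<open>The Schwinger term: \<open>A\<close> lifts a particle from a filled level
  \<open>n < 0\<close> to an empty level \<open>p\<close>, and \<open>B\<close> returns it.\<close>

definition pair_trace :: "zmat \<Rightarrow> zmat \<Rightarrow> complex" where
  "pair_trace A B = (\<Sum>(n,p)\<in>{(n,p). n < 0 \<and> 0 \<le> p \<and> A p n \<noteq> 0 \<and> B n p \<noteq> 0}. B n p * A p n)"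

text \<open>Moving the raising part of the first operator past the others to the end where it vanishes leaves
  commutators, re-centred at the cost of their vacuum traces \<open>pair_trace\<close>; see \<open>centred_eq_cumG\<close>.\<close>
function cumG :: "zmat list \<Rightarrow> complex" where
  "cumG [] = 1"
| "cumG (A # As) = (\<Sum>j<length As. cumG (As[j := zcom (As ! j) (raising A)]) +
      pair_trace A (As ! j) * cumG (take j As @ drop (Suc j) As))"
  by pat_completeness auto
termination by (relation "Wellfounded.measure length") auto

lemma zapply_nonzero: "zapply A u m \<noteq> 0 \<Longrightarrow> \<exists>p. A m p \<noteq> 0 \<and> u p \<noteq> 0"
  unfolding zapply_def by (metis (mono_tags, lifting) empty_Collect_eq sum.empty)

lemma zapply_superset:
  assumes "finite F" "\<And>p. p \<notin> F \<Longrightarrow> A m p = 0 \<or> u p = 0"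
  shows "zapply A u m = (\<Sum>p\<in>F. A m p * u p)"
  unfolding zapply_def
  by (rule sum.mono_neutral_left) (use assms in auto)

abbreviation fsupp :: "(int \<Rightarrow> complex) \<Rightarrow> bool" where
  "fsupp u \<equiv> finite {p. u p \<noteq> 0}"

lemma zapply_eq: "fsupp u \<Longrightarrow> zapply A u m = (\<Sum>p | u p \<noteq> 0. A m p * u p)"
  by (rule zapply_superset) auto

lemma zapply_comb:
  assumes "fsupp u" "fsupp v"
  shows "zapply A (\<lambda>m. a * u m + b * v m) = (\<lambda>m. a * zapply A u m + b * zapply A v m)"
proof
  fix m
  let ?F = "{p. u p \<noteq> 0} \<union> {p. v p \<noteq> 0}"
  have F: "finite ?F" using assms by simp
  have *: "zapply A w m = (\<Sum>p\<in>?F. A m p * w p)" if "\<And>p. p \<notin> ?F \<Longrightarrow> w p = 0" for w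
    by (rule zapply_superset[OF F]) (use that in auto)
  show "zapply A (\<lambda>m. a * u m + b * v m) m = a * zapply A u m + b * zapply A v m"
    by (subst (1 2 3) *) (auto simp: sum_distrib_left sum.distrib algebra_simps)
qed

text \<open>Finite columns keep vectors finitely supported, so that matrix products act as
  compositions. The level \<open>- int N\<close> is that of the constant polynomials, the lowest
  one.\<close>

definition cutmat :: "nat \<Rightarrow> zmat \<Rightarrow> bool" where
  "cutmat N A \<longleftrightarrow> (\<forall>n. finite {m. A m n \<noteq> 0}) \<and> (\<forall>m n. A m n \<noteq> 0 \<longrightarrow> - int N \<le> m \<and> - int N \<le> n)"

lemma cutmat_col: "cutmat N A \<Longrightarrow> fsupp (\<lambda>m. A m n)"
  by (simp add: cutmat_def)

lemma fsupp_zapply: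
  assumes "cutmat N A" "fsupp u"
  shows "fsupp (zapply A u)"
proof (rule finite_subset)
  show "{m. zapply A u m \<noteq> 0} \<subseteq> (\<Union>p\<in>{p. u p \<noteq> 0}. {m. A m p \<noteq> 0})"
  proof
    fix m assume "m \<in> {m. zapply A u m \<noteq> 0}"
    then obtain p where "A m p \<noteq> 0" "u p \<noteq> 0" using zapply_nonzero by blast
    then show "m \<in> (\<Union>p\<in>{p. u p \<noteq> 0}. {m. A m p \<noteq> 0})" by auto
  qed
  show "finite (\<Union>p\<in>{p. u p \<noteq> 0}. {m. A m p \<noteq> 0})"
    using assms by (auto simp: cutmat_def)
qed

lemma zapply_zmult:
  assumes "cutmat N B" "fsupp u"
  shows "zapply (zmult A B) u = zapply A (zapply B u)"
proof
  fix m
  let ?U = "{p. u p \<noteq> 0}"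
  let ?F = "\<Union>p\<in>?U. {m. B m p \<noteq> 0}"
  have fin: "finite ?U" "finite ?F" using assms by (auto simp: cutmat_def)
  have "zapply (zmult A B) u m = (\<Sum>n\<in>?U. zmult A B m n * u n)"
    by (rule zapply_eq[OF assms(2)])
  also have "\<dots> = (\<Sum>n\<in>?U. (\<Sum>p\<in>?F. A m p * B p n) * u n)"
    unfolding zmult_def by (intro sum.cong refl arg_cong2[where f="(*)"] zapply_superset fin) auto
  also have "\<dots> = (\<Sum>p\<in>?F. A m p * (\<Sum>n\<in>?U. B p n * u n))"
    by (simp add: sum_distrib_right sum_distrib_left, subst sum.swap) (simp add: mult_ac)
  also have "\<dots> = (\<Sum>p\<in>?F. A m p * zapply B u p)"
    by (simp add: zapply_eq[OF assms(2)])
  also have "\<dots> = zapply A (zapply B u) m"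
  proof (rule zapply_superset[symmetric, OF fin(2)])
    fix p assume "p \<notin> ?F"
    then show "A m p = 0 \<or> zapply B u p = 0" using zapply_nonzero[of B u p] by blast
  qed
  finally show "zapply (zmult A B) u m = zapply A (zapply B u) m" .
qed

lemma zapply_zcom:
  assumes "cutmat N A" "cutmat N B" "fsupp u"
  shows "zapply (zcom A B) u = (\<lambda>m. zapply A (zapply B u) m - zapply B (zapply A u) m)"
proof
  fix m
  have "zapply (zcom A B) u m = zapply (zmult A B) u m - zapply (zmult B A) u m"
    unfolding zapply_eq[OF assms(3)] zcom_def by (simp add: sum_subtractf algebra_simps)
  then show "zapply (zcom A B) u m = zapply A (zapply B u) m - zapply B (zapply A u) m"
    using assms by (simp add: zapply_zmult)
qed

lemma cutmat_zmult:
  assumes "cutmat N A" "cutmat N B"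
  shows "cutmat N (zmult A B)"
  unfolding cutmat_def
proof (intro conjI allI impI)
  fix n show "finite {m. zmult A B m n \<noteq> 0}"
    unfolding zmult_def using fsupp_zapply[OF assms(1) cutmat_col[OF assms(2), of n]] .
next
  fix m n assume "zmult A B m n \<noteq> 0"
  then obtain p where "A m p \<noteq> 0" "B p n \<noteq> 0"
    unfolding zmult_def using zapply_nonzero by blast
  then show "- int N \<le> m" "- int N \<le> n" using assms by (auto simp: cutmat_def)
qed

lemma cutmat_zcom:
  assumes "cutmat N A" "cutmat N B"
  shows "cutmat N (zcom A B)"
proof -
  have "finite {m. zcom A B m n \<noteq> 0}" for n
    by (rule finite_subset[of _ "{m. zmult A B m n \<noteq> 0} \<union> {m. zmult B A m n \<noteq> 0}"])
       (use cutmat_zmult[OF assms] cutmat_zmult[OF assms(2,1)] in \<open>auto simp: zcom_def cutmat_def\<close>)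
  moreover have "zcom A B m n \<noteq> 0 \<Longrightarrow> zmult A B m n \<noteq> 0 \<or> zmult B A m n \<noteq> 0" for m n
    by (auto simp: zcom_def)
  ultimately show ?thesis
    using cutmat_zmult[OF assms] cutmat_zmult[OF assms(2,1)] unfolding cutmat_def by blast
qed

lemma cutmat_raising: "cutmat N A \<Longrightarrow> cutmat N (raising A)"
  unfolding cutmat_def raising_def by (auto elim!: rev_finite_subset)

lemma cutmat_lowering: "cutmat N A \<Longrightarrow> cutmat N (lowering A)"
  unfolding cutmat_def lowering_def by (auto elim!: rev_finite_subset)

section \<open>The vacuum functional and centred operators\<close>

definition vac_trace :: "nat \<Rightarrow> zmat \<Rightarrow> complex" where
  "vac_trace N A = (\<Sum>j<N. A (-1 - int j) (-1 - int j))"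

text \<open>The coefficient of the filled levels -1, ..., -N in the wedge product of the rows:
  \<open>us\<close> is a state of \<open>N\<close> fermions, paired with the vacuum.\<close>

definition vac_det :: "nat \<Rightarrow> (nat \<Rightarrow> int \<Rightarrow> complex) \<Rightarrow> complex" where
  "vac_det N us = ddet N (\<lambda>i j. us i (-1 - int j))"

definition centred :: "nat \<Rightarrow> zmat list \<Rightarrow> (nat \<Rightarrow> int \<Rightarrow> complex) \<Rightarrow> complex" where
  "centred N As us = theta (vac_det N) N (map (\<lambda>A. (zapply A, vac_trace N A)) As) us"

lemma centred_Nil: "centred N [] us = vac_det N us"
  by (simp add: centred_def)

lemma centred_Cons: "centred N (A # As) us = (\<Sum>i<N. centred N As (us(i := zapply A (us i)))) - vac_trace N A * centred N As us"
  by (simp add: centred_def)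

lemma vac_det_swap: "p < N \<Longrightarrow> q < N \<Longrightarrow> p \<noteq> q \<Longrightarrow> vac_det N (us \<circ> Transposition.transpose p q) = - vac_det N us"
  unfolding vac_det_def using ddet_swap[of p N q "\<lambda>i j. us i (-1 - int j)"] by (simp add: comp_def)

lemma centred_alternating: "p < N \<Longrightarrow> q < N \<Longrightarrow> p \<noteq> q \<Longrightarrow> us p = us q \<Longrightarrow> centred N As us = 0"
  unfolding centred_def using theta_alternating[of "vac_det N" p q N us] vac_det_swap by blast

lemma vac_det_linear:
  assumes "i < N"
  shows "vac_det N (us(i := \<lambda>m. a * u m + b * v m)) = a * vac_det N (us(i := u)) + b * vac_det N (us(i := v))"
proof -
  have *: "(\<lambda>k j. (us(i := w)) k (-1 - int j)) = (\<lambda>k j. us k (-1 - int j))(i := \<lambda>j. w (-1 - int j))" for w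
    by (auto simp: fun_eq_iff)
  show ?thesis unfolding vac_det_def * by (rule ddet_row_linear[OF assms])
qed

lemma centred_linear:
  assumes "i < N" "\<And>A. A \<in> set As \<Longrightarrow> cutmat N A" "fsupp u" "fsupp v"
  shows "centred N As (us(i := \<lambda>m. a * u m + b * v m)) = a * centred N As (us(i := u)) + b * centred N As (us(i := v))"
  using assms(2-4)
proof (induction As arbitrary: us u v)
  case Nil
  show ?case unfolding centred_Nil by (rule vac_det_linear[OF assms(1)])
next
  case (Cons A As)
  have A: "cutmat N A" using Cons.prems by simp
  note fa = fsupp_zapply[OF A]
  have IH: "centred N As (us(i := \<lambda>m. a * u m + b * v m)) = a * centred N As (us(i := u)) + b * centred N As (us(i := v))"
    if "fsupp u" "fsupp v" for us u v
    by (rule Cons.IH) (use Cons.prems that in auto)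
  have step: "centred N As (us(i := w, k := zapply A ((us(i := w)) k))) =
      (if k = i then centred N As (us(i := zapply A w)) else centred N As ((us(k := zapply A (us k)))(i := w)))" for k w
    by (auto simp: fun_upd_twist)
  let ?w = "\<lambda>m. a * u m + b * v m"
  have "(\<Sum>k<N. centred N As (us(i := ?w, k := zapply A ((us(i := ?w)) k)))) =
     (\<Sum>k<N. a * centred N As (us(i := u, k := zapply A ((us(i := u)) k)))
            + b * centred N As (us(i := v, k := zapply A ((us(i := v)) k))))"
  proof (intro sum.cong refl)
    fix k
    show "centred N As (us(i := ?w, k := zapply A ((us(i := ?w)) k))) =
      a * centred N As (us(i := u, k := zapply A ((us(i := u)) k))) + b * centred N As (us(i := v, k := zapply A ((us(i := v)) k)))"
      unfolding step zapply_comb[OF Cons.prems(2,3)]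
      by (cases "k = i") (simp_all only: simp_thms if_True if_False IH Cons.prems(2,3) fa)
  qed
  then show ?case
    unfolding centred_Cons IH[OF Cons.prems(2,3)]
    by (simp add: sum.distrib sum_distrib_left algebra_simps)
qed

subsection \<open>Vacuum expectations\<close>

lemma centred_add_zapply:
  assumes "\<And>A. A \<in> set As \<Longrightarrow> cutmat N A" "i < N" "fsupp u" "fsupp v"
  shows "centred N As (us(i := \<lambda>m. u m + v m)) = centred N As (us(i := u)) + centred N As (us(i := v))"
    and "centred N As (us(i := \<lambda>m. u m - v m)) = centred N As (us(i := u)) - centred N As (us(i := v))"
  using centred_linear[OF assms(2,1,3,4), where us=us and a=1 and b=1] centred_linear[OF assms(2,1,3,4), where us=us and a=1 and b="-1"] by simp_all

text \<open>The commutator appears as \<open>zcom B A\<close> because the head acts on the rows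
  first. As an entry of the list it is centred as well; the last summand gives back the vacuum trace
  subtracted thereby.\<close>

lemma centred_exchange:
  assumes "\<And>C. C \<in> set (A # B # As) \<Longrightarrow> cutmat N C" "\<And>i. i < N \<Longrightarrow> fsupp (us i)"
  shows "centred N (A # B # As) us = centred N (B # A # As) us + centred N (zcom B A # As) us + vac_trace N (zcom B A) * centred N As us"
proof -
  have A: "cutmat N A" and B: "cutmat N B" using assms by auto
  have "centred N (A # B # As) us - centred N (B # A # As) us
      = (\<Sum>i<N. centred N As (us(i := zapply B (zapply A (us i)))) - centred N As (us(i := zapply A (zapply B (us i)))))"
    unfolding centred_def by (simp only: list.map theta_Cons_Cons fst_conv)
  also have "\<dots> = (\<Sum>i<N. centred N As (us(i := zapply (zcom B A) (us i))))"
  proof (intro sum.cong refl)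
    fix i assume i: "i \<in> {..<N}"
    show "centred N As (us(i := zapply B (zapply A (us i)))) - centred N As (us(i := zapply A (zapply B (us i)))) =
       centred N As (us(i := zapply (zcom B A) (us i)))"
      unfolding zapply_zcom[OF B A assms(2)[OF lessThan_iff[THEN iffD1, OF i]]]
      by (rule centred_add_zapply(2)[symmetric])
         (use i assms in \<open>auto intro!: fsupp_zapply[OF A] fsupp_zapply[OF B]\<close>)
  qed
  finally have E: "centred N (A # B # As) us - centred N (B # A # As) us = (\<Sum>i<N. centred N As (us(i := zapply (zcom B A) (us i))))" .
  have gen: "a - b = s \<Longrightarrow> a = b + (s - t) + t" for a b s t :: complex by (simp add: algebra_simps)
  show ?thesis unfolding centred_Cons[of N "zcom B A"] by (rule gen[OF E])
qed

text \<open>Iterated exchange: passing an entry leaves a commutator in its place, plus a scalar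
  multiple of the list without that entry.\<close>

lemma centred_move_last:
  assumes "\<And>C. C \<in> set (A # As) \<Longrightarrow> cutmat N C" "\<And>i. i < N \<Longrightarrow> fsupp (us i)"
  shows "centred N (A # As) us = centred N (As @ [A]) us +
    (\<Sum>j<length As. centred N (As[j := zcom (As ! j) A]) us
        + vac_trace N (zcom (As ! j) A) * centred N (take j As @ drop (Suc j) As) us)"
  using assms
proof (induction As arbitrary: us)
  case Nil
  then show ?case by simp
next
  case (Cons B As)
  have A: "cutmat N A" and B: "cutmat N B" using Cons.prems by auto
  define R where "R us = (\<Sum>j<length As. centred N (As[j := zcom (As ! j) A]) us
        + vac_trace N (zcom (As ! j) A) * centred N (take j As @ drop (Suc j) As) us)" for us
  have IH: "centred N (A # As) us = centred N (As @ [A]) us + R us" if "\<And>i. i < N \<Longrightarrow> fsupp (us i)" for us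
    unfolding R_def by (rule Cons.IH) (use Cons.prems that in auto)
  have upd: "fsupp ((us(i := zapply B (us i))) k)" if "i < N" "k < N" for i k
    using Cons.prems(2) that fsupp_zapply[OF B] by auto
  have "centred N (B # A # As) us = (\<Sum>i<N. centred N (As @ [A]) (us(i := zapply B (us i))) + R (us(i := zapply B (us i))))
       - vac_trace N B * (centred N (As @ [A]) us + R us)"
    unfolding centred_Cons[of N B]
  proof (intro arg_cong2[where f="(-)"] arg_cong2[where f="(*)"] sum.cong refl IH)
    show "fsupp ((us(i := zapply B (us i))) k)" if "i \<in> {..<N}" "k < N" for i k
      using upd that by blast
  qed (use Cons.prems(2) in blast)
  also have "\<dots> = centred N ((B # As) @ [A]) us + ((\<Sum>i<N. R (us(i := zapply B (us i)))) - vac_trace N B * R us)"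
    by (simp add: centred_Cons sum.distrib algebra_simps)
  also have "(\<Sum>i<N. R (us(i := zapply B (us i)))) - vac_trace N B * R us =
     (\<Sum>j<length As. centred N (B # As[j := zcom (As ! j) A]) us
        + vac_trace N (zcom (As ! j) A) * centred N (B # (take j As @ drop (Suc j) As)) us)"
    unfolding R_def sum.swap[of _ "{..<length As}" "{..<N}"] centred_Cons
    by (simp add: sum_distrib_left sum_subtractf sum.distrib algebra_simps)
  finally have "centred N (B # A # As) us = \<dots> + centred N ((B # As) @ [A]) us" by simp
  moreover have "centred N (A # B # As) us = centred N (B # A # As) us + centred N (zcom B A # As) us + vac_trace N (zcom B A) * centred N As us"
    by (rule centred_exchange) (use Cons.prems in auto)
  moreover have "(\<Sum>j<length (B # As). centred N ((B # As)[j := zcom ((B # As) ! j) A]) us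
        + vac_trace N (zcom ((B # As) ! j) A) * centred N (take j (B # As) @ drop (Suc j) (B # As)) us)
    = centred N (zcom B A # As) us + vac_trace N (zcom B A) * centred N As us +
      (\<Sum>j<length As. centred N (B # As[j := zcom (As ! j) A]) us
        + vac_trace N (zcom (As ! j) A) * centred N (B # (take j As @ drop (Suc j) As)) us)"
    unfolding list.size add_0_right add_Suc_right sum.lessThan_Suc_shift by simp
  ultimately show ?case by simp
qed

text \<open>The last entry stands next to the vacuum functional. Read at a filled level,
  \<open>raising A\<close> draws only on lower, hence filled, levels, so it acts on the
  \<open>N\<close> coordinates by a strictly triangular matrix. Its trace, all that
  \<open>ddet_trace\<close> sees, is 0.\<close>

lemma centred_last_raising:
  assumes "cutmat N A"
  shows "centred N (As @ [raising A]) us = 0"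
proof (induction As arbitrary: us)
  case Nil
  have zapply_row: "zapply (raising A) u (-1 - int j) = (\<Sum>k<N. u (-1 - int k) * raising A (-1 - int j) (-1 - int k))"
    if "j < N" for u j
  proof -
    have inj: "inj_on (\<lambda>k. -1 - int k) {..<N}" by (auto simp: inj_on_def)
    have "zapply (raising A) u (-1 - int j) = (\<Sum>p\<in>(\<lambda>k. -1 - int k) ` {..<N}. raising A (-1 - int j) p * u p)"
    proof (rule zapply_superset)
      fix p assume p: "p \<notin> (\<lambda>k. -1 - int k) ` {..<N}"
      have "raising A (-1 - int j) p = 0"
      proof (rule ccontr)
        assume "raising A (-1 - int j) p \<noteq> 0"
        then have "p < -1 - int j" "- int N \<le> p" using assms by (auto simp: raising_def cutmat_def split: if_splits)
        then have "p = -1 - int (nat (-1 - p))" "nat (-1 - p) < N" by auto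
        with p show False by blast
      qed
      then show "raising A (-1 - int j) p = 0 \<or> u p = 0" ..
    qed auto
    then show ?thesis by (simp add: sum.reindex[OF inj] mult.commute)
  qed
  have "(\<Sum>i<N. vac_det N (us(i := zapply (raising A) (us i)))) =
     (\<Sum>i<N. ddet N ((\<lambda>i j. us i (-1 - int j))(i := \<lambda>j. \<Sum>k<N. us i (-1 - int k) * raising A (-1 - int j) (-1 - int k))))"
    unfolding vac_det_def by (intro sum.cong refl ddet_cong) (auto simp: zapply_row)
  also have "\<dots> = (\<Sum>k<N. raising A (-1 - int k) (-1 - int k)) * vac_det N us"
    unfolding vac_det_def by (rule ddet_trace)
  also have "(\<Sum>k<N. raising A (-1 - int k) (-1 - int k)) = 0" by (simp add: raising_def)
  finally have E: "(\<Sum>i<N. vac_det N (us(i := zapply (raising A) (us i)))) = 0 * vac_det N us" .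
  have "vac_trace N (raising A) = 0" by (simp add: vac_trace_def raising_def)
  then show ?case unfolding append_Nil centred_Cons centred_Nil E by simp
next
  case (Cons B As)
  then show ?case by (simp add: centred_Cons)
qed

text \<open>Row \<open>i\<close> has top level exactly \<open>-1 - i\<close>, so the final rows span
  the lowest levels. Polynomials of descending degrees look like this in coordinates.\<close>

definition flag_rows :: "nat \<Rightarrow> (nat \<Rightarrow> int \<Rightarrow> complex) \<Rightarrow> bool" where
  "flag_rows N v \<longleftrightarrow> (\<forall>i<N. v i (-1 - int i) \<noteq> 0 \<and> (\<forall>m. v i m \<noteq> 0 \<longrightarrow> - int N \<le> m \<and> m \<le> -1 - int i))"

lemma flag_rows_fsupp: "flag_rows N v \<Longrightarrow> i < N \<Longrightarrow> fsupp (v i)"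
  unfolding flag_rows_def
  by (rule finite_subset[of _ "{- int N..-1 - int i}"]) auto

text \<open>The rows after \<open>j\<close> span everything under level \<open>-1 - j\<close>.
  Expanding \<open>u\<close> in them puts a copy of another row into slot \<open>i\<close>, and the
  functional alternates. The induction strips off the top level of \<open>u\<close>.\<close>

lemma centred_lower_row:
  assumes v: "flag_rows N v" and As: "\<And>A. A \<in> set As \<Longrightarrow> cutmat N A"
    and i: "i < N" "i \<le> j" and u: "\<And>m. u m \<noteq> 0 \<Longrightarrow> - int N \<le> m \<and> m < -1 - int j"
  shows "centred N As (v(i := u)) = 0"
  using i(2) u
proof (induction "N - 1 - j" arbitrary: j u)
  case 0
  then have eq: "u = (\<lambda>m. 0 * v i m + 0 * v i m)" using i by (force simp: fun_eq_iff)
  have "centred N As (v(i := \<lambda>m. 0 * v i m + 0 * v i m)) = 0 * centred N As (v(i := v i)) + 0 * centred N As (v(i := v i))"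
    using flag_rows_fsupp[OF v i(1)] by (intro centred_linear i(1) As)
  then show ?case by (subst eq) (simp only: mult_zero_left add_0)
next
  case (Suc d)
  then have j: "Suc j < N" by simp
  let ?t = "-2 - int j"
  define c where "c = u ?t / v (Suc j) ?t"
  define w where "w = (\<lambda>m. u m - c * v (Suc j) m)"
  have vj: "v (Suc j) ?t \<noteq> 0" "\<And>m. v (Suc j) m \<noteq> 0 \<Longrightarrow> - int N \<le> m \<and> m \<le> ?t"
  proof -
    have t: "-1 - int (Suc j) = ?t" by simp
    show "v (Suc j) ?t \<noteq> 0" "\<And>m. v (Suc j) m \<noteq> 0 \<Longrightarrow> - int N \<le> m \<and> m \<le> ?t"
      using v j unfolding flag_rows_def t[symmetric] by blast+
  qed
  have w: "- int N \<le> m \<and> m < -1 - int (Suc j)" if "w m \<noteq> 0" for m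
  proof -
    have "w ?t = 0" using vj by (simp add: w_def c_def)
    then have "m \<noteq> ?t" using that by blast
    moreover have "u m \<noteq> 0 \<or> v (Suc j) m \<noteq> 0" using that by (auto simp: w_def)
    then have "- int N \<le> m" "m \<le> ?t" using Suc.prems(2)[of m] vj(2)[of m] by auto
    ultimately show ?thesis by auto
  qed
  have fw: "fsupp w" by (rule finite_subset[of _ "{- int N..-1 - int (Suc j)}"]) (use w in force)+
  have eq: "u = (\<lambda>m. 1 * w m + c * v (Suc j) m)" by (simp add: w_def)
  have "centred N As (v(i := u)) = centred N As (v(i := w)) + c * centred N As (v(i := v (Suc j)))"
    unfolding eq by (subst centred_linear[OF i(1) As fw flag_rows_fsupp[OF v j]]) auto
  also have "centred N As (v(i := w)) = 0"
    by (rule Suc.hyps(1)[of "Suc j"]) (use Suc.hyps(2) Suc.prems(1) w in auto)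
  also have "centred N As (v(i := v (Suc j))) = 0"
    by (rule centred_alternating[of i N "Suc j"]) (use i j Suc.prems in auto)
  also have "0 + c * 0 = 0" by simp
  finally show ?case .
qed

text \<open>Lowering turns row \<open>i\<close> into a diagonal multiple of itself plus a vector
  under its top level, which contributes nothing by \<open>centred_lower_row\<close>. The diagonal
  multiples add up to the vacuum trace, and centring subtracts just that.\<close>

lemma centred_first_lowering:
  assumes v: "flag_rows N v" and A: "cutmat N A" and As: "\<And>A. A \<in> set As \<Longrightarrow> cutmat N A"
  shows "centred N (lowering A # As) v = 0"
proof -
  have "centred N As (v(i := zapply (lowering A) (v i))) = lowering A (-1 - int i) (-1 - int i) * centred N As v" if i: "i < N" for i
  proof -
    let ?t = "-1 - int i" and ?L = "zapply (lowering A) (v i)"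
    define c where "c = lowering A ?t ?t"
    define w where "w = (\<lambda>m. ?L m - c * v i m)"
    have vi: "v i ?t \<noteq> 0" "\<And>m. v i m \<noteq> 0 \<Longrightarrow> - int N \<le> m \<and> m \<le> ?t"
      using v i unfolding flag_rows_def by auto
    have Lsupp: "- int N \<le> m \<and> m \<le> ?t" if "?L m \<noteq> 0" for m
    proof -
      from zapply_nonzero[OF that] obtain p where "lowering A m p \<noteq> 0" "v i p \<noteq> 0" by blast
      then show ?thesis using A vi(2)[of p] by (auto simp: lowering_def cutmat_def split: if_splits)
    qed
    have Lt: "?L ?t = c * v i ?t"
    proof -
      have "?L ?t = (\<Sum>p\<in>{?t}. lowering A ?t p * v i p)"
        by (rule zapply_superset) (use vi(2) in \<open>force simp: lowering_def\<close>)+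
      then show ?thesis by (simp add: c_def)
    qed
    have w: "- int N \<le> m \<and> m < ?t" if "w m \<noteq> 0" for m
    proof -
      have "m \<noteq> ?t" using that Lt by (auto simp: w_def)
      moreover have "?L m \<noteq> 0 \<or> v i m \<noteq> 0" using that by (auto simp: w_def)
      ultimately show ?thesis using Lsupp[of m] vi(2)[of m] by force
    qed
    have fw: "fsupp w" by (rule finite_subset[of _ "{- int N..?t}"]) (use w in force)+
    have eq: "?L = (\<lambda>m. 1 * w m + c * v i m)" by (simp add: w_def)
    have "centred N As (v(i := ?L)) = 1 * centred N As (v(i := w)) + c * centred N As (v(i := v i))"
      by (subst eq, rule centred_linear[OF i As fw flag_rows_fsupp[OF v i]])
    also have "centred N As (v(i := w)) = 0"
      by (rule centred_lower_row[OF v As i order_refl w])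
    also have "v(i := v i) = v" by simp
    also have "1 * 0 + c * centred N As v = c * centred N As v" by simp
    finally show ?thesis unfolding c_def .
  qed
  then have "(\<Sum>i<N. centred N As (v(i := zapply (lowering A) (v i)))) = vac_trace N (lowering A) * centred N As v"
    unfolding vac_trace_def sum_distrib_right by (intro sum.cong refl) (simp only: lessThan_iff)
  then show ?thesis unfolding centred_Cons by (simp only: diff_self)
qed

text \<open>Among filled intermediate levels the two products have equal traces and cancel. Levels
  \<open>p \<ge> 0\<close> occur in one product only: the columns of \<open>raising A\<close> may
  leave the filled levels, but its filled rows never look above them.\<close>

lemma vac_trace_zcom_raising:
  assumes A: "cutmat N A" and B: "cutmat N B"
  shows "vac_trace N (zcom B (raising A)) = pair_trace A B"
proof -
  let ?U = "raising A"
  let ?I = "{- int N..-1}"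
  \<comment> \<open>The empty levels that \<open>A\<close> reaches from filled ones. There are
    finitely many, since finitely many columns are involved and each is finite.\<close>
  define J where "J = (\<Union>n\<in>?I. {p. A p n \<noteq> 0}) \<inter> {0..}"
  have finJ: "finite J" using A by (auto simp: J_def cutmat_def)
  have disj: "?I \<inter> J = {}" by (auto simp: J_def)
  have bij: "bij_betw (\<lambda>j. -1 - int j) {..<N} ?I"
    by (rule bij_betwI[where g="\<lambda>n. nat (-1 - n)"]) auto
  have tr: "vac_trace N M = (\<Sum>n\<in>?I. M n n)" for M
    unfolding vac_trace_def by (rule sum.reindex_bij_betw[OF bij, where g="\<lambda>n. M n n"])
  have 1: "zmult B ?U n n = (\<Sum>p\<in>?I. B n p * ?U p n) + (\<Sum>p\<in>J. B n p * A p n)" if "n \<in> ?I" for n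
  proof -
    have "zmult B ?U n n = (\<Sum>p\<in>?I \<union> J. B n p * ?U p n)"
      unfolding zmult_def
    proof (rule zapply_superset)
      fix p assume "p \<notin> ?I \<union> J"
      then show "B n p = 0 \<or> ?U p n = 0"
        using that A by (fastforce simp: J_def raising_def cutmat_def)
    qed (use finJ in simp)
    also have "\<dots> = (\<Sum>p\<in>?I. B n p * ?U p n) + (\<Sum>p\<in>J. B n p * ?U p n)"
      by (rule sum.union_disjoint) (use finJ disj in auto)
    also have "(\<Sum>p\<in>J. B n p * ?U p n) = (\<Sum>p\<in>J. B n p * A p n)"
      using that by (intro sum.cong) (auto simp: J_def raising_def)
    finally show ?thesis .
  qed
  have 2: "zmult ?U B n n = (\<Sum>p\<in>?I. ?U n p * B p n)" if "n \<in> ?I" for n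
    unfolding zmult_def
  proof (rule zapply_superset)
    fix p assume "p \<notin> ?I"
    then show "?U n p = 0 \<or> B p n = 0"
      using that A by (fastforce simp: raising_def cutmat_def)
  qed simp
  have "vac_trace N (zcom B ?U) = (\<Sum>n\<in>?I. \<Sum>p\<in>?I. B n p * ?U p n) + (\<Sum>n\<in>?I. \<Sum>p\<in>J. B n p * A p n)
      - (\<Sum>n\<in>?I. \<Sum>p\<in>?I. ?U n p * B p n)"
    unfolding tr zcom_def by (simp add: 1 2 sum_subtractf sum.distrib)
  also have "(\<Sum>n\<in>?I. \<Sum>p\<in>?I. ?U n p * B p n) = (\<Sum>n\<in>?I. \<Sum>p\<in>?I. B n p * ?U p n)"
    by (subst sum.swap) (simp add: mult.commute)
  also have "(\<Sum>n\<in>?I. \<Sum>p\<in>J. B n p * A p n) = (\<Sum>(n,p)\<in>?I \<times> J. B n p * A p n)"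
    by (rule sum.cartesian_product)
  also have "\<dots> = pair_trace A B"
    unfolding pair_trace_def
    by (rule sum.mono_neutral_right) (use finJ A B in \<open>auto simp: J_def cutmat_def\<close>, force+)
  finally show ?thesis by simp
qed

text \<open>Only the head is split. Its lowering part vanishes at once on the state, its raising
  part vanishes next to the functional. The induction hypothesis applies to the unchanged rows
  \<open>v\<close>, so their flag shape is never lost.\<close>

lemma centred_eq_cumG:
  assumes v: "flag_rows N v" and As: "\<And>A. A \<in> set As \<Longrightarrow> cutmat N A"
  shows "centred N As v = cumG As * vac_det N v"
  using As
proof (induction As rule: cumG.induct)
  case 1
  then show ?case by (simp add: centred_Nil)
next
  case (2 A As)
  have A: "cutmat N A" and As: "\<And>B. B \<in> set As \<Longrightarrow> cutmat N B" using "2.prems" by auto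
  have U: "cutmat N (raising A)" and L: "cutmat N (lowering A)" using A by (simp_all add: cutmat_raising cutmat_lowering)
  have fv: "\<And>i. i < N \<Longrightarrow> fsupp (v i)" using flag_rows_fsupp[OF v] .
  have split: "zapply A u = (\<lambda>m. zapply (raising A) u m + zapply (lowering A) u m)" if "fsupp u" for u
    unfolding zapply_eq[OF that] fun_eq_iff raising_def lowering_def
    by (auto simp: sum.distrib[symmetric] intro!: sum.cong)
  have tr: "vac_trace N A = vac_trace N (raising A) + vac_trace N (lowering A)" by (simp add: vac_trace_def raising_def lowering_def)
  have "centred N (A # As) v = centred N (raising A # As) v + centred N (lowering A # As) v"
  proof -
    have "(\<Sum>i<N. centred N As (v(i := zapply A (v i)))) =
       (\<Sum>i<N. centred N As (v(i := zapply (raising A) (v i))) + centred N As (v(i := zapply (lowering A) (v i))))"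
    proof (intro sum.cong refl)
      fix i assume "i \<in> {..<N}"
      then have i: "i < N" by simp
      show "centred N As (v(i := zapply A (v i))) =
         centred N As (v(i := zapply (raising A) (v i))) + centred N As (v(i := zapply (lowering A) (v i)))"
        unfolding split[OF fv[OF i]]
        by (rule centred_add_zapply(1)[OF As i]) (use fv[OF i] U L in \<open>auto intro: fsupp_zapply\<close>)
    qed
    then show ?thesis by (simp add: centred_Cons tr sum.distrib algebra_simps)
  qed
  also have "centred N (lowering A # As) v = 0" by (rule centred_first_lowering[OF v A As])
  also have "centred N (raising A # As) v = centred N (As @ [raising A]) v +
    (\<Sum>j<length As. centred N (As[j := zcom (As ! j) (raising A)]) v
        + vac_trace N (zcom (As ! j) (raising A)) * centred N (take j As @ drop (Suc j) As) v)"
    by (rule centred_move_last) (use U As fv in auto)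
  also have "centred N (As @ [raising A]) v = 0" by (rule centred_last_raising[OF A])
  also have "(\<Sum>j<length As. centred N (As[j := zcom (As ! j) (raising A)]) v
        + vac_trace N (zcom (As ! j) (raising A)) * centred N (take j As @ drop (Suc j) As) v)
     = (\<Sum>j<length As. cumG (As[j := zcom (As ! j) (raising A)]) * vac_det N v
        + pair_trace A (As ! j) * (cumG (take j As @ drop (Suc j) As) * vac_det N v))"
  proof (intro sum.cong refl arg_cong2[where f="(+)"] arg_cong2[where f="(*)"])
    fix j assume "j \<in> {..<length As}"
    then have j: "j < length As" by simp
    show "centred N (As[j := zcom (As ! j) (raising A)]) v = cumG (As[j := zcom (As ! j) (raising A)]) * vac_det N v"
    proof (rule "2.IH"(1))
      fix B assume "B \<in> set (As[j := zcom (As ! j) (raising A)])"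
      then have "B \<in> insert (zcom (As ! j) (raising A)) (set As)" using set_update_subset_insert by fast
      then show "cutmat N B" using As U j cutmat_zcom nth_mem by blast
    qed (use j in auto)
    show "centred N (take j As @ drop (Suc j) As) v = cumG (take j As @ drop (Suc j) As) * vac_det N v"
      by (rule "2.IH"(2)) (use j As in \<open>auto dest: in_set_takeD in_set_dropD\<close>)
    show "vac_trace N (zcom (As ! j) (raising A)) = pair_trace A (As ! j)"
      by (rule vac_trace_zcom_raising[OF A]) (use As j in auto)
  qed
  finally have E: "centred N (A # As) v = 0 + (\<Sum>j<length As. cumG (As[j := zcom (As ! j) (raising A)]) * vac_det N v
        + pair_trace A (As ! j) * (cumG (take j As @ drop (Suc j) As) * vac_det N v)) + 0" .
  show ?case unfolding E cumG.simps sum_distrib_right by (simp add: algebra_simps)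
qed

subsection \<open>Limits of vacuum expectations\<close>

text \<open>Only raising is bounded. Lowering is not, since the symbols have infinitely many
  negative powers of y.\<close>

definition banded :: "nat \<Rightarrow> zmat \<Rightarrow> bool" where
  "banded k A \<longleftrightarrow> (\<forall>m n. n + int k < m \<longrightarrow> A m n = 0)"

lemma banded_raising: "banded k A \<Longrightarrow> banded k (raising A)"
  by (auto simp: banded_def raising_def)

text \<open>Bounding how far each factor raises confines the intermediate level from both sides, to
  a window independent of \<open>N\<close>.\<close>

lemma zmult_banded:
  assumes "banded k A" "banded l B"
  shows "zmult A B m n = (\<Sum>p\<in>{m - int k..n + int l}. A m p * B p n)"
  unfolding zmult_def
proof (rule zapply_superset)
  fix p assume "p \<notin> {m - int k..n + int l}"
  then have "p + int k < m \<or> n + int l < p" by auto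
  then show "A m p = 0 \<or> B p n = 0" using assms by (auto simp: banded_def)
qed simp

lemma banded_zmult: "banded k A \<Longrightarrow> banded l B \<Longrightarrow> banded (k + l) (zmult A B)"
  by (subst banded_def) (auto simp: zmult_banded)

lemma banded_zcom:
  assumes "banded k A" "banded l B"
  shows "banded (k + l) (zcom A B)"
  using banded_zmult[OF assms] banded_zmult[OF assms(2,1)] by (auto simp: banded_def zcom_def)

lemma pair_trace_banded:
  assumes "banded k A"
  shows "pair_trace A B = (\<Sum>(n,p)\<in>{- int k..-1} \<times> {0..int k}. B n p * A p n)"
  unfolding pair_trace_def
  by (rule sum.mono_neutral_left) (use assms in \<open>auto simp: banded_def\<close>, smt+)

text \<open>One bandwidth for all \<open>N\<close> and convergence of each entry: with the finite
  windows above, this passes through products, commutators and pair traces, hence through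
  \<open>cumG\<close>.\<close>

definition zconv :: "nat \<Rightarrow> (nat \<Rightarrow> zmat) \<Rightarrow> zmat \<Rightarrow> bool" where
  "zconv k A L \<longleftrightarrow> (\<forall>N. banded k (A N)) \<and> (\<forall>m n. (\<lambda>N. A N m n) \<longlonglongrightarrow> L m n)"

lemma zconv_banded:
  assumes "zconv k A L" shows "banded k L"
  unfolding banded_def
proof (intro allI impI)
  fix m n :: int assume mn: "n + int k < m"
  then have "(\<lambda>N. A N m n) = (\<lambda>_. 0)" using assms by (auto simp: zconv_def banded_def)
  moreover have "(\<lambda>N. A N m n) \<longlonglongrightarrow> L m n" using assms by (simp add: zconv_def)
  ultimately show "L m n = 0" by (simp add: LIMSEQ_const_iff)
qed

lemma zconv_zmult:
  assumes "zconv k A L" "zconv l B M"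
  shows "zconv (k + l) (\<lambda>N. zmult (A N) (B N)) (zmult L M)"
proof -
  have b: "banded k (A N)" "banded l (B N)" for N using assms by (auto simp: zconv_def)
  have "(\<lambda>N. zmult (A N) (B N) m n) \<longlonglongrightarrow> zmult L M m n" for m n
    unfolding zmult_banded[OF b] zmult_banded[OF zconv_banded[OF assms(1)] zconv_banded[OF assms(2)]]
    using assms by (auto intro!: tendsto_sum tendsto_mult simp: zconv_def)
  then show ?thesis using b by (simp add: zconv_def banded_zmult)
qed

lemma zconv_zcom:
  assumes "zconv k A L" "zconv l B M"
  shows "zconv (k + l) (\<lambda>N. zcom (A N) (B N)) (zcom L M)"
  using zconv_zmult[OF assms] zconv_zmult[OF assms(2,1)] banded_zcom assms
  by (auto simp: zconv_def zcom_def intro!: tendsto_diff)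

lemma zconv_raising: "zconv k A L \<Longrightarrow> zconv k (\<lambda>N. raising (A N)) (raising L)"
  unfolding zconv_def by (auto intro: banded_raising) (simp add: raising_def)

lemma tendsto_pair_trace:
  assumes "zconv k A L" "zconv l B M"
  shows "(\<lambda>N. pair_trace (A N) (B N)) \<longlonglongrightarrow> pair_trace L M"
proof -
  have b: "banded k (A N)" for N using assms by (auto simp: zconv_def)
  show ?thesis
    unfolding pair_trace_banded[OF b] pair_trace_banded[OF zconv_banded[OF assms(1)]]
    using assms by (auto intro!: tendsto_sum tendsto_mult simp: zconv_def case_prod_unfold)
qed

lemma tendsto_cumG:
  assumes "\<And>j. j < length Ls \<Longrightarrow> \<exists>k. zconv k (\<lambda>N. As N ! j) (Ls ! j)" "\<And>N. length (As N) = length Ls"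
  shows "(\<lambda>N. cumG (As N)) \<longlonglongrightarrow> cumG Ls"
  using assms
proof (induction Ls arbitrary: As rule: cumG.induct)
  case 1
  then show ?case by simp
next
  case (2 L Ls)
  define A where "A N = hd (As N)" for N
  define Bs where "Bs N = tl (As N)" for N
  have As: "As N = A N # Bs N" "length (Bs N) = length Ls" for N
    using "2.prems"(2)[of N] by (cases "As N"; simp add: A_def Bs_def)+
  obtain k where A: "zconv k A L" using "2.prems"(1)[of 0] by (auto simp: As)
  have Bs: "\<exists>k. zconv k (\<lambda>N. Bs N ! j) (Ls ! j)" if "j < length Ls" for j
    using "2.prems"(1)[of "Suc j"] that by (simp add: As)
  have "(\<lambda>N. \<Sum>j<length Ls. cumG ((Bs N)[j := zcom (Bs N ! j) (raising (A N))]) +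
      pair_trace (A N) (Bs N ! j) * cumG (take j (Bs N) @ drop (Suc j) (Bs N))) \<longlonglongrightarrow>
     (\<Sum>j<length Ls. cumG (Ls[j := zcom (Ls ! j) (raising L)]) +
      pair_trace L (Ls ! j) * cumG (take j Ls @ drop (Suc j) Ls))"
  proof (intro tendsto_sum tendsto_add tendsto_mult)
    fix j assume "j \<in> {..<length Ls}"
    then have j: "j < length Ls" by simp
    obtain l where l: "zconv l (\<lambda>N. Bs N ! j) (Ls ! j)" using Bs[OF j] ..
    show "(\<lambda>N. pair_trace (A N) (Bs N ! j)) \<longlonglongrightarrow> pair_trace L (Ls ! j)"
      by (rule tendsto_pair_trace[OF A l])
    show "(\<lambda>N. cumG ((Bs N)[j := zcom (Bs N ! j) (raising (A N))])) \<longlonglongrightarrow> cumG (Ls[j := zcom (Ls ! j) (raising L)])"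
    proof (rule "2.IH"(1))
      fix i assume i: "i < length (Ls[j := zcom (Ls ! j) (raising L)])"
      show "\<exists>k. zconv k (\<lambda>N. (Bs N)[j := zcom (Bs N ! j) (raising (A N))] ! i) (Ls[j := zcom (Ls ! j) (raising L)] ! i)"
        using zconv_zcom[OF l zconv_raising[OF A]] Bs[of i] i j
        by (cases "i = j") (auto simp: As)
    qed (use j As in auto)
    show "(\<lambda>N. cumG (take j (Bs N) @ drop (Suc j) (Bs N))) \<longlonglongrightarrow> cumG (take j Ls @ drop (Suc j) Ls)"
    proof (rule "2.IH"(2))
      fix i assume i: "i < length (take j Ls @ drop (Suc j) Ls)"
      show "\<exists>k. zconv k (\<lambda>N. (take j (Bs N) @ drop (Suc j) (Bs N)) ! i) ((take j Ls @ drop (Suc j) Ls) ! i)"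
        using Bs[of i] Bs[of "Suc i"] i j by (auto simp: nth_append As min_def)
    qed (use j As in auto)
  qed
  then show ?case by (simp add: As)
qed

text \<open>Each summand of the recursion either keeps a zero matrix in the list or carries a pair
  trace with one.\<close>

lemma cumG_zero: "(\<lambda>m n. 0) \<in> set As \<Longrightarrow> cumG As = 0"
proof (induction As rule: cumG.induct)
  case 1
  then show ?case by simp
next
  case (2 A As)
  let ?Z = "(\<lambda>m n. 0) :: zmat"
  have comZ: "zcom B ?Z = ?Z" "zcom ?Z B = ?Z" for B
    by (auto simp: zcom_def zmult_def zapply_def fun_eq_iff)
  have ccZ: "pair_trace ?Z B = 0" "pair_trace B ?Z = 0" for B by (auto simp: pair_trace_def)
  have upZ: "raising ?Z = ?Z" by (auto simp: raising_def fun_eq_iff)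
  have "cumG (As[j := zcom (As ! j) (raising A)]) + pair_trace A (As ! j) * cumG (take j As @ drop (Suc j) As) = 0"
    if j: "j < length As" for j
  proof (cases "A = ?Z")
    case True
    have "cumG (As[j := zcom (As ! j) (raising A)]) = 0"
      by (rule "2.IH"(1)) (use j True in \<open>auto simp: comZ upZ set_update_memI\<close>)
    then show ?thesis using True by (simp add: ccZ)
  next
    case False
    then obtain i where i: "i < length As" "As ! i = ?Z" using "2.prems" by (auto simp: in_set_conv_nth)
    have "cumG (As[j := zcom (As ! j) (raising A)]) = 0"
    proof (rule "2.IH"(1))
      have "As[j := zcom (As ! j) (raising A)] ! i = ?Z" using i j by (cases "i = j") (auto simp: comZ)
      then show "?Z \<in> set (As[j := zcom (As ! j) (raising A)])" using i by (metis length_list_update nth_mem)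
    qed (use j in auto)
    moreover have "pair_trace A (As ! j) * cumG (take j As @ drop (Suc j) As) = 0"
    proof (cases "i = j")
      case True
      then show ?thesis using i by (simp add: ccZ)
    next
      case False
      have "?Z \<in> set (take j As @ drop (Suc j) As)"
      proof (cases "i < j")
        case True
        then have "take j As ! i \<in> set (take j As)" using i j by (intro nth_mem) auto
        then show ?thesis using True i by simp
      next
        case 2: False
        then have "drop (Suc j) As ! (i - Suc j) \<in> set (drop (Suc j) As)"
          using i False by (intro nth_mem) auto
        then show ?thesis using False 2 i by simp
      qed
      then show ?thesis using "2.IH"(2)[of j] j by simp
    qed
    ultimately show ?thesis by simp
  qed
  then show ?case by (simp only: cumG.simps) (simp add: sum.neutral)
qed

section \<open>Toeplitz matrices: multiplication by Laurent series\<close>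

definition toep :: "(int \<Rightarrow> complex) \<Rightarrow> zmat" where
  "toep f m n = f (m - n)"

text \<open>Both products are convolutions, and reflecting the intermediate level \<open>p\<close>
  to \<open>m + n - p\<close> exchanges them.\<close>

lemma zcom_toep:
  assumes "\<And>j. int k < j \<Longrightarrow> f j = 0" "\<And>j. int l < j \<Longrightarrow> g j = 0"
  shows "zcom (toep f) (toep g) = (\<lambda>m n. 0)"
proof (intro ext)
  fix m n
  have b: "banded k (toep f)" "banded l (toep g)" using assms by (auto simp: banded_def toep_def)
  have bij: "bij_betw (\<lambda>p. m + n - p) {m - int k..n + int l} {m - int l..n + int k}"
    by (rule bij_betwI[where g="\<lambda>p. m + n - p"]) auto
  have "zmult (toep g) (toep f) m n = (\<Sum>p\<in>{m - int l..n + int k}. toep g m p * toep f p n)"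
    by (rule zmult_banded[OF b(2,1)])
  also have "\<dots> = (\<Sum>p\<in>{m - int k..n + int l}. toep g m (m + n - p) * toep f (m + n - p) n)"
    by (rule sum.reindex_bij_betw[OF bij, symmetric])
  also have "\<dots> = (\<Sum>p\<in>{m - int k..n + int l}. toep f m p * toep g p n)"
    by (intro sum.cong refl) (simp add: toep_def algebra_simps)
  also have "\<dots> = zmult (toep f) (toep g) m n"
    by (rule zmult_banded[OF b, symmetric])
  finally show "zcom (toep f) (toep g) m n = 0" by (simp add: zcom_def)
qed

lemma raising_toep: "raising (toep f) = toep (\<lambda>j. if 0 < j then f j else 0)"
  by (auto simp: raising_def toep_def fun_eq_iff)

text \<open>A pair across the Fermi level enters only through the jump \<open>j = p - n\<close>, and
  exactly \<open>j\<close> pairs have that jump. This is the origin of the factor \<open>j\<close>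
  in the covariance.\<close>

lemma pair_trace_toep:
  assumes "\<And>j. int k < j \<Longrightarrow> f j = 0"
  shows "pair_trace (toep f) (toep g) = (\<Sum>j=1..k. of_nat j * f (int j) * g (- int j))"
proof -
  have b: "banded k (toep f)" using assms by (auto simp: banded_def toep_def)
  have "pair_trace (toep f) (toep g) = (\<Sum>(n,p)\<in>{- int k..-1} \<times> {0..int k}. f (p - n) * g (n - p))"
    unfolding pair_trace_banded[OF b] by (simp add: toep_def mult.commute)
  also have "\<dots> = (\<Sum>(n,p)\<in>{(n,p). n \<le> -1 \<and> 0 \<le> p \<and> p - n \<le> int k}. f (p - n) * g (n - p))"
    by (rule sum.mono_neutral_right) (use assms in \<open>auto simp: not_le[symmetric]\<close>, metis not_le)
  also have "\<dots> = (\<Sum>(j,i)\<in>Sigma {1..k} (\<lambda>j. {..<j}). f (int j) * g (- int j))"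
    by (rule sum.reindex_bij_witness[where i="\<lambda>(j,i). (int i - int j, int i)" and j="\<lambda>(n,p). (nat (p - n), nat p)"]) 
       (auto simp: algebra_simps)
  also have "\<dots> = (\<Sum>j=1..k. \<Sum>i<j. f (int j) * g (- int j))"
    by (rule sum.Sigma[symmetric]) auto
  finally show ?thesis by (simp add: mult.assoc)
qed

text \<open>The raising part of a Toeplitz matrix is again Toeplitz, so all commutators vanish and
  the recursion of \<open>cumG\<close> becomes that of \<open>wick\<close>.\<close>

lemma cumG_toep:
  assumes "\<And>k. k \<in> set ks \<Longrightarrow> \<forall>j>int (d k). f k j = 0"
  shows "cumG (map (\<lambda>k. toep (f k)) ks) = wick (\<lambda>k l. pair_trace (toep (f k)) (toep (f l))) ks"
  using assms
proof (induction "\<lambda>k l. pair_trace (toep (f k)) (toep (f l))" ks rule: wick.induct)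
  case 1
  then show ?case by simp
next
  case (2 k ks)
  let ?M = "map (\<lambda>k. toep (f k))"
  have z: "cumG ((?M ks)[j := zcom (?M ks ! j) (raising (toep (f k)))]) = 0" if "j < length ks" for j
  proof (rule cumG_zero)
    have "zcom (?M ks ! j) (raising (toep (f k))) = (\<lambda>m n. 0)"
      using that 2(2)[of k] 2(2)[of "ks ! j"]
      by (simp add: raising_toep, intro zcom_toep[of "d (ks ! j)" _ "d k"]) auto
    then show "(\<lambda>m n. 0) \<in> set ((?M ks)[j := zcom (?M ks ! j) (raising (toep (f k)))])"
      using that by (simp add: set_update_memI)
  qed
  have IH: "cumG (take j (?M ks) @ drop (Suc j) (?M ks)) = wick (\<lambda>k l. pair_trace (toep (f k)) (toep (f l))) (take j ks @ drop (Suc j) ks)"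
    if "j < length ks" for j
    using 2(1)[of j] that 2(2) by (auto simp: take_map drop_map dest!: in_set_takeD in_set_dropD)
  show ?case
    using z by (simp add: IH cong: sum.cong_simp)
qed

subsection \<open>Sums over interlacing signatures\<close>

definition dif :: "complex poly \<Rightarrow> complex poly" where
  "dif p = pcompose p [:1,1:] - p"

lemma dif_add: "dif (p + q) = dif p + dif q"
  and dif_diff: "dif (p - q) = dif p - dif q"
  and dif_smult: "dif (Polynomial.smult c p) = Polynomial.smult c (dif p)"
  and dif_0 [simp]: "dif 0 = 0"
  by (simp_all add: dif_def pcompose_add pcompose_diff pcompose_smult smult_diff_right)

lemma dif_mult_X: "dif ([:0,1:] * p) = [:0,1:] * dif p + dif p + p"
  by (simp add: dif_def pcompose_mult pcompose_pCons algebra_simps)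

lemma poly_dif: "poly (dif p) x = poly p (x + 1) - poly p x"
  by (simp add: dif_def poly_pcompose add.commute)

lemma dif_eq_0_const:
  assumes "dif p = 0"
  shows "p = [:poly p 0:]"
proof (rule ccontr)
  assume "p \<noteq> [:poly p 0:]"
  then have "finite {x. poly (p - [:poly p 0:]) x = 0}" by (intro poly_roots_finite) auto
  moreover have "poly p (of_nat n) = poly p 0" for n
  proof (induction n)
    case (Suc n)
    have "poly (dif p) (of_nat n) = 0" using assms by simp
    then show ?case using Suc by (simp add: poly_dif add.commute)
  qed simp
  then have "range of_nat \<subseteq> {x. poly (p - [:poly p 0:]) x = 0}" by auto
  ultimately have "finite (range (of_nat :: nat \<Rightarrow> complex))" by (rule rev_finite_subset)
  then show False by (simp add: finite_image_iff inj_of_nat)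
qed

lemma degree_dif_le: "degree (dif p) \<le> degree p"
proof -
  have "degree (pcompose p [:1,1:]) \<le> degree p" using degree_pcompose_le[of p "[:1,1:]"] by simp
  then show ?thesis unfolding dif_def by (intro degree_diff_le) auto
qed

lemma degree_dif_less: "dif p \<noteq> 0 \<Longrightarrow> degree (dif p) < degree p"
proof -
  assume nz: "dif p \<noteq> 0"
  have "lead_coeff (pcompose p [:1,1:]) = lead_coeff p"
    by (subst lead_coeff_comp) auto
  moreover have "degree (pcompose p [:1,1:]) = degree p" by (simp add: degree_pcompose)
  ultimately have "coeff (dif p) (degree p) = 0" by (simp add: dif_def)
  then have "degree (dif p) \<noteq> degree p" using nz by (metis leading_coeff_0_iff)
  then show ?thesis using degree_dif_le[of p] by simp
qed

text \<open>The falling factorials x(x-1)...(x-n+1), on which \<open>dif\<close> acts as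
  differentiation does on powers.\<close>

fun ffact_poly :: "nat \<Rightarrow> complex poly" where
  "ffact_poly 0 = 1"
| "ffact_poly (Suc n) = ffact_poly n * [:- of_nat n, 1:]"

lemma dif_ffact_poly: "dif (ffact_poly (Suc n)) = Polynomial.smult (of_nat (Suc n)) (ffact_poly n)"
proof -
  have "pcompose (ffact_poly (Suc n)) [:1,1:] = [:1,1:] * ffact_poly n"
  proof (induction n)
    case 0
    show ?case by (simp add: pcompose_pCons)
  next
    case (Suc n)
    have "pcompose [:- of_nat (Suc n), 1:] [:1,1:] = [:- of_nat n, 1 :: complex:]"
      by (simp add: pcompose_pCons)
    then have "pcompose (ffact_poly (Suc (Suc n))) [:1,1:] = [:1,1:] * ffact_poly n * [:- of_nat n, 1:]"
      by (simp only: ffact_poly.simps(2)[of "Suc n"] pcompose_mult Suc.IH)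
    then show ?case by (simp only: ffact_poly.simps mult.assoc)
  qed
  then show ?thesis by (simp add: dif_def smult_add_left algebra_simps)
qed

lemma ffact_poly_monic: "degree (ffact_poly n) = n \<and> lead_coeff (ffact_poly n) = 1"
proof (induction n)
  case (Suc n)
  then have "ffact_poly n \<noteq> 0" by auto
  have "degree (ffact_poly (Suc n)) = degree (ffact_poly n) + degree [:- of_nat n, 1 :: complex:]"
    unfolding ffact_poly.simps by (rule degree_mult_eq) (use \<open>ffact_poly n \<noteq> 0\<close> in auto)
  moreover have "lead_coeff (ffact_poly (Suc n)) = lead_coeff (ffact_poly n) * lead_coeff [:- of_nat n, 1 :: complex:]"
    unfolding ffact_poly.simps by (rule lead_coeff_mult)
  ultimately have "degree (ffact_poly (Suc n)) = Suc n" "lead_coeff (ffact_poly (Suc n)) = 1"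
    using Suc by (simp_all only: degree_pCons_eq_if lead_coeff_pCons mult_1) auto
  then show ?case by blast
qed simp

lemma dif_surj: "\<exists>q. dif q = p \<and> poly q 0 = 0 \<and> degree q \<le> Suc (degree p)"
proof (induction "degree p" arbitrary: p rule: less_induct)
  case less
  let ?n = "degree p"
  define c where "c = lead_coeff p"
  \<comment> \<open>The antidifference of the leading part of \<open>p\<close>, rewritten as a
    multiple of the monic falling factorial; subtracting its difference lowers the degree.\<close>
  define q0 where "q0 = Polynomial.smult (c / of_nat (Suc ?n)) (ffact_poly (Suc ?n))"
  have d0: "dif q0 = Polynomial.smult c (ffact_poly ?n)"
    unfolding q0_def dif_smult dif_ffact_poly by (simp del: of_nat_Suc)
  have deg0: "degree q0 \<le> Suc ?n" unfolding q0_def using ffact_poly_monic[of "Suc ?n"]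
    by (metis degree_smult_le)
  have eval0: "poly q0 0 = 0"
  proof -
    have "poly (ffact_poly (Suc k)) 0 = 0" for k by (induction k) auto
    then show ?thesis by (simp add: q0_def del: ffact_poly.simps)
  qed
  define p' where "p' = p - dif q0"
  have "\<exists>q. dif q = p' \<and> poly q 0 = 0 \<and> degree q \<le> Suc ?n"
  proof (cases "p' = 0")
    case True
    then show ?thesis by (intro exI[of _ 0]) auto
  next
    case False
    have deg: "degree p' \<le> ?n"
      unfolding p'_def d0 by (intro degree_diff_le) (use ffact_poly_monic[of ?n] in auto)
    have "coeff (ffact_poly ?n) ?n = 1" using ffact_poly_monic[of ?n] by metis
    then have "coeff p' ?n = 0" unfolding p'_def d0 by (simp add: c_def)
    then have "degree p' < ?n" using False deg by (metis le_neq_implies_less leading_coeff_0_iff)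
    from less[OF this] show ?thesis using \<open>degree p' < ?n\<close> by fastforce
  qed
  then obtain q1 where "dif q1 = p'" "poly q1 0 = 0" "degree q1 \<le> Suc ?n" by blast
  then show ?case using eval0 deg0
    by (intro exI[of _ "q0 + q1"]) (auto simp: dif_add p'_def intro: degree_add_le)
qed

text \<open>The value at 0 fixes the additive constant. This makes the right inverse linear, and its
  iterates send 1 to the binomial polynomials.\<close>

definition antidif :: "complex poly \<Rightarrow> complex poly" where
  "antidif p = (SOME q. dif q = p \<and> poly q 0 = 0 \<and> degree q \<le> Suc (degree p))"

lemma dif_antidif [simp]: "dif (antidif p) = p" and antidif_0: "poly (antidif p) 0 = 0" and degree_antidif_le: "degree (antidif p) \<le> Suc (degree p)"
  using someI_ex[OF dif_surj[of p]] unfolding antidif_def by blast+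

lemma antidif_unique: "dif q = p \<Longrightarrow> poly q 0 = 0 \<Longrightarrow> q = antidif p"
  using dif_eq_0_const[of "q - antidif p"] by (simp add: dif_diff antidif_0)

lemma antidif_zero [simp]: "antidif 0 = 0"
  by (rule antidif_unique[symmetric]) auto

lemma antidif_dif: "antidif (dif q) = q - [:poly q 0:]"
  by (rule antidif_unique[symmetric]) (auto simp: dif_diff, simp add: dif_def pcompose_pCons)

lemma dif_pow_antidif_pow [simp]: "(dif ^^ r) ((antidif ^^ r) p) = p"
proof (induction r)
  case (Suc r)
  have "(dif ^^ Suc r) ((antidif ^^ Suc r) p) = (dif ^^ r) (dif (antidif ((antidif ^^ r) p)))"
    unfolding funpow_Suc_right[of r dif] by simp
  then show ?case using Suc by simp
qed simp

lemma dif_pow_0 [simp]: "(dif ^^ r) 0 = 0" by (induction r) auto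
lemma antidif_pow_0 [simp]: "(antidif ^^ r) 0 = 0" by (induction r) auto

lemma poly_antidif_telescope:
  assumes "a \<le> b"
  shows "poly (antidif p) (of_int b) - poly (antidif p) (of_int a) = (\<Sum>t\<in>{a..<b}. poly p (of_int t))"
  using assms
proof (induction b rule: int_ge_induct)
  case (step b)
  have "{a..<b + 1} = insert b {a..<b}" using step by auto
  moreover have "poly (antidif p) (of_int b + 1) - poly (antidif p) (of_int b) = poly p (of_int b)"
    using poly_dif[of "antidif p" "of_int b"] by simp
  ultimately show ?case using step by (simp add: algebra_simps)
qed simp

section \<open>Alternants at the shifted positions and sums over interlacing arrays\<close>

definition pos :: "nat \<Rightarrow> (nat \<Rightarrow> int) \<Rightarrow> nat \<Rightarrow> int" where
  "pos n l j = l j + int n - int j"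

definition eval_det :: "nat \<Rightarrow> (nat \<Rightarrow> int) \<Rightarrow> (nat \<Rightarrow> complex poly) \<Rightarrow> complex" where
  "eval_det n l ps = ddet n (\<lambda>i j. poly (ps i) (of_int (pos n l (Suc j))))"

lemma eval_det_cong: "(\<And>i. i < n \<Longrightarrow> ps i = qs i) \<Longrightarrow> eval_det n l ps = eval_det n l qs"
  unfolding eval_det_def by (rule ddet_cong) auto

abbreviation below :: "nat \<Rightarrow> (nat \<Rightarrow> int) \<Rightarrow> (nat \<Rightarrow> int) set" where
  "below n l \<equiv> {\<mu> \<in> GT n. interlace n \<mu> l}"

lemma GT_antimono: "l \<in> GT n \<Longrightarrow> 1 \<le> i \<Longrightarrow> i \<le> j \<Longrightarrow> j \<le> n \<Longrightarrow> l j \<le> l i"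
  by (auto simp: GT_def)

text \<open>Interlacing constrains each entry on its own, and monotonicity follows from it. Hence
  the signatures below \<open>l\<close> form a product of intervals.\<close>

lemma bij_below_PiE:
  assumes "l \<in> GT (Suc n)"
  shows "bij_betw (\<lambda>\<mu>. restrict (\<lambda>j. \<mu> (Suc j)) {0..<n}) (below n l) (PiE {0..<n} (\<lambda>j. {l (Suc (Suc j))..l (Suc j)}))"
proof (rule bij_betwI[where g="\<lambda>f i. if 1 \<le> i \<and> i \<le> n then f (i - 1) else 0"])
  show "(\<lambda>\<mu>. restrict (\<lambda>j. \<mu> (Suc j)) {0..<n}) \<in> below n l \<rightarrow> (PiE {0..<n} (\<lambda>j. {l (Suc (Suc j))..l (Suc j)}))"
    by (auto simp: interlace_def)
  show "(\<lambda>f i. if 1 \<le> i \<and> i \<le> n then f (i - 1) else 0) \<in> (PiE {0..<n} (\<lambda>j. {l (Suc (Suc j))..l (Suc j)})) \<rightarrow> below n l"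
  proof
    fix f assume f: "f \<in> (PiE {0..<n} (\<lambda>j. {l (Suc (Suc j))..l (Suc j)}))"
    let ?\<mu> = "\<lambda>i. if 1 \<le> i \<and> i \<le> n then f (i - 1) else 0"
    have b: "l (Suc i) \<le> f (i - 1)" "f (i - 1) \<le> l i" if "1 \<le> i" "i \<le> n" for i
      using PiE_mem[OF f, of "i - 1"] that by auto
    have "f (j - 1) \<le> f (i - 1)" if "1 \<le> i" "i \<le> j" "j \<le> n" for i j
    proof (cases "i = j")
      case False
      then have "l j \<le> l (Suc i)" using that by (intro GT_antimono[OF assms]) auto
      then show ?thesis using b(2)[of j] b(1)[of i] that by linarith
    qed simp
    then show "?\<mu> \<in> below n l"
      using b by (auto simp: GT_def interlace_def)
  qed
  show "(\<lambda>i. if 1 \<le> i \<and> i \<le> n then restrict (\<lambda>j. \<mu> (Suc j)) {0..<n} (i - 1) else 0) = \<mu>" if "\<mu> \<in> below n l" for \<mu>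
    using that by (auto simp: fun_eq_iff GT_def Suc_le_eq)
  show "restrict (\<lambda>j. if 1 \<le> Suc j \<and> Suc j \<le> n then f (Suc j - 1) else 0) {0..<n} = f"
    if "f \<in> (PiE {0..<n} (\<lambda>j. {l (Suc (Suc j))..l (Suc j)}))" for f
    using that by (auto simp: fun_eq_iff PiE_def extensional_def)
qed

lemma finite_below: "l \<in> GT (Suc n) \<Longrightarrow> finite (below n l)"
  using bij_betw_finite[OF bij_below_PiE] by (auto intro: finite_PiE)

text \<open>For a fixed permutation the sum over the box factorises by columns, and each factor
  telescopes to a difference of antidifferences. An additional row of ones absorbs these column
  differences.\<close>

lemma sum_below_eval_det:
  assumes l: "l \<in> GT (Suc n)"
  shows "(\<Sum>\<mu>\<in>below n l. eval_det n \<mu> \<phi>) = eval_det (Suc n) l (\<lambda>i. if i < n then antidif (\<phi> i) else 1)"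
proof -
  let ?x = "\<lambda>j t. of_int (t + int n - int (Suc j)) :: complex"
  let ?P = "PiE {0..<n} (\<lambda>j. {l (Suc (Suc j))..l (Suc j)})"
  have one: "(\<Sum>\<mu>\<in>below n l. \<Prod>j = 0..<n. poly (\<phi> (p j)) (of_int (pos n \<mu> (Suc j)))) =
     (\<Prod>j = 0..<n. poly (antidif (\<phi> (p j))) (of_int (pos (Suc n) l (Suc j)))
        - poly (antidif (\<phi> (p j))) (of_int (pos (Suc n) l (Suc (Suc j)))))" for p
  proof -
    have "(\<Sum>\<mu>\<in>below n l. \<Prod>j = 0..<n. poly (\<phi> (p j)) (of_int (pos n \<mu> (Suc j)))) =
       (\<Sum>\<mu>\<in>below n l. \<Prod>j = 0..<n. poly (\<phi> (p j)) (?x j (restrict (\<lambda>j. \<mu> (Suc j)) {0..<n} j)))"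
      by (intro sum.cong prod.cong refl) (simp add: pos_def)
    also have "\<dots> = (\<Sum>f\<in>?P. \<Prod>j = 0..<n. poly (\<phi> (p j)) (?x j (f j)))"
      by (rule sum.reindex_bij_betw[OF bij_below_PiE[OF l], where g="\<lambda>f. \<Prod>j = 0..<n. poly (\<phi> (p j)) (?x j (f j))"])
    also have "\<dots> = (\<Prod>j = 0..<n. \<Sum>t\<in>{l (Suc (Suc j))..l (Suc j)}. poly (\<phi> (p j)) (?x j t))"
      by (rule prod_sum_PiE[symmetric]) auto
    also have "\<dots> = (\<Prod>j = 0..<n. poly (antidif (\<phi> (p j))) (of_int (pos (Suc n) l (Suc j)))
        - poly (antidif (\<phi> (p j))) (of_int (pos (Suc n) l (Suc (Suc j)))))"
    proof (intro prod.cong refl)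
      fix j assume "j \<in> {0..<n}"
      then have le: "l (Suc (Suc j)) \<le> l (Suc j)" by (intro GT_antimono[OF l]) auto
      let ?a = "pos (Suc n) l (Suc (Suc j))" and ?b = "pos (Suc n) l (Suc j)"
      \<comment> \<open>\<open>pos\<close> gains one between sizes \<open>n\<close> and
        \<open>Suc n\<close>. Therefore the closed interval of entries becomes the half-open
        interval between neighbouring positions.\<close>
      have "(\<Sum>t\<in>{l (Suc (Suc j))..l (Suc j)}. poly (\<phi> (p j)) (?x j t)) = (\<Sum>t\<in>{?a..<?b}. poly (\<phi> (p j)) (of_int t))"
        by (rule sum.reindex_bij_witness[where i="\<lambda>t. t - int n + int (Suc j)" and j="\<lambda>t. t + int n - int (Suc j)"])
           (auto simp: pos_def)
      also have "\<dots> = poly (antidif (\<phi> (p j))) (of_int ?b) - poly (antidif (\<phi> (p j))) (of_int ?a)"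
        by (rule poly_antidif_telescope[symmetric]) (use le in \<open>auto simp: pos_def\<close>)
      finally show "(\<Sum>t\<in>{l (Suc (Suc j))..l (Suc j)}. poly (\<phi> (p j)) (?x j t)) = \<dots>" .
    qed
    finally show ?thesis .
  qed
  have "(\<Sum>\<mu>\<in>below n l. eval_det n \<mu> \<phi>) = (\<Sum>p | p permutes {0..<n}. of_int (sign p) *
     (\<Sum>\<mu>\<in>below n l. \<Prod>j = 0..<n. poly (\<phi> (p j)) (of_int (pos n \<mu> (Suc j)))))"
    unfolding eval_det_def ddet_Leibniz_transpose by (subst sum.swap) (simp add: sum_distrib_left)
  also have "\<dots> = ddet n (\<lambda>i j. poly (antidif (\<phi> i)) (of_int (pos (Suc n) l (Suc j)))
        - poly (antidif (\<phi> i)) (of_int (pos (Suc n) l (Suc (Suc j)))))"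
    unfolding one ddet_Leibniz_transpose ..
  also have "\<dots> = ddet (Suc n) (\<lambda>i j. if i < n then poly (antidif (\<phi> i)) (of_int (pos (Suc n) l (Suc j))) else 1)"
    by (rule ddet_differences[symmetric])
  also have "\<dots> = eval_det (Suc n) l (\<lambda>i. if i < n then antidif (\<phi> i) else 1)"
    unfolding eval_det_def by (rule ddet_cong) auto
  finally show ?thesis .
qed

text \<open>The function is pushed up through all Gelfand-Tsetlin patterns with top row
  \<open>l\<close>, truncated at size \<open>n\<close>. For Schur functions this is the iterated
  branching rule.\<close>

fun down :: "nat \<Rightarrow> nat \<Rightarrow> ((nat \<Rightarrow> int) \<Rightarrow> complex) \<Rightarrow> (nat \<Rightarrow> int) \<Rightarrow> complex" where
  "down n 0 g l = g l"
| "down n (Suc r) g l = (\<Sum>\<mu>\<in>below (n + r) l. down n r g \<mu>)"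

lemma down_cong: "(\<And>\<mu>. \<mu> \<in> GT n \<Longrightarrow> g \<mu> = h \<mu>) \<Longrightarrow> l \<in> GT (n + r) \<Longrightarrow> down n r g l = down n r h l"
  by (induction r arbitrary: l) (auto intro!: sum.cong)

lemma down_add: "down n r (\<lambda>\<mu>. g \<mu> + h \<mu>) l = down n r g l + down n r h l"
  by (induction r arbitrary: l) (auto simp: sum.distrib)

lemma down_mult_left: "down n r (\<lambda>\<mu>. c * g \<mu>) l = c * down n r g l"
  by (induction r arbitrary: l) (auto simp: sum_distrib_left)

lemma down_diff: "down n r (\<lambda>\<mu>. g \<mu> - h \<mu>) l = down n r g l - down n r h l"
  using down_add[of n r g "\<lambda>\<mu>. -1 * h \<mu>" l] down_mult_left[of n r "-1" h l] by simp

lemma down_sum: "finite I \<Longrightarrow> down n r (\<lambda>\<mu>. \<Sum>i\<in>I. g i \<mu>) l = (\<Sum>i\<in>I. down n r (g i) l)"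
proof (induction I rule: finite_induct)
  case empty
  show ?case using down_mult_left[of n r 0 "\<lambda>_. 0" l] by simp
qed (simp add: down_add)

text \<open>Every step up takes antidifferences of the old rows and appends a row of ones, so rows
  appended later have undergone fewer antidifferences.\<close>

definition ext_rows :: "nat \<Rightarrow> nat \<Rightarrow> (nat \<Rightarrow> complex poly) \<Rightarrow> nat \<Rightarrow> complex poly" where
  "ext_rows n r \<phi> i = (if i < n then (antidif ^^ r) (\<phi> i) else (antidif ^^ (n + r - 1 - i)) 1)"

lemma down_eval_det:
  assumes "l \<in> GT (n + r)"
  shows "down n r (\<lambda>\<mu>. eval_det n \<mu> \<phi>) l = eval_det (n + r) l (ext_rows n r \<phi>)"
  using assms
proof (induction r arbitrary: l)
  case 0
  then show ?case by (auto intro!: eval_det_cong simp: ext_rows_def)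
next
  case (Suc r)
  have "down n (Suc r) (\<lambda>\<mu>. eval_det n \<mu> \<phi>) l = (\<Sum>\<mu>\<in>below (n + r) l. eval_det (n + r) \<mu> (ext_rows n r \<phi>))"
    by (auto intro!: sum.cong Suc.IH)
  also have "\<dots> = eval_det (Suc (n + r)) l (\<lambda>i. if i < n + r then antidif (ext_rows n r \<phi> i) else 1)"
    by (rule sum_below_eval_det) (use Suc.prems in simp)
  also have "\<dots> = eval_det (n + Suc r) l (ext_rows n (Suc r) \<phi>)"
    unfolding add_Suc_right
  proof (rule eval_det_cong)
    fix i assume i: "i < Suc (n + r)"
    consider "i < n" | "n \<le> i" "i < n + r" | "i = n + r" using i by linarith
    then show "(if i < n + r then antidif (ext_rows n r \<phi> i) else 1) = ext_rows n (Suc r) \<phi> i"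
    proof cases
      case 2
      then have "n + Suc r - 1 - i = Suc (n + r - 1 - i)" by linarith
      then show ?thesis using 2 by (simp add: ext_rows_def)
    qed (auto simp: ext_rows_def)
  qed
  finally show ?case .
qed

text \<open>The binomial polynomials of degree \<open>n - 1 - i\<close>. Starting from size 0 the
  array sums generate exactly these rows, so their alternant counts Gelfand-Tsetlin patterns: the
  dimension formula.\<close>

definition base_rows :: "nat \<Rightarrow> nat \<Rightarrow> complex poly" where
  "base_rows n i = (antidif ^^ (n - 1 - i)) 1"

lemma ext_base_rows: "i < n + r \<Longrightarrow> ext_rows n r (base_rows n) i = base_rows (n + r) i"
proof -
  assume "i < n + r"
  have "(antidif ^^ r) ((antidif ^^ (n - 1 - i)) p) = (antidif ^^ (n + r - 1 - i)) p" if "i < n" for p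
  proof -
    have "r + (n - 1 - i) = n + r - 1 - i" using that by simp
    then show ?thesis by (metis comp_apply funpow_add)
  qed
  then show ?thesis by (auto simp: ext_rows_def base_rows_def)
qed

lemma schur_cong: "(\<And>i. 1 \<le> i \<Longrightarrow> i \<le> n \<Longrightarrow> x i = y i) \<Longrightarrow> schur n l x = schur n l y"
proof (induction n arbitrary: l)
  case (Suc n)
  have "schur n \<mu> x = schur n \<mu> y" for \<mu> by (rule Suc.IH) (use Suc.prems in auto)
  then show ?case using Suc.prems[of "Suc n"] by (simp cong: sum.cong)
qed simp

lemma schur_one: "l \<in> GT n \<Longrightarrow> schur n l (\<lambda>_. 1) = eval_det n l (base_rows n)"
proof (induction n arbitrary: l)
  case 0
  then show ?case by (simp add: eval_det_def ddet_Leibniz)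
next
  case (Suc n)
  have "schur (Suc n) l (\<lambda>_. 1) = (\<Sum>\<mu>\<in>below n l. eval_det n \<mu> (base_rows n))"
    using Suc.IH by (auto intro!: sum.cong)
  also have "\<dots> = down n 1 (\<lambda>\<mu>. eval_det n \<mu> (base_rows n)) l" by simp
  also have "\<dots> = eval_det (n + 1) l (ext_rows n 1 (base_rows n))"
    by (rule down_eval_det) (use Suc.prems in simp)
  also have "\<dots> = eval_det (n + 1) l (base_rows (n + 1))"
    by (rule eval_det_cong) (rule ext_base_rows)
  finally show ?case by simp
qed

lemma schur_down:
  assumes "l \<in> GT (n + r)"
  shows "schur (n + r) l (\<lambda>i. if i \<le> n then x i else 1) = down n r (\<lambda>\<mu>. schur n \<mu> x) l"
  using assms
proof (induction r arbitrary: l)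
  case 0
  then show ?case by (auto intro: schur_cong)
next
  case (Suc r)
  then show ?case by (auto intro!: sum.cong)
qed

lemma eval_det_zero_row: "i < n \<Longrightarrow> ps i = 0 \<Longrightarrow> eval_det n l ps = 0"
proof -
  assume i: "i < n" "ps i = 0"
  let ?f = "\<lambda>i j. poly (ps i) (of_int (pos n l (Suc j)))"
  have "?f = ?f(i := \<lambda>j. 0 * 0 + 0 * 0)" using i by (auto simp: fun_eq_iff)
  then have "ddet n ?f = 0 * ddet n (?f(i := \<lambda>j. 0)) + 0 * ddet n (?f(i := \<lambda>j. 0))"
    using ddet_row_linear[OF i(1), of ?f 0 "\<lambda>_. 0" 0 "\<lambda>_. 0"] by metis
  then show ?thesis by (simp add: eval_det_def)
qed

lemma eval_det_update: "eval_det n l (\<phi>(i := q)) =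
   ddet n ((\<lambda>i j. poly (\<phi> i) (of_int (pos n l (Suc j))))(i := \<lambda>j. poly q (of_int (pos n l (Suc j)))))"
  unfolding eval_det_def by (rule ddet_cong) auto

definition psum :: "nat \<Rightarrow> (nat \<Rightarrow> int) \<Rightarrow> complex poly \<Rightarrow> complex" where
  "psum n \<mu> g = (\<Sum>m<n. poly g (of_int (pos n \<mu> (Suc m))))"

text \<open>Multiplying rows by \<open>g\<close> is right multiplication by the diagonal matrix of
  values of \<open>g\<close> at the positions. The trace of that matrix is the power sum, and
  \<open>ddet_trace\<close> converts it into a derivation.\<close>

lemma theta_psum:
  "(\<Prod>(g,t)\<leftarrow>gts. psum n \<mu> g - t) * eval_det n \<mu> \<phi> =
     theta (eval_det n \<mu>) n (map (\<lambda>(g,t). (\<lambda>p. g * p, t)) gts) \<phi>"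
proof (induction gts arbitrary: \<phi>)
  case Nil
  then show ?case by simp
next
  case (Cons gt gts)
  obtain g t where gt: "gt = (g, t)" by (cases gt)
  let ?f = "\<lambda>i j. poly (\<phi> i) (of_int (pos n \<mu> (Suc j)))"
  let ?a = "\<lambda>i j. if i = j then poly g (of_int (pos n \<mu> (Suc j))) else 0"
  have "(\<Sum>i<n. eval_det n \<mu> (\<phi>(i := g * \<phi> i))) = (\<Sum>i<n. ddet n (?f(i := \<lambda>j. \<Sum>m<n. ?f i m * ?a m j)))"
    unfolding eval_det_update by (intro sum.cong refl ddet_cong) (auto simp: if_distrib cong: if_cong)
  also have "\<dots> = (\<Sum>m<n. ?a m m) * ddet n ?f" by (rule ddet_trace)
  finally have "(\<Sum>i<n. eval_det n \<mu> (\<phi>(i := g * \<phi> i))) = psum n \<mu> g * eval_det n \<mu> \<phi>"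
    by (simp add: eval_det_def psum_def)
  then have "(psum n \<mu> g - t) * (\<Prod>(g,t)\<leftarrow>gts. psum n \<mu> g - t) * eval_det n \<mu> \<phi>
    = (\<Sum>i<n. (\<Prod>(g,t)\<leftarrow>gts. psum n \<mu> g - t) * eval_det n \<mu> (\<phi>(i := g * \<phi> i)))
       - t * ((\<Prod>(g,t)\<leftarrow>gts. psum n \<mu> g - t) * eval_det n \<mu> \<phi>)"
    unfolding sum_distrib_left[symmetric] by (simp add: algebra_simps)
  then show ?case
    unfolding Cons.IH gt
    by (simp only: list.map prod_list.Cons case_prod_conv theta.simps fst_conv snd_conv)
qed

definition conj_mult :: "nat \<Rightarrow> complex poly \<Rightarrow> complex poly \<Rightarrow> complex poly" where
  "conj_mult r g p = (antidif ^^ r) (g * (dif ^^ r) p)"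

text \<open>Going up \<open>r\<close> sizes applies \<open>antidif ^^ r\<close> to a row, which
  \<open>dif ^^ r\<close> undoes; hence the conjugation. The derivation upstairs also visits the
  appended rows, but these come from 1 by fewer than \<open>r\<close> antidifferences and
  \<open>dif ^^ r\<close> kills them.\<close>

lemma down_theta:
  assumes l: "l \<in> GT (n + r)"
  shows "down n r (\<lambda>\<mu>. theta (eval_det n \<mu>) n (map (\<lambda>(g,t). (\<lambda>p. g * p, t)) gts) \<phi>) l =
     theta (eval_det (n + r) l) (n + r) (map (\<lambda>(g,t). (conj_mult r g, t)) gts) (ext_rows n r \<phi>)"
proof (induction gts arbitrary: \<phi>)
  case Nil
  then show ?case using down_eval_det[OF l] by simp
next
  case (Cons kt gts)
  obtain g t where kt: "kt = (g, t)" by (cases kt)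
  let ?T = "theta (eval_det (n + r) l) (n + r) (map (\<lambda>(g,t). (conj_mult r g, t)) gts)"
  have "(\<Sum>i<n + r. ?T ((ext_rows n r \<phi>)(i := conj_mult r g (ext_rows n r \<phi> i)))) =
        (\<Sum>i<n. ?T (ext_rows n r (\<phi>(i := g * \<phi> i))))"
  proof (rule sum.mono_neutral_cong_right)
    show "\<forall>i\<in>{..<n + r} - {..<n}. ?T ((ext_rows n r \<phi>)(i := conj_mult r g (ext_rows n r \<phi> i))) = 0"
    proof
      fix i assume i: "i \<in> {..<n + r} - {..<n}"
      define s where "s = n + r - 1 - i"
      have "Suc s \<le> r" using i by (auto simp: s_def)
      then obtain q where q: "r = q + Suc 0 + s" by (metis add.commute add_Suc_right add_0_right le_iff_add)
      have "(dif ^^ r) ((antidif ^^ s) 1) = (dif ^^ q) (dif ((dif ^^ s) ((antidif ^^ s) 1)))"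
        unfolding q funpow_add by simp
      also have "\<dots> = 0" by (simp, simp add: dif_def pcompose_1)
      finally have "conj_mult r g (ext_rows n r \<phi> i) = 0"
        using i by (simp add: conj_mult_def ext_rows_def s_def)
      then show "?T ((ext_rows n r \<phi>)(i := conj_mult r g (ext_rows n r \<phi> i))) = 0"
        using i by (intro theta_zero_row[where z=0 and i=i]) (auto simp: conj_mult_def intro: eval_det_zero_row)
    qed
    show "?T ((ext_rows n r \<phi>)(i := conj_mult r g (ext_rows n r \<phi> i))) = ?T (ext_rows n r (\<phi>(i := g * \<phi> i)))"
      if "i \<in> {..<n}" for i
    proof (rule arg_cong[where f="?T"])
      show "(ext_rows n r \<phi>)(i := conj_mult r g (ext_rows n r \<phi> i)) = ext_rows n r (\<phi>(i := g * \<phi> i))"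
        using that by (auto simp: fun_eq_iff ext_rows_def conj_mult_def)
    qed
  qed auto
  then show ?case
    by (simp add: kt down_diff down_sum down_mult_left Cons.IH del: fun_upd_apply)
qed

lemma theta_rows_cong:
  assumes "\<And>us vs. (\<And>i. i < N \<Longrightarrow> us i = vs i) \<Longrightarrow> D us = D vs" "\<And>i. i < N \<Longrightarrow> us i = vs i"
  shows "theta D N xs us = theta D N xs vs"
  using assms(2)
proof (induction xs arbitrary: us vs)
  case Nil
  show ?case unfolding theta.simps by (rule assms(1)[OF Nil])
next
  case (Cons x xs)
  have "theta D N xs (us(i := fst x (us i))) = theta D N xs (vs(i := fst x (vs i)))" if "i < N" for i
    by (rule Cons.IH) (use Cons.prems that in auto)
  moreover have "theta D N xs us = theta D N xs vs" by (rule Cons.IH) (use Cons.prems in auto)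
  ultimately show ?case by simp
qed

lemma down_psums:
  assumes l: "l \<in> GT (n + r)"
  shows "down n r (\<lambda>\<mu>. (\<Prod>(g,t)\<leftarrow>gts. psum n \<mu> g - t) * schur n \<mu> (\<lambda>_. 1)) l =
     theta (eval_det (n + r) l) (n + r) (map (\<lambda>(g,t). (conj_mult r g, t)) gts) (base_rows (n + r))"
proof -
  have "down n r (\<lambda>\<mu>. (\<Prod>(g,t)\<leftarrow>gts. psum n \<mu> g - t) * schur n \<mu> (\<lambda>_. 1)) l =
     down n r (\<lambda>\<mu>. theta (eval_det n \<mu>) n (map (\<lambda>(g,t). (\<lambda>p. g * p, t)) gts) (base_rows n)) l"
    by (rule down_cong[OF _ l]) (simp add: schur_one theta_psum)
  also have "\<dots> = theta (eval_det (n + r) l) (n + r) (map (\<lambda>(g,t). (conj_mult r g, t)) gts) (ext_rows n r (base_rows n))"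
    by (rule down_theta[OF l])
  also have "\<dots> = theta (eval_det (n + r) l) (n + r) (map (\<lambda>(g,t). (conj_mult r g, t)) gts) (base_rows (n + r))"
    by (rule theta_rows_cong) (auto intro: eval_det_cong ext_base_rows)
  finally show ?thesis .
qed

subsection \<open>Coordinates at infinity\<close>

lemma degree_antidif: "p \<noteq> 0 \<Longrightarrow> degree (antidif p) = Suc (degree p)"
  using degree_dif_less[of "antidif p"] degree_antidif_le[of p] by simp

lemma degree_base_rows: "i < n \<Longrightarrow> degree (base_rows n i) = n - 1 - i \<and> base_rows n i \<noteq> 0"
proof -
  have "degree ((antidif ^^ k) 1) = k \<and> (antidif ^^ k) 1 \<noteq> 0" for k
  proof (induction k)
    case (Suc k)
    moreover have "antidif ((antidif ^^ k) 1) \<noteq> 0" using Suc by (metis dif_antidif dif_0)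
    ultimately show ?case using degree_antidif[of "(antidif ^^ k) 1"] by simp
  qed simp
  then show ?thesis by (simp add: base_rows_def)
qed

definition linop :: "(complex poly \<Rightarrow> complex poly) \<Rightarrow> bool" where
  "linop T \<longleftrightarrow> (\<forall>p q. T (p + q) = T p + T q) \<and> (\<forall>c p. T (Polynomial.smult c p) = Polynomial.smult c (T p))"

lemma linop_sum: "linop T \<Longrightarrow> T (\<Sum>i\<in>I. Polynomial.smult (c i) (p i)) = (\<Sum>i\<in>I. Polynomial.smult (c i) (T (p i)))"
proof (induction I rule: infinite_finite_induct)
  case empty
  then have "T (Polynomial.smult 0 0) = Polynomial.smult 0 (T 0)" unfolding linop_def by blast
  then show ?case by simp
next
  case (infinite I)
  then have "T (Polynomial.smult 0 0) = Polynomial.smult 0 (T 0)" unfolding linop_def by blast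
  then show ?case using infinite by simp
qed (simp add: linop_def)

locale coords =
  fixes N :: nat and l :: "nat \<Rightarrow> int"
  assumes N_pos: "0 < N"
begin

definition scaled_pos :: "nat \<Rightarrow> complex" where "scaled_pos i = of_int (pos N l (Suc i)) / of_nat N"

definition denom :: "complex fps" where "denom = (\<Prod>i<N. 1 - fps_const (scaled_pos i) * fps_X)"

definition hcoeff :: "int \<Rightarrow> complex" where "hcoeff z = (if 0 \<le> z then fps_nth (inverse denom) (nat z) else 0)"

lemma denom_0: "fps_nth denom 0 = 1"
proof -
  have "fps_nth (\<Prod>i<n. 1 - fps_const (c i) * fps_X) 0 = (1 :: complex)" for n and c :: "nat \<Rightarrow> complex"
    by (induction n) simp_all
  then show ?thesis by (simp add: denom_def)
qed

lemma hcoeff_0: "hcoeff 0 = 1" "z < 0 \<Longrightarrow> hcoeff z = 0"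
  by (simp_all add: hcoeff_def denom_0)

text \<open>\<open>coord p m\<close> is the coefficient of \<open>y\<^sup>m\<close> in \<open>p(Ny) / \<Prod>(y - l\<^sub>i/N)\<close>, cut off below \<open>m = -N\<close>;
  \<open>hcoeff\<close> holds the complete homogeneous symmetric functions of the points \<open>l\<^sub>i/N\<close>.\<close>
definition coord :: "complex poly \<Rightarrow> int \<Rightarrow> complex" where
  "coord p m = (if m < - int N then 0 else
     (\<Sum>j\<le>degree p. coeff p j * of_nat N ^ j * hcoeff (int j - int N - m)))"

lemma coord_eq: "degree p \<le> d \<Longrightarrow> - int N \<le> m \<Longrightarrow>
    coord p m = (\<Sum>j\<le>d. coeff p j * of_nat N ^ j * hcoeff (int j - int N - m))"
  unfolding coord_def by (auto intro!: sum.mono_neutral_left intro: le_degree)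

lemma coord_low: "m < - int N \<Longrightarrow> coord p m = 0"
  by (simp add: coord_def)

lemma coord_add: "coord (p + q) m = coord p m + coord q m"
proof (cases "m < - int N")
  case False
  let ?d = "max (degree p) (degree q)"
  have "degree (p + q) \<le> ?d" by (rule degree_add_le_max)
  then show ?thesis using False
    by (simp add: coord_eq[of _ ?d] sum.distrib[symmetric] algebra_simps)
qed (simp add: coord_def)

lemma coord_smult: "coord (Polynomial.smult c p) m = c * coord p m"
proof (cases "m < - int N")
  case False
  have "degree (Polynomial.smult c p) \<le> degree p" by (rule degree_smult_le)
  then show ?thesis using False
    by (simp add: coord_eq[of _ "degree p"] sum_distrib_left algebra_simps)
qed (simp add: coord_def)

lemma coord_0 [simp]: "coord 0 m = 0"
  by (simp add: coord_def)

lemma coord_diff: "coord (p - q) m = coord p m - coord q m"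
  using coord_add[of "p - q" q m] by simp

lemma coord_sum: "coord (\<Sum>i\<in>I. p i) m = (\<Sum>i\<in>I. coord (p i) m)"
  by (induction I rule: infinite_finite_induct) (auto simp: coord_add)

lemma coord_high: "int (degree p) - int N < m \<Longrightarrow> coord p m = 0"
  unfolding coord_def by (auto intro!: sum.neutral simp: hcoeff_0(2))

lemma coord_lead: "coord p (int (degree p) - int N) = lead_coeff p * of_nat N ^ degree p"
proof -
  let ?d = "degree p"
  have "coord p (int ?d - int N) = (\<Sum>j\<le>?d. coeff p j * of_nat N ^ j * hcoeff (int j - int N - (int ?d - int N)))"
    by (rule coord_eq) auto
  also have "\<dots> = (\<Sum>j\<le>?d. if j = ?d then coeff p j * of_nat N ^ j else 0)"
  proof (intro sum.cong refl)
    fix j assume "j \<in> {..?d}"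
    then show "coeff p j * of_nat N ^ j * hcoeff (int j - int N - (int ?d - int N)) = (if j = ?d then coeff p j * of_nat N ^ j else 0)"
      by (cases "j = ?d") (auto simp: hcoeff_0)
  qed
  finally show ?thesis by simp
qed

lemma coord_inj: "(\<And>m. coord p m = 0) \<Longrightarrow> p = 0"
  using coord_lead[of p] N_pos by (metis mult_eq_0_iff leading_coeff_0_iff of_nat_0_eq_iff power_not_zero gr_implies_not0)

text \<open>Since x = N y, multiplication by x shifts coordinates. At level \<open>- int N\<close>
  the coordinate shifted in has been cut away, hence the strict bound.\<close>

lemma coord_mult_X:
  assumes "- int N < m"
  shows "coord ([:0,1:] * p) m = of_nat N * coord p (m - 1)"
proof -
  have "degree ([:0,1:] * p) \<le> Suc (degree p)" by (simp add: degree_pCons_le)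
  then have "coord ([:0,1:] * p) m = (\<Sum>j\<le>Suc (degree p). coeff ([:0,1:] * p) j * of_nat N ^ j * hcoeff (int j - int N - m))"
    using assms by (intro coord_eq) auto
  also have "\<dots> = (\<Sum>j\<le>degree p. coeff p j * of_nat N ^ Suc j * hcoeff (int (Suc j) - int N - m))"
    by (subst sum.atMost_Suc_shift) simp
  also have "\<dots> = of_nat N * coord p (m - 1)"
    using assms by (simp add: coord_eq[of p "degree p"] sum_distrib_left algebra_simps)
  finally show ?thesis .
qed

definition pos_poly :: "complex poly" where "pos_poly = (\<Prod>i<N. [:- of_int (pos N l (Suc i)), 1:])"

lemma degree_prod_lin: "degree (\<Prod>i<n. [:- (c i :: complex), 1:]) = n"
  by (subst degree_prod_eq_sum_degree) auto

text \<open>Read backwards and rescaled by \<open>x\<close>, a product of linear factors X - c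
  becomes a product of factors 1 - (c/x) X. The guards \<open>j \<le> n\<close> let the induction
  range over all \<open>j\<close>.\<close>

lemma coeff_prod_scaled:
  fixes c :: "nat \<Rightarrow> complex"
  assumes x: "x \<noteq> 0"
  shows "coeff (\<Prod>i<n. [:- c i, 1:]) j * x ^ j * (if j \<le> n then 1 else 0)
     = (if j \<le> n then x ^ n * fps_nth (\<Prod>i<n. 1 - fps_const (c i / x) * fps_X) (n - j) else 0)"
proof (induction n arbitrary: j)
  case 0
  then show ?case by (auto simp: coeff_1)
next
  case (Suc n)
  let ?P = "\<Prod>i<n. [:- c i, 1:]" and ?Q = "\<Prod>i<n. 1 - fps_const (c i / x) * fps_X"
  have IH: "coeff ?P k * x ^ k = x ^ n * fps_nth ?Q (n - k)" if "k \<le> n" for k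
    using Suc.IH[of k] that by simp
  have hi: "coeff ?P (Suc n) = 0" by (rule coeff_eq_0) (simp add: degree_prod_lin)
  have PS: "(\<Prod>i<Suc n. [:- c i, 1:]) = pCons 0 ?P - Polynomial.smult (c n) ?P"
    by (simp add: mult.commute)
  have QS: "(\<Prod>i<Suc n. 1 - fps_const (c i / x) * fps_X) = ?Q - fps_const (c n / x) * (fps_X * ?Q)"
    by (simp add: algebra_simps)
  show ?case
  proof (cases j)
    case 0
    have "fps_nth ?Q (Suc n) = 0"
    proof -
      have "?Q = fps_of_poly (\<Prod>i<n. [:1, - (c i / x):])"
        by (simp add: fps_of_poly_prod fps_of_poly_pCons fps_const_neg[symmetric] mult.commute del: fps_const_neg)
      moreover have "degree (\<Prod>i<n. [:1, - (c i / x):]) \<le> n"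
        by (rule order_trans[OF degree_prod_sum_le]) (auto intro!: order_trans[OF sum_bounded_above[where K=1]])
      ultimately show ?thesis by (simp add: coeff_eq_0)
    qed
    then show ?thesis using IH[of 0] x by (simp only: PS QS 0) (simp add: field_simps)
  next
    case (Suc k)
    consider "k = n" | "k < n" | "n < k" by linarith
    then show ?thesis
    proof cases
      case 1
      then show ?thesis using IH[of n] hi by (simp only: PS QS Suc) simp
    next
      case 2
      have "coeff ?P k * x ^ Suc k = x * (x ^ n * fps_nth ?Q (n - k))" using IH[of k] 2 by simp
      moreover have "coeff ?P (Suc k) * x ^ Suc k = x ^ n * fps_nth ?Q (n - Suc k)" using IH[of "Suc k"] 2 by simp
      moreover have "n - k = Suc (n - Suc k)" using 2 by simp
      ultimately show ?thesis using 2 x by (simp only: PS QS Suc) (simp add: field_simps)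
    next
      case 3
      then show ?thesis using Suc by simp
    qed
  qed
qed

text \<open>The left-hand side is the coordinate at level \<open>s\<close> of the monic polynomial
  with roots \<open>c i\<close>, hence a coefficient of a quotient of two products. It serves for
  the positions themselves, where the quotient is 1, and for the positions moved by one, as needed
  for \<open>dif\<close>.\<close>

lemma sum_prod_hcoeff:
  fixes c :: "nat \<Rightarrow> complex"
  shows "(\<Sum>j\<le>N. coeff (\<Prod>i<N. [:- c i, 1:]) j * of_nat N ^ j * hcoeff (int j - int N - s)) =
     (if s \<le> 0 then of_nat N ^ N * fps_nth ((\<Prod>i<N. 1 - fps_const (c i / of_nat N) * fps_X) * inverse denom) (nat (- s)) else 0)"
proof -
  let ?Q = "\<Prod>i<N. 1 - fps_const (c i / of_nat N) * fps_X"
  have "(\<Sum>j\<le>N. coeff (\<Prod>i<N. [:- c i, 1:]) j * of_nat N ^ j * hcoeff (int j - int N - s)) =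
    (\<Sum>j\<le>N. of_nat N ^ N * fps_nth ?Q (N - j) * hcoeff (int j - int N - s))"
  proof (intro sum.cong refl)
    fix j assume "j \<in> {..N}"
    then have "coeff (\<Prod>i<N. [:- c i, 1:]) j * of_nat N ^ j = of_nat N ^ N * fps_nth ?Q (N - j)"
      using coeff_prod_scaled[of "of_nat N" c N j] N_pos by simp
    then show "coeff (\<Prod>i<N. [:- c i, 1:]) j * of_nat N ^ j * hcoeff (int j - int N - s) =
        of_nat N ^ N * fps_nth ?Q (N - j) * hcoeff (int j - int N - s)" by simp
  qed
  also have "\<dots> = (\<Sum>i\<le>N. of_nat N ^ N * fps_nth ?Q i * hcoeff (- int i - s))"
    by (rule sum.reindex_bij_witness[where i="\<lambda>i. N - i" and j="\<lambda>i. N - i"]) auto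
  \<comment> \<open>The numerator has degree at most \<open>N\<close>, so the new terms vanish; the
    larger range contains the full Cauchy product.\<close>
  also have "\<dots> = (\<Sum>i\<in>{0..N + nat (- s)}. of_nat N ^ N * fps_nth ?Q i * hcoeff (- int i - s))"
  proof (rule sum.mono_neutral_left)
    have "fps_nth ?Q i = 0" if "i > N" for i
    proof -
      have "?Q = fps_of_poly (\<Prod>i<N. [:1, - (c i / of_nat N):])"
        by (simp add: fps_of_poly_prod fps_of_poly_pCons fps_const_neg[symmetric] mult.commute del: fps_const_neg)
      moreover have "degree (\<Prod>i<N. [:1, - (c i / of_nat N):]) \<le> N"
        by (rule order_trans[OF degree_prod_sum_le]) (auto intro!: order_trans[OF sum_bounded_above[where K=1]])
      ultimately show ?thesis using that by (simp add: coeff_eq_0)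
    qed
    then show "\<forall>i\<in>{0..N + nat (- s)} - {..N}. of_nat N ^ N * fps_nth ?Q i * hcoeff (- int i - s) = 0" by auto
  qed auto
  also have "\<dots> = (if s \<le> 0 then of_nat N ^ N * fps_nth (?Q * inverse denom) (nat (- s)) else 0)"
  proof (cases "s \<le> 0")
    case True
    have "(\<Sum>i\<in>{0..N + nat (- s)}. of_nat N ^ N * fps_nth ?Q i * hcoeff (- int i - s)) =
        (\<Sum>i\<in>{0..nat (- s)}. of_nat N ^ N * (fps_nth ?Q i * fps_nth (inverse denom) (nat (- s) - i)))"
    proof (rule sum.mono_neutral_cong_right)
      fix i assume i: "i \<in> {0..nat (- s)}"
      then have "nat (- int i - s) = nat (- s) - i" "0 \<le> - int i - s" using True by auto
      then show "of_nat N ^ N * fps_nth ?Q i * hcoeff (- int i - s) =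
          of_nat N ^ N * (fps_nth ?Q i * fps_nth (inverse denom) (nat (- s) - i))"
        by (simp add: hcoeff_def)
    qed (use True in \<open>auto simp: hcoeff_def\<close>)
    then show ?thesis using True by (simp add: fps_mult_nth sum_distrib_left)
  next
    case False
    then show ?thesis by (auto intro!: sum.neutral simp: hcoeff_def)
  qed
  finally show ?thesis .
qed

lemma sum_pos_poly_hcoeff: "(\<Sum>j\<le>N. coeff pos_poly j * of_nat N ^ j * hcoeff (int j - int N - s)) = (if s = 0 then of_nat N ^ N else 0)"
proof -
  have "denom * inverse denom = 1" by (rule inverse_mult_eq_1') (simp add: denom_0)
  then show ?thesis
    unfolding pos_poly_def sum_prod_hcoeff using denom_def by (auto simp: scaled_pos_def)
qed

text \<open>With P(y) the product of the factors y - l_i/N, this is the polynomial part of y^n P(y),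
  the polynomial whose coordinate series is y^n alone. For negative \<open>n\<close> the lowest
  coefficients have to be dropped, which \<open>poly_shift\<close> does.\<close>

definition basis_poly :: "int \<Rightarrow> complex poly" where
  "basis_poly n = (if 0 \<le> n then Polynomial.smult (inverse (of_nat N ^ (N + nat n))) (monom 1 (nat n) * pos_poly)
           else Polynomial.smult (of_nat N ^ nat (- n) / of_nat N ^ N) (poly_shift (nat (- n)) pos_poly))"

lemma degree_pos_poly: "degree pos_poly = N"
  unfolding pos_poly_def by (rule degree_prod_lin)

text \<open>For \<open>n < 0\<close> the polynomial part differs from y^n P(y) by negative powers of
  y. Divided by P these lie below y^(-N), and the cut hides them.\<close>

lemma coord_basis_poly:
  assumes "- int N \<le> n"
  shows "coord (basis_poly n) m = (if m = n then 1 else 0)"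
proof (cases "m < - int N")
  case True
  then show ?thesis using assms by (simp add: coord_low)
next
  case False
  have NN: "of_nat N \<noteq> (0::complex)" using N_pos by simp
  show ?thesis
  proof (cases "0 \<le> n")
    case True
    let ?k = "nat n"
    have "degree (monom 1 ?k * pos_poly) \<le> N + ?k"
      using degree_mult_le[of "monom 1 ?k" pos_poly] degree_monom_le[of "1::complex" ?k] by (simp add: degree_pos_poly)
    then have "coord (monom 1 ?k * pos_poly) m = (\<Sum>j\<le>N + ?k. coeff (monom 1 ?k * pos_poly) j * of_nat N ^ j * hcoeff (int j - int N - m))"
      using False by (intro coord_eq) auto
    also have "\<dots> = (\<Sum>j\<in>{?k..N + ?k}. coeff pos_poly (j - ?k) * of_nat N ^ j * hcoeff (int j - int N - m))"
      by (rule sum.mono_neutral_cong_right) (auto simp: coeff_monom_mult)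
    also have "\<dots> = (\<Sum>j\<le>N. of_nat N ^ ?k * (coeff pos_poly j * of_nat N ^ j * hcoeff (int j - int N - (m - n))))"
      by (rule sum.reindex_bij_witness[where i="\<lambda>j. j - ?k" and j="\<lambda>j. j + ?k", symmetric])
         (use True in \<open>auto simp: power_add algebra_simps\<close>)
    also have "\<dots> = of_nat N ^ ?k * (if m = n then of_nat N ^ N else 0)"
      unfolding sum_distrib_left[symmetric] sum_pos_poly_hcoeff by simp
    finally show ?thesis using True NN by (simp add: basis_poly_def coord_smult power_add field_simps)
  next
    case n: False
    let ?k = "nat (- n)"
    have dg: "degree (poly_shift ?k pos_poly) \<le> N" 
      by (rule degree_le) (auto simp: coeff_poly_shift coeff_eq_0 degree_pos_poly)
    have z: "coeff pos_poly (j + ?k) = 0" if "N - ?k < j" for j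
      using that by (intro coeff_eq_0) (simp add: degree_pos_poly)
    have kN: "?k \<le> N" using assms by simp
    have "of_nat N ^ ?k * coord (poly_shift ?k pos_poly) m = of_nat N ^ ?k * (\<Sum>j\<le>N. coeff (poly_shift ?k pos_poly) j * of_nat N ^ j * hcoeff (int j - int N - m))"
      using False dg by (subst coord_eq[where d=N]) auto
    also have "\<dots> = (\<Sum>j\<le>N. coeff pos_poly (j + ?k) * of_nat N ^ (j + ?k) * hcoeff (int (j + ?k) - int N - (m - n)))"
      using n by (simp add: coeff_poly_shift sum_distrib_left power_add algebra_simps)
    also have "\<dots> = (\<Sum>j\<le>N - ?k. coeff pos_poly (j + ?k) * of_nat N ^ (j + ?k) * hcoeff (int (j + ?k) - int N - (m - n)))"
      by (rule sum.mono_neutral_right) (use z in auto)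
    also have "\<dots> = (\<Sum>j\<in>{?k..N}. coeff pos_poly j * of_nat N ^ j * hcoeff (int j - int N - (m - n)))"
      by (rule sum.reindex_bij_witness[where i="\<lambda>j. j - ?k" and j="\<lambda>j. j + ?k"]) (use kN in auto)
    \<comment> \<open>The coefficients restored here have index below \<open>- n\<close>. Since
      \<open>m \<ge> - int N\<close>, they meet \<open>hcoeff\<close> only at negative
      arguments.\<close>
    also have "\<dots> = (\<Sum>j\<le>N. coeff pos_poly j * of_nat N ^ j * hcoeff (int j - int N - (m - n)))"
      by (rule sum.mono_neutral_left) (use False n in \<open>auto intro!: hcoeff_0(2)\<close>)
    also have "\<dots> = (if m = n then of_nat N ^ N else 0)"
      unfolding sum_pos_poly_hcoeff by simp
    finally have "of_nat N ^ ?k * coord (poly_shift ?k pos_poly) m = (if m = n then of_nat N ^ N else 0)" .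
    then show ?thesis using n NN by (simp add: basis_poly_def coord_smult)
  qed
qed

lemma poly_basis_poly: "0 \<le> n \<Longrightarrow> i < N \<Longrightarrow> poly (basis_poly n) (of_int (pos N l (Suc i))) = 0"
  by (auto simp: basis_poly_def pos_poly_def poly_prod)

lemma basis_poly_expand:
  assumes "degree p \<le> d"
  shows "p = (\<Sum>n\<in>{- int N..int d - int N}. Polynomial.smult (coord p n) (basis_poly n))"
proof -
  let ?q = "\<Sum>n\<in>{- int N..int d - int N}. Polynomial.smult (coord p n) (basis_poly n)"
  have "coord (p - ?q) m = 0" for m
  proof -
    have "coord ?q m = (\<Sum>n\<in>{- int N..int d - int N}. if n = m then coord p n else 0)"
      unfolding coord_sum coord_smult by (intro sum.cong) (auto simp: coord_basis_poly)
    also have "\<dots> = coord p m"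
      using assms coord_low[of m p] coord_high[of p m] by (auto simp: sum.delta)
    finally show ?thesis by (simp add: coord_diff)
  qed
  then have "p - ?q = 0" by (rule coord_inj)
  then show ?thesis by simp
qed

lemma degree_basis_poly: "- int N \<le> n \<Longrightarrow> int (degree (basis_poly n)) = int N + n"
proof -
  assume n: "- int N \<le> n"
  have "basis_poly n \<noteq> 0" using coord_basis_poly[OF n, of n] by auto
  then have "coord (basis_poly n) (int (degree (basis_poly n)) - int N) \<noteq> 0"
    using N_pos by (simp add: coord_lead)
  then show ?thesis using coord_basis_poly[OF n, of "int (degree (basis_poly n)) - int N"] by (auto split: if_splits)
qed

definition evdet :: complex where
  "evdet = ddet N (\<lambda>k j. poly (basis_poly (-1 - int k)) (of_int (pos N l (Suc j))))"

text \<open>Basis polynomials of nonnegative level are multiples of \<open>pos_poly\<close> and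
  vanish at the positions, so evaluation factors through the \<open>N\<close> filled levels. The
  change of basis \<open>evdet\<close> later cancels against the normalising dimension.\<close>

lemma eval_det_vac_det: "eval_det N l ps = evdet * vac_det N (\<lambda>i. coord (ps i))"
proof -
  have "poly p (of_int (pos N l (Suc j))) = (\<Sum>k<N. coord p (-1 - int k) * poly (basis_poly (-1 - int k)) (of_int (pos N l (Suc j))))"
    if j: "j < N" for p j
  proof -
    let ?x = "of_int (pos N l (Suc j)) :: complex"
    let ?d = "degree p + N"
    have "p = (\<Sum>n\<in>{- int N..int ?d - int N}. Polynomial.smult (coord p n) (basis_poly n))"
      by (rule basis_poly_expand) simp
    then have "poly p ?x = (\<Sum>n\<in>{- int N..int ?d - int N}. coord p n * poly (basis_poly n) ?x)"
      by (subst (asm) poly_eq_poly_eq_iff[symmetric]) (simp add: poly_sum fun_eq_iff)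
    also have "\<dots> = (\<Sum>n\<in>{- int N..-1}. coord p n * poly (basis_poly n) ?x)"
      by (rule sum.mono_neutral_right) (use j in \<open>auto simp: poly_basis_poly\<close>)
    also have "\<dots> = (\<Sum>k<N. coord p (-1 - int k) * poly (basis_poly (-1 - int k)) ?x)"
      by (rule sum.reindex_bij_witness[where i="\<lambda>k. -1 - int k" and j="\<lambda>n. nat (-1 - n)"]) auto
    finally show ?thesis .
  qed
  then have "eval_det N l ps = ddet N (\<lambda>i j. \<Sum>k<N. coord (ps i) (-1 - int k) * poly (basis_poly (-1 - int k)) (of_int (pos N l (Suc j))))"
    unfolding eval_det_def by (intro ddet_cong) auto
  then show ?thesis by (simp add: ddet_mult vac_det_def evdet_def)
qed

lemma fsupp_coord: "fsupp (coord p)"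
  by (rule finite_subset[of _ "{- int N..int (degree p) - int N}"])
     (auto simp: not_less[symmetric] dest: coord_low[of _ p] coord_high[of p])

definition op_mat :: "(complex poly \<Rightarrow> complex poly) \<Rightarrow> zmat" where
  "op_mat T m n = (if n < - int N then 0 else coord (T (basis_poly n)) m)"

lemma coord_op_sum:
  assumes "linop T" "degree p \<le> d"
  shows "coord (T p) m = (\<Sum>n\<in>{- int N..int d - int N}. op_mat T m n * coord p n)"
proof -
  have "coord (T p) m = coord (T (\<Sum>n\<in>{- int N..int d - int N}. Polynomial.smult (coord p n) (basis_poly n))) m"
    using basis_poly_expand[OF assms(2)] by simp
  also have "\<dots> = (\<Sum>n\<in>{- int N..int d - int N}. op_mat T m n * coord p n)"
    unfolding linop_sum[OF assms(1)] coord_sum coord_smult by (intro sum.cong) (auto simp: op_mat_def)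
  finally show ?thesis .
qed

lemma coord_op: "linop T \<Longrightarrow> coord (T p) = zapply (op_mat T) (coord p)"
proof
  fix m assume "linop T"
  then have "coord (T p) m = (\<Sum>n\<in>{- int N..int (degree p) - int N}. op_mat T m n * coord p n)"
    by (rule coord_op_sum) simp
  also have "\<dots> = zapply (op_mat T) (coord p) m"
    by (rule zapply_superset[symmetric]) (auto intro: coord_low coord_high)
  finally show "coord (T p) m = zapply (op_mat T) (coord p) m" .
qed

lemma cutmat_op_mat: "cutmat N (op_mat T)"
  unfolding cutmat_def op_mat_def using fsupp_coord coord_low by (auto split: if_splits simp: not_less[symmetric])

lemma banded_op_mat:
  assumes "\<And>p. degree (T p) \<le> degree p + k"
  shows "banded k (op_mat T)"
  unfolding banded_def op_mat_def
proof (intro allI impI)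
  fix m n :: int assume mn: "n + int k < m"
  show "(if n < - int N then 0 else coord (T (basis_poly n)) m) = 0"
  proof (cases "n < - int N")
    case False
    then have "int (degree (T (basis_poly n))) - int N < m" using assms[of "basis_poly n"] degree_basis_poly[of n] mn by linarith
    then show ?thesis by (simp add: coord_high)
  qed simp
qed

lemma flag_rows_base: "flag_rows N (\<lambda>i. coord (base_rows N i))"
  unfolding flag_rows_def
proof (intro allI impI conjI)
  fix i assume i: "i < N"
  have d: "int (degree (base_rows N i)) - int N = -1 - int i"
    using degree_base_rows[OF i] i by (simp add: of_nat_diff)
  show "coord (base_rows N i) (-1 - int i) \<noteq> 0"
    unfolding d[symmetric] coord_lead using conjunct2[OF degree_base_rows[OF i]] N_pos by simp
  fix m assume "coord (base_rows N i) m \<noteq> 0"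
  then show "- int N \<le> m" "m \<le> -1 - int i"
    using coord_low[of m "base_rows N i"] coord_high[of "base_rows N i" m] unfolding d by (auto simp: not_less[symmetric])
qed

lemma theta_op_mat:
  assumes "\<And>T. T \<in> set Ts \<Longrightarrow> linop (fst T)"
  shows "theta (eval_det N l) N Ts ps = evdet * theta (vac_det N) N (map (\<lambda>(T,t). (zapply (op_mat T), t)) Ts) (\<lambda>i. coord (ps i))"
  using assms
proof (induction Ts arbitrary: ps)
  case Nil
  then show ?case by (simp add: eval_det_vac_det)
next
  case (Cons Tt Ts)
  obtain T t where Tt: "Tt = (T, t)" by (cases Tt)
  have T: "linop T" using Cons.prems[of Tt] Tt by simp
  have "(\<lambda>k. coord ((ps(i := T (ps i))) k)) = (\<lambda>k. coord (ps k))(i := zapply (op_mat T) (coord (ps i)))" for i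
    by (auto simp: fun_eq_iff coord_op[OF T])
  moreover have "theta (eval_det N l) N Ts ps = evdet * theta (vac_det N) N (map (\<lambda>(T,t). (zapply (op_mat T), t)) Ts) (\<lambda>i. coord (ps i))" for ps
    by (rule Cons.IH) (use Cons.prems in auto)
  ultimately show ?case
    by (simp add: Tt sum_distrib_left algebra_simps del: fun_upd_apply)
qed

end

lemma linop_conj_mult: "linop (conj_mult r g)"
  unfolding linop_def
proof -
  have d: "(dif ^^ r) (p + q) = (dif ^^ r) p + (dif ^^ r) q" "(dif ^^ r) (Polynomial.smult c p) = Polynomial.smult c ((dif ^^ r) p)" for p q c
    by (induction r) (auto simp: dif_add dif_smult)
  have S: "antidif (p + q) = antidif p + antidif q" "antidif (Polynomial.smult c p) = Polynomial.smult c (antidif p)" for p q c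
    by (rule antidif_unique[symmetric]; simp add: dif_add dif_smult antidif_0)+
  have Sr: "(antidif ^^ r) (p + q) = (antidif ^^ r) p + (antidif ^^ r) q" "(antidif ^^ r) (Polynomial.smult c p) = Polynomial.smult c ((antidif ^^ r) p)" for p q c
    by (induction r) (auto simp: S)
  show "(\<forall>p q. conj_mult r g (p + q) = conj_mult r g p + conj_mult r g q) \<and> (\<forall>c p. conj_mult r g (Polynomial.smult c p) = Polynomial.smult c (conj_mult r g p))"
    by (simp add: conj_mult_def d Sr distrib_left)
qed

subsection \<open>The matrices of the power sums\<close>

lemma degree_antidif_pow: "degree ((antidif ^^ r) p) \<le> degree p + r"
  by (induction r) (auto intro: order_trans[OF degree_antidif_le])

lemma degree_dif_pow: "(dif ^^ r) p \<noteq> 0 \<Longrightarrow> degree ((dif ^^ r) p) + r \<le> degree p"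
proof (induction r)
  case (Suc r)
  then have "(dif ^^ r) p \<noteq> 0" by auto
  then show ?case using Suc degree_dif_less[of "(dif ^^ r) p"] by simp
qed simp

lemma degree_conj_mult: "degree (conj_mult r g p) \<le> degree p + degree g"
proof (cases "(dif ^^ r) p = 0")
  case False
  have "degree (conj_mult r g p) \<le> degree (g * (dif ^^ r) p) + r"
    unfolding conj_mult_def by (rule degree_antidif_pow)
  also have "\<dots> \<le> degree g + degree ((dif ^^ r) p) + r" by (simp add: degree_mult_le)
  finally show ?thesis using degree_dif_pow[OF False] by simp
qed (simp add: conj_mult_def)

lemma conj_mult_mult: "conj_mult r (g * h) p = conj_mult r g (conj_mult r h p)"
  by (simp add: conj_mult_def mult.assoc)

lemma dif_pow_eq_0_degree:
  assumes "(dif ^^ r) p = 0" "0 < r"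
  shows "degree p < r"
  using assms
proof (induction r arbitrary: p)
  case (Suc r)
  show ?case
  proof (cases "dif p = 0")
    case True
    then have "p = [:poly p 0:]" by (rule dif_eq_0_const)
    then have "degree p = 0" by (metis degree_pCons_0)
    then show ?thesis by simp
  next
    case False
    then have "r \<noteq> 0" using Suc.prems by (auto intro: ccontr)
    then have "degree (dif p) < r" using Suc.prems by (intro Suc.IH) (auto simp: funpow_swap1)
    moreover have "degree p \<le> Suc (degree (dif p))"
    proof -
      have "p = antidif (dif p) + [:poly p 0:]" by (simp add: antidif_dif)
      then show ?thesis by (metis degree_antidif_le degree_add_le degree_pCons_0 zero_le)
    qed
    ultimately show ?thesis by simp
  qed
qed simp

lemma dif_pow_mult_X:
  "(dif ^^ Suc r) ([:0,1:] * p) = [:0,1:] * (dif ^^ Suc r) p + of_nat (Suc r) * ((dif ^^ Suc r) p + (dif ^^ r) p)"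
proof (induction r)
  case 0
  show ?case using dif_mult_X[of p] by simp
next
  case (Suc r)
  have m: "dif (of_nat k * q) = of_nat k * dif q" for k q
    by (induction k) (simp_all add: dif_add algebra_simps)
  show ?case
    unfolding funpow.simps(2)[of "Suc r"] o_apply Suc.IH dif_add dif_mult_X m
    by (simp add: algebra_simps)
qed

text \<open>Both expressions agree after \<open>dif ^^ r\<close>, by its commutation relation with
  multiplication by x, and the kernel of \<open>dif ^^ r\<close> consists of polynomials of degree
  less than \<open>r\<close>.\<close>

lemma conj_mult_X_mod:
  assumes "0 < r"
  shows "degree (conj_mult r [:0,1:] p - ([:0,1:] * p - of_nat r * p - of_nat r * antidif p)) < r"
proof (rule dif_pow_eq_0_degree[OF _ assms])
  obtain s where r: "r = Suc s" using assms by (cases r) auto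
  have m: "(dif ^^ k) (of_nat j * q) = of_nat j * (dif ^^ k) q" for k j q
  proof (induction k)
    case (Suc k)
    have "dif (of_nat j * q) = of_nat j * dif q" for q
      by (induction j) (simp_all add: dif_add algebra_simps)
    then show ?case using Suc by simp
  qed simp
  have d: "(dif ^^ k) (p - q) = (dif ^^ k) p - (dif ^^ k) q" for k p q
    by (induction k) (simp_all add: dif_diff)
  have S: "(dif ^^ Suc s) (antidif p) = (dif ^^ s) p"
    unfolding funpow_Suc_right by simp
  have "(dif ^^ r) (conj_mult r [:0,1:] p) = [:0,1:] * (dif ^^ r) p" by (simp add: conj_mult_def)
  then show "(dif ^^ r) (conj_mult r [:0,1:] p - ([:0,1:] * p - of_nat r * p - of_nat r * antidif p)) = 0"
    unfolding d m r dif_pow_mult_X S by (simp add: algebra_simps)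
qed

context coords begin

lemma coord_of_nat_mult: "coord (of_nat k * p) m = of_nat k * coord p m"
  by (induction k) (simp_all add: coord_add algebra_simps)

lemma linop_dif: "linop dif"
  by (simp add: linop_def dif_add dif_smult)

definition dif_mat :: zmat where "dif_mat = op_mat dif"
definition antidif_mat :: zmat where "antidif_mat = op_mat antidif"

lemma linop_antidif: "linop antidif"
proof -
  have "antidif (p + q) = antidif p + antidif q" "antidif (Polynomial.smult c p) = Polynomial.smult c (antidif p)" for p q c
    by (rule antidif_unique[symmetric]; simp add: dif_add dif_smult antidif_0)+
  then show ?thesis by (simp add: linop_def)
qed

lemma dif_mat_upper: "n \<le> m \<Longrightarrow> dif_mat m n = 0"
proof -
  assume mn: "n \<le> m"
  show "dif_mat m n = 0"
  proof (cases "n < - int N \<or> dif (basis_poly n) = 0")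
    case True
    then show ?thesis by (auto simp: dif_mat_def op_mat_def)
  next
    case False
    then show ?thesis
      using degree_dif_less[of "basis_poly n"] degree_basis_poly[of n] mn
      by (auto simp: dif_mat_def op_mat_def intro!: coord_high)
  qed
qed

text \<open>At level 0 the basis polynomial is a multiple of the monic one with roots at the
  positions. Shifting its argument moves every root by -1, which gives the quotient of products; the
  series 1 that \<open>dif\<close> subtracts sits at level 0 only.\<close>

lemma dif_mat_zero:
  assumes "- int N \<le> m"
  shows "dif_mat m 0 = (if m < 0 then fps_nth ((\<Prod>i<N. 1 - fps_const (scaled_pos i - 1 / of_nat N) * fps_X) * inverse denom) (nat (- m)) else 0)"
proof (cases "m < 0")
  case True
  let ?R = "\<Prod>i<N. [:- (of_int (pos N l (Suc i)) - 1), 1:] :: complex poly"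
  have NN: "of_nat N \<noteq> (0::complex)" using N_pos by simp
  have e0: "basis_poly 0 = Polynomial.smult (inverse (of_nat N ^ N)) pos_poly" by (simp add: basis_poly_def)
  have sh: "pcompose pos_poly [:1,1:] = ?R"
    unfolding pos_poly_def pcompose_prod by (intro prod.cong refl) (simp add: pcompose_pCons)
  have "dif (basis_poly 0) = Polynomial.smult (inverse (of_nat N ^ N)) ?R - basis_poly 0"
    unfolding e0 dif_smult by (simp add: dif_def sh smult_diff_right)
  then have "dif_mat m 0 = inverse (of_nat N ^ N) * coord ?R m"
    using True by (simp add: dif_mat_def op_mat_def coord_diff coord_smult coord_basis_poly)
  also have "coord ?R m = (\<Sum>j\<le>N. coeff ?R j * of_nat N ^ j * hcoeff (int j - int N - m))"
    by (rule coord_eq[OF _ assms]) (simp only: degree_prod_lin order_refl)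
  also have "\<dots> = of_nat N ^ N * fps_nth ((\<Prod>i<N. 1 - fps_const (scaled_pos i - 1 / of_nat N) * fps_X) * inverse denom) (nat (- m))"
    using True unfolding sum_prod_hcoeff by (simp add: scaled_pos_def diff_divide_distrib)
  finally show ?thesis using True NN by simp
qed (simp add: dif_mat_upper)

text \<open>This is the commutation relation \<open>\<nabla>x = x\<nabla> + \<nabla> + 1\<close>; it propagates the explicit column \<open>n = 0\<close> to all columns.\<close>
lemma dif_mat_step:
  assumes "- int N \<le> n" "- int N < m"
  shows "dif_mat m (n + 1) = dif_mat (m - 1) n + (dif_mat m n + (if m = n then 1 else 0)) / of_nat N"
proof -
  have NN: "of_nat N \<noteq> (0::complex)" using N_pos by simp
  let ?x = "[:0,1:] * basis_poly n"
  \<comment> \<open>Multiplication by x sends y^n to N y^(n+1), up to an error that the cut leaves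
    at the lowest level. That error is a constant polynomial, so \<open>dif\<close> removes
    it.\<close>
  define c where "c = coord ?x (- int N)"
  have "?x = of_nat N * basis_poly (n + 1) + Polynomial.smult c (basis_poly (- int N))" if "n + 1 \<noteq> - int N"
  proof -
    have "coord (?x - (of_nat N * basis_poly (n + 1) + Polynomial.smult c (basis_poly (- int N)))) k = 0" for k
    proof -
      consider "k < - int N" | "k = - int N" | "- int N < k" by linarith
      then show ?thesis
      proof cases
        case 2
        then show ?thesis using assms
          by (simp add: coord_diff coord_add coord_smult coord_of_nat_mult coord_basis_poly c_def)
      next
        case 3
        then show ?thesis using assms
          by (simp add: coord_diff coord_add coord_smult coord_of_nat_mult coord_basis_poly coord_mult_X del: mult_pCons_left)
      qed (simp add: coord_low)
    qed
    then show ?thesis using coord_inj[of "?x - (of_nat N * basis_poly (n + 1) + Polynomial.smult c (basis_poly (- int N)))"] by simp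
  qed
  then have x: "?x = of_nat N * basis_poly (n + 1) + Polynomial.smult c (basis_poly (- int N))" using assms by simp
  have "degree (basis_poly (- int N)) = 0" using degree_basis_poly[of "- int N"] by simp
  then have "dif (basis_poly (- int N)) = 0" by (metis degree_dif_less not_less0)
  moreover have m: "dif (of_nat k * q) = of_nat k * dif q" for k q
    by (induction k) (simp_all add: dif_add algebra_simps)
  ultimately have "dif ?x = of_nat N * dif (basis_poly (n + 1))"
    unfolding x by (simp add: dif_add dif_smult)
  then have "of_nat N * dif (basis_poly (n + 1)) = [:0,1:] * dif (basis_poly n) + dif (basis_poly n) + basis_poly n"
    by (simp only: dif_mult_X)
  then have "coord (of_nat N * dif (basis_poly (n + 1))) m = coord ([:0,1:] * dif (basis_poly n) + dif (basis_poly n) + basis_poly n) m" by simp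
  then have "of_nat N * dif_mat m (n + 1) = of_nat N * dif_mat (m - 1) n + dif_mat m n + (if m = n then 1 else 0)"
    using assms unfolding coord_add coord_of_nat_mult coord_mult_X[OF assms(2)]
    by (simp add: dif_mat_def op_mat_def coord_basis_poly)
  then show ?thesis using NN by (simp add: field_simps)
qed

lemma antidif_mat_upper: "n + 1 < m \<Longrightarrow> antidif_mat m n = 0"
  using banded_op_mat[of antidif 1] degree_antidif_le by (auto simp: antidif_mat_def banded_def)

text \<open>\<open>dif\<close> lowers strictly and \<open>antidif\<close> raises by at most one, so
  the identity becomes a finite triangular system from which the antidifference matrix can be
  solved.\<close>

lemma dif_mat_antidif_mat:
  assumes "- int N \<le> m" "- int N \<le> n"
  shows "(\<Sum>p\<in>{m + 1..n + 1}. dif_mat m p * antidif_mat p n) = (if m = n then 1 else 0)"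
proof -
  have deg: "degree (antidif (basis_poly n)) \<le> nat (int N + n + 1)"
    using degree_antidif_le[of "basis_poly n"] degree_basis_poly[OF assms(2)] by linarith
  have "coord (dif (antidif (basis_poly n))) m = (\<Sum>p\<in>{- int N..int (nat (int N + n + 1)) - int N}. dif_mat m p * coord (antidif (basis_poly n)) p)"
    unfolding dif_mat_def by (rule coord_op_sum[OF linop_dif deg])
  also have "\<dots> = (\<Sum>p\<in>{m + 1..n + 1}. dif_mat m p * antidif_mat p n)"
    by (rule sum.mono_neutral_cong_right) (use assms in \<open>auto simp: antidif_mat_def op_mat_def intro: dif_mat_upper\<close>)
  finally show ?thesis using coord_basis_poly[OF assms(2), of m] by simp
qed

definition power_mat :: "nat \<Rightarrow> nat \<Rightarrow> zmat" where "power_mat r k = op_mat (conj_mult r (monom (1 / of_nat N ^ k) k))"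

lemma banded_power_mat: "banded k (power_mat r k)"
  unfolding power_mat_def
proof (rule banded_op_mat)
  fix p
  have "degree (monom (1 / of_nat N ^ k) k :: complex poly) \<le> k" by (rule degree_monom_le)
  then show "degree (conj_mult r (monom (1 / of_nat N ^ k) k) p) \<le> degree p + k"
    using degree_conj_mult[of r "monom (1 / of_nat N ^ k) k" p] by simp
qed

text \<open>The error of degree below \<open>r\<close> has coordinates only under level
  \<open>r - N\<close>, which the lower bound on \<open>m\<close> excludes.\<close>

lemma power_mat_one:
  assumes "0 < r" "r \<le> N" "- int N < m" "int r - int N \<le> m" "- int N \<le> n"
  shows "power_mat r 1 m n = (if m = n + 1 then 1 else 0) - of_nat r / of_nat N * ((if m = n then 1 else 0) + antidif_mat m n)"
proof -
  have NN: "of_nat N \<noteq> (0::complex)" using N_pos by simp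
  let ?p = "basis_poly n"
  define q where "q = conj_mult r [:0,1:] ?p - ([:0,1:] * ?p - of_nat r * ?p - of_nat r * antidif ?p)"
  have "degree q < r" unfolding q_def by (rule conj_mult_X_mod[OF assms(1)])
  then have "coord q m = 0" using assms(4) by (intro coord_high) linarith
  then have A: "coord (conj_mult r [:0,1:] ?p) m = coord ([:0,1:] * ?p) m - of_nat r * coord ?p m - of_nat r * coord (antidif ?p) m"
    unfolding q_def coord_diff coord_of_nat_mult by simp
  have mono: "monom (1 / of_nat N) 1 = Polynomial.smult (1 / of_nat N) [:0, 1:: complex:]"
    by (simp add: monom_Suc monom_0)
  have "conj_mult r (monom (1 / of_nat N) 1) ?p = Polynomial.smult (1 / of_nat N) (conj_mult r [:0,1:] ?p)"
  proof -
    have "(antidif ^^ r) (Polynomial.smult c u) = Polynomial.smult c ((antidif ^^ r) u)" for c u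
      using linop_antidif by (induction r) (simp_all add: linop_def)
    then show ?thesis unfolding conj_mult_def mono by (simp only: mult_smult_left)
  qed
  then have "power_mat r 1 m n = coord (conj_mult r [:0,1:] ?p) m / of_nat N"
    using assms by (simp add: power_mat_def op_mat_def coord_smult)
  also have "\<dots> = (of_nat N * coord ?p (m - 1) - of_nat r * coord ?p m - of_nat r * antidif_mat m n) / of_nat N"
    unfolding A coord_mult_X[OF assms(3)] using assms by (simp add: antidif_mat_def op_mat_def)
  also have "\<dots> = (if m = n + 1 then 1 else 0) - of_nat r / of_nat N * ((if m = n then 1 else 0) + antidif_mat m n)"
    using NN assms by (auto simp: coord_basis_poly field_simps)
  finally show ?thesis .
qed

lemma power_mat_Suc:
  assumes "- int N \<le> m" "- int N \<le> n" "- int N < m"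
  shows "power_mat r (Suc k) m n = (\<Sum>p\<in>{m - 1..n + int k}. power_mat r 1 m p * power_mat r k p n)"
proof -
  have mono: "monom (1 / of_nat N ^ Suc k) (Suc k) = monom (1 / of_nat N ^ 1) 1 * monom (1 / of_nat N ^ k :: complex) k"
    by (simp add: mult_monom)
  let ?q = "conj_mult r (monom (1 / of_nat N ^ k) k) (basis_poly n)"
  have "degree ?q \<le> degree (basis_poly n) + k"
    using degree_conj_mult[of r "monom (1 / of_nat N ^ k) k" "basis_poly n"] degree_monom_le[of "1 / of_nat N ^ k :: complex" k] by simp
  then have deg: "degree ?q \<le> nat (int N + n + int k)"
    using degree_basis_poly[OF assms(2)] by linarith
  have "power_mat r (Suc k) m n = coord (conj_mult r (monom (1 / of_nat N ^ 1) 1) ?q) m"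
    using assms(2) unfolding power_mat_def op_mat_def mono conj_mult_mult by simp
  also have "\<dots> = (\<Sum>p\<in>{- int N..int (nat (int N + n + int k)) - int N}. power_mat r 1 m p * coord ?q p)"
    unfolding power_mat_def by (rule coord_op_sum[OF linop_conj_mult deg])
  also have "\<dots> = (\<Sum>p\<in>{m - 1..n + int k}. power_mat r 1 m p * power_mat r k p n)"
  proof (rule sum.mono_neutral_cong_right)
    show "\<forall>p\<in>{- int N..int (nat (int N + n + int k)) - int N} - {m - 1..n + int k}. power_mat r 1 m p * coord ?q p = 0"
      using assms banded_power_mat[of 1 r] by (auto simp: banded_def)
  qed (use assms in \<open>auto simp: power_mat_def op_mat_def\<close>)
  finally show ?thesis .
qed

end

subsection \<open>Limits of the matrices\<close>

lemma fps_deriv_prod_linear: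
  fixes c :: "nat \<Rightarrow> complex"
  shows "fps_deriv (\<Prod>i<n. 1 - fps_const (c i) * fps_X) =
    - (\<Prod>i<n. 1 - fps_const (c i) * fps_X) * Abs_fps (\<lambda>k. \<Sum>i<n. c i ^ Suc k)"
proof (induction n)
  case 0
  have "Abs_fps (\<lambda>k. 0) = (0 :: complex fps)" by (simp add: fps_eq_iff)
  then show ?case by simp
next
  case (Suc n)
  let ?P = "\<Prod>i<n. 1 - fps_const (c i) * fps_X" and ?S = "Abs_fps (\<lambda>k. \<Sum>i<n. c i ^ Suc k)"
  let ?g = "Abs_fps (\<lambda>k. c n ^ Suc k)"
  have g: "(1 - fps_const (c n) * fps_X) * ?g = fps_const (c n)"
  proof (rule fps_ext)
    fix k show "fps_nth ((1 - fps_const (c n) * fps_X) * ?g) k = fps_nth (fps_const (c n)) k"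
      by (cases k) (simp_all add: algebra_simps)
  qed
  have S: "Abs_fps (\<lambda>k. \<Sum>i<Suc n. c i ^ Suc k) = ?S + ?g"
    by (simp add: fps_eq_iff)
  have L: "fps_deriv (1 - fps_const (c n) * fps_X) = - fps_const (c n)" by simp
  have gen: "P * (- c) + (- P * S) * L = - P * S * L - P * c" for P S L c :: "complex fps"
    by (simp add: algebra_simps)
  have gen2: "- P * S * L - P * (L * g) = - (P * L) * (S + g)" for P S L g :: "complex fps"
    by (simp add: algebra_simps)
  have "fps_deriv (?P * (1 - fps_const (c n) * fps_X)) = - ?P * ?S * (1 - fps_const (c n) * fps_X) - ?P * fps_const (c n)"
    unfolding fps_deriv_mult Suc.IH L by (rule gen)
  also have "\<dots> = - ?P * ?S * (1 - fps_const (c n) * fps_X) - ?P * ((1 - fps_const (c n) * fps_X) * ?g)"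
    unfolding g ..
  also have "\<dots> = - (?P * (1 - fps_const (c n) * fps_X)) * (?S + ?g)"
    by (rule gen2)
  finally show ?case unfolding S prod.lessThan_Suc .
qed

text \<open>Newton's identities for a quotient: its logarithmic derivative is the difference of the
  two power sum series. This reduces limits of coefficients to limits of power sums.\<close>

lemma fps_ratio_coeff:
  fixes t u :: "nat \<Rightarrow> complex" and n :: nat
  defines "Q \<equiv> (\<Prod>i<n. 1 - fps_const (u i) * fps_X) * inverse (\<Prod>i<n. 1 - fps_const (t i) * fps_X)"
  shows "fps_nth Q 0 = 1"
    and "of_nat (Suc k) * fps_nth Q (Suc k) = (\<Sum>j\<le>k. fps_nth Q j * (\<Sum>i<n. t i ^ Suc (k - j) - u i ^ Suc (k - j)))"
proof -
  let ?A = "\<Prod>i<n. 1 - fps_const (u i) * fps_X" and ?B = "\<Prod>i<n. 1 - fps_const (t i) * fps_X"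
  let ?Su = "Abs_fps (\<lambda>k. \<Sum>i<n. u i ^ Suc k)" and ?St = "Abs_fps (\<lambda>k. \<Sum>i<n. t i ^ Suc k)"
  have "fps_nth (\<Prod>i<n. 1 - fps_const (c i) * fps_X) 0 = (1 :: complex)" for n and c :: "nat \<Rightarrow> complex"
    by (induction n) simp_all
  then have 0: "fps_nth ?A 0 = 1" "fps_nth ?B 0 = 1" by blast+
  then have "?B * inverse ?B = 1" by (intro inverse_mult_eq_1') simp
  then have BQ: "?B * Q = ?A" unfolding Q_def mult.left_commute[of ?B ?A] by (simp only: mult_1_right)
  have "fps_nth (?B * Q) 0 = 1" using BQ 0 by simp
  then show "fps_nth Q 0 = 1" using 0 by simp
  have gen: "B * Q' = B * (Q * (St - Su))" if "B * Q' + - B * St * Q = - (B * Q) * Su" for B Q Q' St Su :: "complex fps"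
    using that by (simp add: algebra_simps eq_neg_iff_add_eq_0)
  have "?B * fps_deriv Q + fps_deriv ?B * Q = fps_deriv ?A"
    using arg_cong[OF BQ, of fps_deriv] by (simp only: fps_deriv_mult)
  then have "?B * fps_deriv Q + - ?B * ?St * Q = - (?B * Q) * ?Su"
    unfolding fps_deriv_prod_linear BQ .
  then have "?B * fps_deriv Q = ?B * (Q * (?St - ?Su))" by (rule gen)
  moreover have "?B \<noteq> 0" using 0 by auto
  ultimately have "fps_deriv Q = Q * (?St - ?Su)" by simp
  then have "fps_nth (fps_deriv Q) k = fps_nth (Q * (?St - ?Su)) k" by simp
  then show "of_nat (Suc k) * fps_nth Q (Suc k) = (\<Sum>j\<le>k. fps_nth Q j * (\<Sum>i<n. t i ^ Suc (k - j) - u i ^ Suc (k - j)))"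
    by (simp add: fps_mult_nth sum_subtractf atMost_atLeast0)
qed

text \<open>Moving \<open>N\<close> points by 1/N changes a power sum by a bounded amount, written
  here through normalised power sums. Only the term \<open>j = 0\<close> survives as
  \<open>N\<close> grows.\<close>

lemma power_shift_diff_sum:
  fixes t :: "nat \<Rightarrow> complex"
  assumes "0 < N"
  shows "(\<Sum>i<N. t i ^ Suc k - (t i - 1 / of_nat N) ^ Suc k) =
    (\<Sum>j\<le>k. of_nat (Suc k choose Suc j) * (-1) ^ j * (1 / of_nat N) ^ j * ((\<Sum>i<N. t i ^ (k - j)) / of_nat N))"
proof -
  have "(x - h) ^ Suc k = x ^ Suc k - (\<Sum>j\<le>k. of_nat (Suc k choose Suc j) * (-1) ^ j * h ^ Suc j * x ^ (k - j))"
    for x h :: complex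
  proof -
    have "(x - h) ^ Suc k = (\<Sum>j\<le>Suc k. of_nat (Suc k choose j) * (- h) ^ j * x ^ (Suc k - j))"
      using binomial_ring[of "- h" x "Suc k"] by simp
    also have "\<dots> = x ^ Suc k + (\<Sum>j\<le>k. of_nat (Suc k choose Suc j) * (- h) ^ Suc j * x ^ (k - j))"
      by (subst sum.atMost_Suc_shift) simp
    also have "(\<Sum>j\<le>k. of_nat (Suc k choose Suc j) * (- h) ^ Suc j * x ^ (k - j)) =
       - (\<Sum>j\<le>k. of_nat (Suc k choose Suc j) * (-1) ^ j * h ^ Suc j * x ^ (k - j))"
      unfolding sum_negf[symmetric] power_minus[of h] by (intro sum.cong) auto
    finally show ?thesis by simp
  qed
  then have "(\<Sum>i<N. t i ^ Suc k - (t i - 1 / of_nat N) ^ Suc k) =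
     (\<Sum>i<N. \<Sum>j\<le>k. of_nat (Suc k choose Suc j) * (-1) ^ j * (1 / of_nat N) ^ Suc j * t i ^ (k - j))"
    by simp
  also have "\<dots> = (\<Sum>j\<le>k. \<Sum>i<N. of_nat (Suc k choose Suc j) * (-1) ^ j * (1 / of_nat N) ^ Suc j * t i ^ (k - j))"
    by (rule sum.swap)
  finally show ?thesis by (simp add: sum_distrib_left sum_divide_distrib mult_ac)
qed

text \<open>exp(C) as a series in w = 1/y, where C is the sum of the terms \<open>mo k\<close>
  w^(k+1).\<close>

definition expC :: "(nat \<Rightarrow> complex) \<Rightarrow> complex fps" where
  "expC mo = fps_exp 1 oo Abs_fps (\<lambda>k. if k = 0 then 0 else mo (k - 1))"

lemma expC_coeff:
  "fps_nth (expC mo) 0 = 1"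
  "of_nat (Suc k) * fps_nth (expC mo) (Suc k) = (\<Sum>j\<le>k. fps_nth (expC mo) j * (of_nat (Suc (k - j)) * mo (k - j)))"
proof -
  let ?C = "Abs_fps (\<lambda>k. if k = 0 then 0 else mo (k - 1))"
  show "fps_nth (expC mo) 0 = 1" by (simp add: expC_def)
  have "fps_deriv (expC mo) = expC mo * fps_deriv ?C"
    unfolding expC_def by (subst fps_compose_deriv) simp_all
  then have "fps_nth (fps_deriv (expC mo)) k = fps_nth (expC mo * fps_deriv ?C) k" by simp
  then show "of_nat (Suc k) * fps_nth (expC mo) (Suc k) = (\<Sum>j\<le>k. fps_nth (expC mo) j * (of_nat (Suc (k - j)) * mo (k - j)))"
    by (simp add: fps_mult_nth atMost_atLeast0)
qed

text \<open>(exp(C) - 1) / w; its constant term is the total mass \<open>mo 0\<close>, so it is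
  invertible for a probability measure.\<close>

definition symV :: "(nat \<Rightarrow> complex) \<Rightarrow> complex fps" where
  "symV mo = fps_shift 1 (expC mo)"

text \<open>w F(1/w), where F is the limiting symbol. The factor w removes the pole of F at
  infinity, so that powers of F can be read off from ordinary power series.\<close>

definition symU :: "(nat \<Rightarrow> complex) \<Rightarrow> real \<Rightarrow> complex fps" where
  "symU mo a = 1 - fps_const (of_real (1 - a)) * fps_X - fps_const (of_real (1 - a)) * inverse (symV mo)"

locale regular_limit =
  fixes lam :: "nat \<Rightarrow> nat \<Rightarrow> int" and r :: "nat \<Rightarrow> nat" and mo :: "nat \<Rightarrow> complex" and a :: real
  assumes mo_lim: "\<And>k. (\<lambda>N. (\<Sum>i<N. coords.scaled_pos N (lam N) i ^ k) / of_nat N) \<longlonglongrightarrow> mo k"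
    and mo_0: "mo 0 = 1"
    and r_lim: "(\<lambda>N. real (r N) / real N) \<longlonglongrightarrow> 1 - a" and a_pos: "0 < a"
    and r_bound: "\<And>N. 0 < N \<Longrightarrow> 0 < r N \<and> r N \<le> N"
begin

lemma coordsI: "0 < N \<Longrightarrow> coords N" by (simp add: coords_def)

definition QN :: "nat \<Rightarrow> complex fps" where
  "QN N = (\<Prod>i<N. 1 - fps_const (coords.scaled_pos N (lam N) i - 1 / of_nat N) * fps_X) *
     inverse (\<Prod>i<N. 1 - fps_const (coords.scaled_pos N (lam N) i) * fps_X)"

text \<open>The recursion of \<open>fps_ratio_coeff\<close> tends to that of
  \<open>expC_coeff\<close>, and both start at 1.\<close>

lemma QN_lim: "(\<lambda>N. fps_nth (QN N) k) \<longlonglongrightarrow> fps_nth (expC mo) k"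
proof (induction k rule: less_induct)
  case (less k)
  show ?case
  proof (cases k)
    case 0
    show ?thesis unfolding 0 QN_def fps_ratio_coeff(1) expC_coeff(1) by simp
  next
    case (Suc q)
    have G: "(\<lambda>N. \<Sum>i<N. coords.scaled_pos N (lam N) i ^ Suc s - (coords.scaled_pos N (lam N) i - 1 / of_nat N) ^ Suc s) \<longlonglongrightarrow> of_nat (Suc s) * mo s" for s
    proof -
      have "(\<lambda>N. \<Sum>j\<le>s. of_nat (Suc s choose Suc j) * (-1) ^ j * (1 / of_nat N) ^ j * ((\<Sum>i<N. coords.scaled_pos N (lam N) i ^ (s - j)) / of_nat N))
         \<longlonglongrightarrow> (\<Sum>j\<le>s. of_nat (Suc s choose Suc j) * (-1) ^ j * 0 ^ j * mo (s - j))"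
        by (intro tendsto_sum tendsto_mult tendsto_power tendsto_const mo_lim lim_1_over_n)
      also have "(\<Sum>j\<le>s. of_nat (Suc s choose Suc j) * (-1) ^ j * 0 ^ j * mo (s - j)) =
         (\<Sum>j\<in>{0}. of_nat (Suc s choose Suc j) * (-1) ^ j * 0 ^ j * mo (s - j))"
        by (rule sum.mono_neutral_right) auto
      finally have "(\<lambda>N. \<Sum>j\<le>s. of_nat (Suc s choose Suc j) * (-1) ^ j * (1 / of_nat N) ^ j * ((\<Sum>i<N. coords.scaled_pos N (lam N) i ^ (s - j)) / of_nat N))
         \<longlonglongrightarrow> of_nat (Suc s) * mo s" by simp
      then show ?thesis
        by (rule Lim_transform_eventually)
           (use eventually_gt_at_top[of 0] in eventually_elim, simp only: power_shift_diff_sum)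
    qed
    have "(\<lambda>N. (\<Sum>j\<le>q. fps_nth (QN N) j * (\<Sum>i<N. coords.scaled_pos N (lam N) i ^ Suc (q - j) - (coords.scaled_pos N (lam N) i - 1 / of_nat N) ^ Suc (q - j))) / of_nat (Suc q))
       \<longlonglongrightarrow> (\<Sum>j\<le>q. fps_nth (expC mo) j * (of_nat (Suc (q - j)) * mo (q - j))) / of_nat (Suc q)"
      by (intro tendsto_divide tendsto_sum tendsto_mult[OF less G] tendsto_const) (use Suc in \<open>auto simp del: of_nat_Suc\<close>)
    also have "(\<Sum>j\<le>q. fps_nth (expC mo) j * (of_nat (Suc (q - j)) * mo (q - j))) / of_nat (Suc q) = fps_nth (expC mo) k"
      unfolding expC_coeff(2)[symmetric] Suc by (rule nonzero_mult_div_cancel_left[OF of_nat_neq_0])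
    also have "(\<lambda>N. (\<Sum>j\<le>q. fps_nth (QN N) j * (\<Sum>i<N. coords.scaled_pos N (lam N) i ^ Suc (q - j) - (coords.scaled_pos N (lam N) i - 1 / of_nat N) ^ Suc (q - j))) / of_nat (Suc q))
       = (\<lambda>N. fps_nth (QN N) k)"
      unfolding QN_def fps_ratio_coeff(2)[symmetric] Suc nonzero_mult_div_cancel_left[OF of_nat_neq_0] ..
    finally show ?thesis .
  qed
qed

lemma eventually_index: "eventually (\<lambda>N. - int N < m \<and> 0 < N) sequentially"
  using eventually_gt_at_top[of "nat (- m)"] by eventually_elim linarith

abbreviation dN where "dN N \<equiv> coords.dif_mat N (lam N)"
abbreviation sN where "sN N \<equiv> coords.antidif_mat N (lam N)"
abbreviation xN where "xN N k \<equiv> coords.power_mat N (lam N) (r N) k"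

text \<open>The coefficient of y^j in exp(C) - 1, which has negative powers only.\<close>

definition eps :: "int \<Rightarrow> complex" where
  "eps j = (if j < 0 then fps_nth (expC mo) (nat (- j)) else 0)"

lemma dN_zero_lim: "(\<lambda>N. dN N m 0) \<longlonglongrightarrow> eps m"
proof -
  have "(\<lambda>N. if m < 0 then fps_nth (QN N) (nat (- m)) else 0) \<longlonglongrightarrow> eps m"
    using QN_lim by (auto simp: eps_def)
  then show ?thesis
    by (rule Lim_transform_eventually)
       (use eventually_index[of m] in eventually_elim,
        auto simp: coords.dif_mat_zero[OF coordsI] QN_def coords.denom_def[OF coordsI])
qed

text \<open>Up to an error of order 1/N the step relation moves entries along diagonals, so the
  limit is Toeplitz.\<close>

lemma dN_raising_lim: "(\<lambda>N. dN N m (int k)) \<longlonglongrightarrow> eps (m - int k)"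
proof (induction k arbitrary: m)
  case 0
  then show ?case using dN_zero_lim by simp
next
  case (Suc k)
  have "(\<lambda>N. dN N (m - 1) (int k) + (dN N m (int k) + (if m = int k then 1 else 0)) * (1 / of_nat N))
    \<longlonglongrightarrow> eps (m - 1 - int k) + (eps (m - int k) + (if m = int k then 1 else 0)) * 0"
    by (intro tendsto_intros Suc.IH lim_1_over_n)
  then have "(\<lambda>N. dN N (m - 1) (int k) + (dN N m (int k) + (if m = int k then 1 else 0)) * (1 / of_nat N))
    \<longlonglongrightarrow> eps (m - int (Suc k))" by (simp add: algebra_simps)
  then show ?case
    by (rule Lim_transform_eventually)
       (use eventually_index[of m] in eventually_elim,
        use coords.dif_mat_step[OF coordsI, of _ "int k" m] in \<open>simp add: add.commute\<close>)
qed

text \<open>Towards lower columns, the step relation expresses an entry through one in the next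
  column and, with weight 1/N, through the entry one level higher in its own column. A second
  induction down the column, from the vanishing diagonal, controls the latter.\<close>

lemma dN_down_lim: "(\<lambda>N. dN N m (- int k)) \<longlonglongrightarrow> eps (m + int k)"
proof (induction k arbitrary: m)
  case 0
  then show ?case using dN_zero_lim by simp
next
  case (Suc k)
  let ?n = "- int (Suc k)"
  have "(\<lambda>N. dN N (?n - int i) ?n) \<longlonglongrightarrow> eps (?n - int i - ?n)" for i
  proof (induction i)
    case 0
    have "(\<lambda>N. 0) \<longlonglongrightarrow> eps (?n - int 0 - ?n)" by (simp add: eps_def)
    then show ?case
      by (rule Lim_transform_eventually)
         (use eventually_gt_at_top[of 0] in eventually_elim, simp add: coords.dif_mat_upper[OF coordsI])
  next
    case (Suc i)
    let ?m = "?n - int i"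
    have "(\<lambda>N. dN N ?m (?n + 1) - (dN N ?m ?n + (if ?m = ?n then 1 else 0)) * (1 / of_nat N)) \<longlonglongrightarrow>
       eps (?m + int k) - (eps (?m - ?n) + (if ?m = ?n then 1 else 0)) * 0"
      using Suc.IH \<open>\<And>m. (\<lambda>N. dN N m (- int k)) \<longlonglongrightarrow> eps (m + int k)\<close>[of ?m]
      by (intro tendsto_intros lim_1_over_n) (simp_all add: algebra_simps)
    then have "(\<lambda>N. dN N ?m (?n + 1) - (dN N ?m ?n + (if ?m = ?n then 1 else 0)) * (1 / of_nat N)) \<longlonglongrightarrow> eps (?n - int (Suc i) - ?n)"
      by (simp add: algebra_simps)
    then show ?case
      by (rule Lim_transform_eventually)
         (use eventually_index[of ?m] in eventually_elim,
          use coords.dif_mat_step[OF coordsI, of _ ?n ?m] in \<open>simp add: algebra_simps add_divide_distrib\<close>)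
  qed
  from this[of "nat (?n - m)"] show ?case
  proof (cases "m \<le> ?n")
    case False
    have "(\<lambda>N. 0) \<longlonglongrightarrow> eps (m + int (Suc k))" using False by (simp add: eps_def)
    then show ?thesis
      by (rule Lim_transform_eventually)
         (use eventually_gt_at_top[of 0] in eventually_elim, use False in \<open>simp add: coords.dif_mat_upper[OF coordsI]\<close>)
  qed (simp add: algebra_simps)
qed

lemma dN_lim: "(\<lambda>N. dN N m n) \<longlonglongrightarrow> eps (m - n)"
  using dN_raising_lim[of m "nat n"] dN_down_lim[of m "nat (- n)"] by (cases "0 \<le> n") auto

lemma symV_0: "fps_nth (symV mo) 0 = 1"
  using expC_coeff(2)[where mo=mo and k=0] mo_0 by (simp add: symV_def expC_coeff)

text \<open>The coefficient of y^j in 1/(exp(C) - 1), that is, in y / V(1/y) with V the series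
  \<open>symV mo\<close>.\<close>

definition sig :: "int \<Rightarrow> complex" where
  "sig j = (if j \<le> 1 then fps_nth (inverse (symV mo)) (nat (1 - j)) else 0)"

lemma eps_sig:
  assumes "m \<le> n"
  shows "(\<Sum>p\<in>{m + 1..n + 1}. eps (m - p) * sig (p - n)) = (if m = n then 1 else 0)"
proof -
  have "(\<Sum>p\<in>{m + 1..n + 1}. eps (m - p) * sig (p - n)) =
     (\<Sum>j\<in>{0..nat (n - m)}. fps_nth (symV mo) j * fps_nth (inverse (symV mo)) (nat (n - m) - j))"
    by (rule sum.reindex_bij_witness[where i="\<lambda>j. m + 1 + int j" and j="\<lambda>p. nat (p - m - 1)"])
       (use assms in \<open>auto simp: eps_def sig_def symV_def nat_diff_distrib' intro!: arg_cong2[where f="(*)"] arg_cong[where f="fps_nth _"]\<close>)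
  also have "\<dots> = fps_nth (symV mo * inverse (symV mo)) (nat (n - m))"
    by (simp add: fps_mult_nth)
  also have "symV mo * inverse (symV mo) = 1"
    by (rule inverse_mult_eq_1') (simp add: symV_0)
  finally show ?thesis using assms by simp
qed

text \<open>Each column of the triangular system is solved from its top entry downwards. The pivots
  \<open>dN N m (m + 1)\<close> tend to 1, the total mass, so the divisions are legitimate for large
  \<open>N\<close>.\<close>

lemma sN_lim: "(\<lambda>N. sN N m n) \<longlonglongrightarrow> sig (m - n)"
proof -
  have "(\<lambda>N. sN N (n + 1 - int i) n) \<longlonglongrightarrow> sig (1 - int i)" for i
  proof (induction i rule: less_induct)
    case (less i)
    define m where "m = n - int i"
    have IH: "(\<lambda>N. sN N p n) \<longlonglongrightarrow> sig (p - n)" if "p \<in> {m + 2..n + 1}" for p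
    proof -
      have "nat (n + 1 - p) < i" "int (nat (n + 1 - p)) = n + 1 - p" using that by (auto simp: m_def)
      then show ?thesis using less[of "nat (n + 1 - p)"] by simp
    qed
    have ins: "{m + 1..n + 1} = insert (m + 1) {m + 2..n + 1}" using m_def by auto
    have e1: "eps (-1) = 1" using symV_0 by (simp add: eps_def symV_def)
    have d1: "(\<lambda>N. dN N m (m + 1)) \<longlonglongrightarrow> 1" using dN_lim[of m "m + 1"] e1 by simp
    have "(\<lambda>N. ((if m = n then 1 else 0) - (\<Sum>p\<in>{m + 2..n + 1}. dN N m p * sN N p n)) / dN N m (m + 1))
       \<longlonglongrightarrow> ((if m = n then 1 else 0) - (\<Sum>p\<in>{m + 2..n + 1}. eps (m - p) * sig (p - n))) / 1"
      by (intro tendsto_divide tendsto_diff tendsto_const tendsto_sum tendsto_mult dN_lim IH d1) auto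
    also have "((if m = n then 1 else 0) - (\<Sum>p\<in>{m + 2..n + 1}. eps (m - p) * sig (p - n))) / 1 = sig (m + 1 - n)"
    proof -
      have "sig (m + 1 - n) + (\<Sum>p\<in>{m + 2..n + 1}. eps (m - p) * sig (p - n)) = (if m = n then 1 else 0)"
        using eps_sig[of m n] e1 unfolding ins by (simp add: m_def)
      then show ?thesis by (simp only: eq_diff_eq div_by_1 flip: \<open>sig (m + 1 - n) + _ = _\<close>) simp
    qed
    finally have "(\<lambda>N. sN N (m + 1) n) \<longlonglongrightarrow> sig (m + 1 - n)"
    proof (rule Lim_transform_eventually)
      have "eventually (\<lambda>N. dN N m (m + 1) \<noteq> 0) sequentially"
        using d1 by (rule tendsto_imp_eventually_ne) simp
      then show "eventually (\<lambda>N. ((if m = n then 1 else 0) - (\<Sum>p\<in>{m + 2..n + 1}. dN N m p * sN N p n)) / dN N m (m + 1) = sN N (m + 1) n) sequentially"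
        using eventually_index[of m] eventually_index[of n]
      proof eventually_elim
        case (elim N)
        have "(\<Sum>p\<in>{m + 1..n + 1}. dN N m p * sN N p n) = (if m = n then 1 else 0)"
          using elim by (intro coords.dif_mat_antidif_mat coordsI) auto
        then have "dN N m (m + 1) * sN N (m + 1) n = (if m = n then 1 else 0) - (\<Sum>p\<in>{m + 2..n + 1}. dN N m p * sN N p n)"
          unfolding ins by (simp add: algebra_simps)
        then show ?case using elim by (simp add: field_simps)
      qed
    qed
    then show ?case by (simp add: m_def algebra_simps)
  qed
  from this[of "nat (n + 1 - m)"] show ?thesis
  proof (cases "m \<le> n + 1")
    case False
    have "(\<lambda>N. 0) \<longlonglongrightarrow> sig (m - n)" using False by (simp add: sig_def)
    then show ?thesis
      by (rule Lim_transform_eventually)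
         (use eventually_gt_at_top[of 0] in eventually_elim, use False in \<open>simp add: coords.antidif_mat_upper[OF coordsI]\<close>)
  qed (simp add: algebra_simps)
qed

text \<open>Since \<open>a > 0\<close>, the levels under \<open>r - N\<close>, which carry the error
  of \<open>conj_mult_X_mod\<close>, retreat to minus infinity.\<close>

lemma eventually_r: "eventually (\<lambda>N. int (r N) - int N \<le> m) sequentially"
proof -
  have "eventually (\<lambda>N. real (r N) / real N < 1 - a / 2) sequentially"
    by (rule order_tendstoD(2)[OF r_lim]) (use a_pos in simp)
  moreover have "eventually (\<lambda>N. real N > 2 * \<bar>real_of_int m\<bar> / a) sequentially"
    using filterlim_real_sequentially by (simp add: filterlim_at_top_dense)
  ultimately show ?thesis using eventually_gt_at_top[of 0]
  proof eventually_elim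
    case (elim N)
    then have "real (r N) < real N - a / 2 * real N" "\<bar>real_of_int m\<bar> < a / 2 * real N"
      using a_pos by (simp_all add: field_simps)
    then have "real_of_int (int (r N) - int N) < real_of_int m" by simp
    then show ?case by linarith
  qed
qed

text \<open>The coefficient of y^j in F(y)^k, which is that of w^(k-j) in (w F(1/w))^k.\<close>

definition TU :: "nat \<Rightarrow> int \<Rightarrow> complex" where
  "TU k j = (if j \<le> int k then fps_nth (symU mo a ^ k) (nat (int k - j)) else 0)"

lemma xN_one_lim: "(\<lambda>N. xN N 1 m n) \<longlonglongrightarrow> TU 1 (m - n)"
proof -
  have r': "(\<lambda>N. of_nat (r N) / of_nat N :: complex) \<longlonglongrightarrow> of_real (1 - a)"
    using tendsto_of_real[OF r_lim, where 'a=complex] by simp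
  have "(\<lambda>N. (if m = n + 1 then 1 else 0) - of_nat (r N) / of_nat N * ((if m = n then 1 else 0) + sN N m n))
     \<longlonglongrightarrow> (if m = n + 1 then 1 else 0) - of_real (1 - a) * ((if m = n then 1 else 0) + sig (m - n))"
    by (intro tendsto_intros r' sN_lim)
  also have "(if m = n + 1 then 1 else 0) - of_real (1 - a) * ((if m = n then 1 else 0) + sig (m - n)) = TU 1 (m - n)"
  proof -
    have "nat (1 - (m - n)) = 0 \<longleftrightarrow> n + 1 \<le> m" "nat (1 - (m - n)) = Suc 0 \<longleftrightarrow> m = n" by auto
    then show ?thesis
      by (auto simp: TU_def sig_def symU_def fps_X_def algebra_simps)
  qed
  finally show ?thesis
    by (rule Lim_transform_eventually)
       (use eventually_index[of m] eventually_index[of n] eventually_r[of m] in eventually_elim,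
        subst coords.power_mat_one[OF coordsI], use r_bound in auto)
qed

lemma TU_Suc: 
  "(\<Sum>p\<in>{m - 1..n + int k}. TU 1 (m - p) * TU k (p - n)) = TU (Suc k) (m - n)"
proof (cases "m - n \<le> int (Suc k)")
  case True
  have "(\<Sum>p\<in>{m - 1..n + int k}. TU 1 (m - p) * TU k (p - n)) =
     (\<Sum>j\<in>{0..nat (int (Suc k) - (m - n))}. fps_nth (symU mo a) j * fps_nth (symU mo a ^ k) (nat (int (Suc k) - (m - n)) - j))"
    by (rule sum.reindex_bij_witness[where i="\<lambda>j. m - 1 + int j" and j="\<lambda>p. nat (p - m + 1)"])
       (use True in \<open>auto simp: TU_def intro!: arg_cong2[where f="(*)"] arg_cong[where f="fps_nth _"]\<close>)
  then show ?thesis using True by (simp add: TU_def fps_mult_nth)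
next
  case False
  then show ?thesis by (simp add: TU_def)
qed

lemma xN_lim: "0 < k \<Longrightarrow> (\<lambda>N. xN N k m n) \<longlonglongrightarrow> TU k (m - n)"
proof (induction k arbitrary: m n rule: nat_induct_non_zero)
  case 1
  then show ?case using xN_one_lim by simp
next
  case (Suc k)
  have "(\<lambda>N. \<Sum>p\<in>{m - 1..n + int k}. xN N 1 m p * xN N k p n) \<longlonglongrightarrow> (\<Sum>p\<in>{m - 1..n + int k}. TU 1 (m - p) * TU k (p - n))"
    by (intro tendsto_sum tendsto_mult xN_one_lim Suc.IH)
  also have "(\<Sum>p\<in>{m - 1..n + int k}. TU 1 (m - p) * TU k (p - n)) = TU (Suc k) (m - n)" by (rule TU_Suc)
  finally show ?case
    by (rule Lim_transform_eventually)
       (use eventually_index[of m] eventually_index[of n] in eventually_elim, simp add: coords.power_mat_Suc[OF coordsI])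
qed

end

subsection \<open>The double contour integral\<close>

text \<open>A Taylor expansion stopped after \<open>J\<close> terms, with closed remainder. The
  factor \<open>x ^ J\<close> in the remainder is meant to cancel a pole of order \<open>J\<close>,
  so no infinite series has to be integrated.\<close>

lemma inverse_square_expand:
  fixes x y :: complex
  assumes "y \<noteq> 0" "x \<noteq> y"
  shows "1 / (x - y)\<^sup>2 = (\<Sum>j<J. of_nat (Suc j) * x ^ j / y ^ (j + 2))
     + x ^ J * (of_nat (Suc J) * y - of_nat J * x) / (y ^ Suc J * (y - x)\<^sup>2)"
proof (induction J)
  case 0
  then show ?case using assms by (simp add: power2_commute)
next
  case (Suc J)
  have yx: "y - x \<noteq> 0" using assms by simp
  have "x ^ J * (of_nat (Suc J) * y - of_nat J * x) / (y ^ Suc J * (y - x)\<^sup>2) =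
     (of_nat (Suc J) * x ^ J * (y - x)\<^sup>2 + x ^ Suc J * (of_nat (Suc (Suc J)) * y - of_nat (Suc J) * x)) / (y ^ (J + 2) * (y - x)\<^sup>2)"
    using assms yx by (simp add: frac_eq_eq) (simp add: algebra_simps power2_eq_square)
  also have "\<dots> = of_nat (Suc J) * x ^ J / y ^ (J + 2)
      + x ^ Suc J * (of_nat (Suc (Suc J)) * y - of_nat (Suc J) * x) / (y ^ Suc (Suc J) * (y - x)\<^sup>2)"
    using assms yx by (simp add: add_divide_distrib)
  finally show ?case using Suc by simp
qed

lemma has_integral_circlepath:
  assumes "(f has_contour_integral I) (circlepath 0 r)"
  shows "((\<lambda>t. f (of_real r * cis t) * (\<i> * of_real r * cis t)) has_integral I) {0..2 * pi}"
  using assms unfolding circlepath_def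
  by (subst (asm) has_contour_integral_part_circlepath_iff) (auto simp: mult_ac)

text \<open>\<open>g\<close> stands for 1/y as a function of z, a small perturbation of the
  identity. The bound 1/8 yields injectivity and keeps the difference quotients in
  \<open>ratio_not_nonpos\<close> close to 1; \<open>R\<close> keeps the values of \<open>g\<close>
  inside discs of convergence.\<close>

locale local_coord =
  fixes g :: "complex \<Rightarrow> complex" and \<delta> :: real and R :: ereal
  assumes \<delta>: "0 < \<delta>" and holo: "g holomorphic_on ball 0 \<delta>" and g0: "g 0 = 0"
    and dg: "\<And>z. z \<in> ball 0 \<delta> \<Longrightarrow> cmod (deriv g z - 1) \<le> 1 / 8"
    and gR: "\<And>z. z \<in> ball 0 \<delta> \<Longrightarrow> ereal (cmod (g z)) < R"
begin

lemma has_deriv: "z \<in> ball 0 \<delta> \<Longrightarrow> (g has_field_derivative deriv g z) (at z within A)"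
  using holomorphic_derivI[OF holo] by (auto intro: has_field_derivative_at_within)

lemma g_close: "z \<in> ball 0 \<delta> \<Longrightarrow> w \<in> ball 0 \<delta> \<Longrightarrow> cmod (g z - g w - (z - w)) \<le> 1 / 8 * cmod (z - w)"
proof -
  assume zw: "z \<in> ball 0 \<delta>" "w \<in> ball 0 \<delta>"
  have "cmod ((g z - z) - (g w - w)) \<le> 1 / 8 * cmod (z - w)"
    by (rule field_differentiable_bound[OF convex_ball[of 0 \<delta>], where f'="\<lambda>z. deriv g z - 1"])
       (use zw dg in \<open>auto intro!: derivative_eq_intros has_deriv\<close>)
  then show ?thesis by (simp add: algebra_simps)
qed

lemma g_inj: "z \<in> ball 0 \<delta> \<Longrightarrow> w \<in> ball 0 \<delta> \<Longrightarrow> g z = g w \<Longrightarrow> z = w"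
proof -
  assume "z \<in> ball 0 \<delta>" "w \<in> ball 0 \<delta>" "g z = g w"
  then have "cmod (z - w) \<le> 1 / 8 * cmod (z - w)" using g_close[of z w] by (simp add: norm_minus_commute)
  then show "z = w" by simp
qed

lemma g_nz: "z \<in> ball 0 \<delta> \<Longrightarrow> z \<noteq> 0 \<Longrightarrow> g z \<noteq> 0"
  using g_inj[of z 0] g0 \<delta> by auto

lemma holo_eval: "R \<le> fps_conv_radius F \<Longrightarrow> (\<lambda>z. eval_fps F (g z)) holomorphic_on ball 0 \<delta>"
proof -
  assume R: "R \<le> fps_conv_radius F"
  have "eval_fps F holomorphic_on g ` ball 0 \<delta>"
    by (rule holomorphic_on_eval_fps) (auto simp: in_eball_iff intro!: less_le_trans[OF gR R])
  then show ?thesis using holomorphic_on_compose[OF holo] by (simp add: comp_def)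
qed

lemma holo_deriv: "deriv g holomorphic_on ball 0 \<delta>"
  by (rule holomorphic_deriv[OF holo]) simp

lemma circle_sub: "0 < r \<Longrightarrow> r < \<delta> \<Longrightarrow> path_image (circlepath 0 r) \<subseteq> ball 0 \<delta> - {0}"
  by (auto simp: path_image_circlepath)

text \<open>Every power but -1 has a primitive. For -1 the difference to 1/z is the derivative of
  log(g(z)/z), whose argument stays near 1.\<close>

lemma contour_powi:
  assumes r: "0 < r" "r < \<delta>"
  shows "((\<lambda>z. g z powi n * deriv g z) has_contour_integral (if n = -1 then 2 * of_real pi * \<i> else 0)) (circlepath 0 r)"
proof (cases "n = -1")
  case False
  have "((\<lambda>z. g z powi n * deriv g z) has_contour_integral 0) (circlepath 0 r)"
  proof (rule Cauchy_theorem_primitive[where f="\<lambda>z. g z powi (n + 1) / of_int (n + 1)" and S="ball 0 \<delta> - {0}"])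
    fix z :: complex assume z: "z \<in> ball 0 \<delta> - {0}"
    have "of_int (n + 1) \<noteq> (0 :: complex)" using False by (metis add_eq_0_iff2 of_int_eq_0_iff add.commute minus_minus)
    moreover have "((\<lambda>z. g z powi (n + 1)) has_field_derivative of_int (n + 1) * g z powi (n + 1 - 1) * deriv g z) (at z within ball 0 \<delta> - {0})"
      by (rule DERIV_power_int) (use z has_deriv g_nz in auto)
    ultimately show "((\<lambda>z. g z powi (n + 1) / of_int (n + 1)) has_field_derivative g z powi n * deriv g z) (at z within ball 0 \<delta> - {0})"
      using DERIV_cdivide[of "\<lambda>z. g z powi (n + 1)" "of_int (n + 1) * g z powi (n + 1 - 1) * deriv g z" z "ball 0 \<delta> - {0}" "of_int (n + 1)"]
      by (simp del: of_int_add)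
  qed (use circle_sub[OF r] in auto)
  then show ?thesis using False by simp
next
  case True
  have 1: "((\<lambda>z. deriv g z / g z - 1 / z) has_contour_integral 0) (circlepath 0 r)"
  proof (rule Cauchy_theorem_primitive[where f="\<lambda>z. Ln (g z / z)" and S="ball 0 \<delta> - {0}"])
    fix z :: complex assume z: "z \<in> ball 0 \<delta> - {0}"
    have "cmod (g z - z) \<le> 1 / 8 * cmod z" using g_close[of z 0] z g0 \<delta> by simp
    then have "cmod (g z / z - 1) \<le> 1 / 8" using z by (simp add: field_simps norm_divide)
    then have "\<bar>Re (g z / z) - 1\<bar> \<le> 1 / 8" using abs_Re_le_cmod[of "g z / z - 1"] by simp
    then have "g z / z \<notin> \<real>\<^sub>\<le>\<^sub>0" using complex_nonpos_Reals_iff by force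
    moreover have "((\<lambda>z. g z / z) has_field_derivative (deriv g z * z - g z) / (z * z)) (at z within ball 0 \<delta> - {0})"
      using z by (auto intro!: derivative_eq_intros has_deriv)
    ultimately have "((\<lambda>z. Ln (g z / z)) has_field_derivative inverse (g z / z) * ((deriv g z * z - g z) / (z * z))) (at z within ball 0 \<delta> - {0})"
      by (intro has_field_derivative_Ln[THEN DERIV_chain2]) auto
    moreover have "inverse (g z / z) * ((deriv g z * z - g z) / (z * z)) = deriv g z / g z - 1 / z"
      using z g_nz[of z] by (simp add: field_simps)
    ultimately show "((\<lambda>z. Ln (g z / z)) has_field_derivative deriv g z / g z - 1 / z) (at z within ball 0 \<delta> - {0})"
      by simp
  qed (use circle_sub[OF r] in auto)
  have 2: "((\<lambda>z. 1 / z) has_contour_integral 2 * of_real pi * \<i>) (circlepath 0 r)"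
  proof -
    have "((\<lambda>t. 1 / (0 + of_real r * cis t) * of_real r * \<i> * cis t) has_integral (2 * pi - 0) *\<^sub>R \<i>) {0..2 * pi}"
      using has_integral_const_real[of "\<i>" 0 "2 * pi"] r by simp
    then show ?thesis
      unfolding circlepath_def
      by (subst has_contour_integral_part_circlepath_iff) (auto simp: scaleR_conv_of_real)
  qed
  have "((\<lambda>z. (deriv g z / g z - 1 / z) + 1 / z) has_contour_integral (0 + 2 * of_real pi * \<i>)) (circlepath 0 r)"
    by (rule has_contour_integral_add[OF 1 2])
  then show ?thesis using True by (simp add: power_int_minus divide_inverse mult.commute)
qed

text \<open>The residue computed in the coordinate \<open>g\<close>: the finitely many terms of
  \<open>F\<close> left with a negative exponent are integrated one by one, and the remaining tail
  is holomorphic.\<close>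

lemma contour_residue:
  assumes r: "0 < r" "r < \<delta>" and F: "R \<le> fps_conv_radius F"
  shows "((\<lambda>z. eval_fps F (g z) * g z powi n * deriv g z) has_contour_integral
     (2 * of_real pi * \<i> * (if n < 0 then fps_nth F (nat (- n - 1)) else 0))) (circlepath 0 r)"
proof -
  define d where "d = nat (- n)"
  define W where "W = (\<lambda>z. eval_fps (fps_shift d F) (g z) * g z ^ nat (n + int d) * deriv g z)"
  have W: "(W has_contour_integral 0) (circlepath 0 r)"
    unfolding W_def
    by (rule Cauchy_theorem_disc_simple[where a=0 and e=\<delta>])
       (use r F circle_sub[OF r] in \<open>auto intro!: holomorphic_intros holo_eval holo_deriv holo\<close>)
  have S: "((\<lambda>z. \<Sum>i<d. fps_nth F i * (g z powi (int i + n) * deriv g z)) has_contour_integral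
      (\<Sum>i<d. fps_nth F i * (if int i + n = -1 then 2 * of_real pi * \<i> else 0))) (circlepath 0 r)"
    by (intro has_contour_integral_sum has_contour_integral_lmul contour_powi r) auto
  have val: "(\<Sum>i<d. fps_nth F i * (if int i + n = -1 then 2 * of_real pi * \<i> else 0)) =
     2 * of_real pi * \<i> * (if n < 0 then fps_nth F (nat (- n - 1)) else 0)"
  proof (cases "n < 0")
    case True
    have "(\<Sum>i<d. fps_nth F i * (if int i + n = -1 then 2 * of_real pi * \<i> else 0)) =
       (\<Sum>i<d. if i = nat (- n - 1) then fps_nth F i * (2 * of_real pi * \<i>) else 0)"
      by (intro sum.cong) (use True in auto)
    then show ?thesis using True by (auto simp: d_def)
  qed (auto simp: d_def)
  have "((\<lambda>z. (\<Sum>i<d. fps_nth F i * (g z powi (int i + n) * deriv g z)) + W z) has_contour_integral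
      (2 * of_real pi * \<i> * (if n < 0 then fps_nth F (nat (- n - 1)) else 0))) (circlepath 0 r)"
    using has_contour_integral_add[OF S W] unfolding val by simp
  then show ?thesis
  proof (rule has_contour_integral_eq)
    fix z assume "z \<in> path_image (circlepath 0 r)"
    then have z: "z \<in> ball 0 \<delta>" "z \<noteq> 0" using circle_sub[OF r] by auto
    let ?x = "g z"
    have x: "?x \<noteq> 0" using g_nz z by blast
    have conv: "summable (\<lambda>n. fps_nth F n * ?x ^ n)"
      by (rule summable_fps) (use gR[OF z(1)] F in \<open>auto dest: less_le_trans\<close>)
    have "eval_fps F ?x = (\<Sum>n. fps_nth F (n + d) * ?x ^ (n + d)) + (\<Sum>i<d. fps_nth F i * ?x ^ i)"
      unfolding eval_fps_def by (rule suminf_split_initial_segment[OF conv])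
    also have "(\<Sum>n. fps_nth F (n + d) * ?x ^ (n + d)) = ?x ^ d * eval_fps (fps_shift d F) ?x"
    proof -
      have "summable (\<lambda>n. fps_nth (fps_shift d F) n * ?x ^ n)"
        by (rule summable_fps) (use gR[OF z(1)] F in \<open>auto dest: less_le_trans\<close>)
      then show ?thesis unfolding eval_fps_def
        by (subst suminf_mult[symmetric]) (auto simp: power_add mult_ac intro!: suminf_cong)
    qed
    finally have e: "eval_fps F ?x = ?x ^ d * eval_fps (fps_shift d F) ?x + (\<Sum>i<d. fps_nth F i * ?x ^ i)" .
    have p: "?x ^ i * ?x powi n = ?x powi (int i + n)" for i
      using x by (simp add: power_int_add)
    have pd: "?x powi (int d + n) = ?x ^ nat (n + int d)"
      by (simp add: d_def power_int_def add.commute)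
    have "eval_fps F ?x * ?x powi n * deriv g z = eval_fps (fps_shift d F) ?x * (?x ^ d * ?x powi n) * deriv g z
        + (\<Sum>i<d. fps_nth F i * (?x ^ i * ?x powi n)) * deriv g z"
      unfolding e by (simp add: algebra_simps sum_distrib_left sum_distrib_right)
    then show "(\<Sum>i<d. fps_nth F i * (?x powi (int i + n) * deriv g z)) + W z = eval_fps F ?x * ?x powi n * deriv g z"
      unfolding p pd W_def by (simp add: sum_distrib_right mult.assoc)
  qed
qed

text \<open>The circle of \<open>z\<close> is the inner one, so the double pole on the diagonal
  expands in powers of g(z)/g(w); \<open>k1\<close> terms suffice because of the pole order in
  \<open>z\<close>. The definition of \<open>circ_dbl\<close> integrates over \<open>w\<close>
  first, whence the exchange of integrals.\<close>

lemma circ_dbl_residue: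
  fixes F1 F2 :: "complex fps"
  assumes \<epsilon>: "0 < \<epsilon>" "2 * \<epsilon> < \<delta>" and F: "R \<le> fps_conv_radius F1" "R \<le> fps_conv_radius F2"
  shows "circ_dbl \<epsilon> (2 * \<epsilon>) (\<lambda>z w. (eval_fps F1 (g z) / g z ^ k1) * (eval_fps F2 (g w) / g w ^ k2) *
      (deriv g z * deriv g w / (g z - g w)\<^sup>2)) =
     (\<Sum>j=1..k1. of_nat j * fps_nth F1 (k1 - j) * fps_nth F2 (k2 + j))"
proof -
  define A where "A z = eval_fps F1 (g z) / g z ^ k1 * deriv g z" for z
  define B where "B w = eval_fps F2 (g w) / g w ^ k2 * deriv g w" for w
  define c where "c = 2 * of_real pi * \<i>"
  let ?z = "\<lambda>s. of_real \<epsilon> * cis s" and ?w = "\<lambda>t. of_real (2 * \<epsilon>) * cis t"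
  have nz: "g z \<noteq> 0" if "0 < cmod z" "cmod z < \<delta>" for z
    using g_nz[of z] that by auto
  have z: "cmod (?z s) = \<epsilon>" and w: "cmod (?w t) = 2 * \<epsilon>" for s t
    using \<epsilon> by (auto simp: norm_mult)
  have ne: "g z \<noteq> g w" if "cmod z < 2 * \<epsilon>" "cmod w = 2 * \<epsilon>" for z w
    using g_inj[of z w] that \<epsilon> by auto
  have contA: "continuous_on (ball 0 \<delta> - {0}) A" and contB: "continuous_on (ball 0 \<delta> - {0}) B"
    unfolding A_def B_def using g_nz F
    by (auto intro!: continuous_intros holomorphic_on_imp_continuous_on[OF holomorphic_on_subset[OF holo_eval]]
         holomorphic_on_imp_continuous_on[OF holomorphic_on_subset[OF holo]]
         holomorphic_on_imp_continuous_on[OF holomorphic_on_subset[OF holo_deriv]])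
  have contg: "continuous_on (ball 0 \<delta>) g" by (rule holomorphic_on_imp_continuous_on[OF holo])
  define f where "f s t = A (?z s) * B (?w t) / (g (?z s) - g (?w t))\<^sup>2 * (\<i> * of_real \<epsilon> * cis s) * (\<i> * of_real (2 * \<epsilon>) * cis t)" for s t
  have cont_f: "continuous_on (cbox (0,0) (2*pi,2*pi)) (\<lambda>(s,t). f s t)"
  proof -
    have zc: "continuous_on X (\<lambda>x. ?z (fst x))" "continuous_on X (\<lambda>x. ?w (snd x))" for X :: "(real \<times> real) set"
      by (intro continuous_intros)+
    have sub: "?z s \<in> ball 0 \<delta> - {0}" "?w s \<in> ball 0 \<delta> - {0}" for s
      using z[of s] w[of s] \<epsilon> by auto
    show ?thesis
      unfolding f_def case_prod_unfold
      using ne[OF _ w] z \<epsilon> sub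
      by (intro continuous_intros continuous_on_compose2[OF contA zc(1)] continuous_on_compose2[OF contB zc(2)]
           continuous_on_compose2[OF contg zc(1)] continuous_on_compose2[OF contg zc(2)]) auto
  qed
  have inner: "((\<lambda>z. A z / (g z - g w)\<^sup>2) has_contour_integral
      (\<Sum>j<k1. of_nat (Suc j) / g w ^ (j + 2) * (c * fps_nth F1 (k1 - Suc j)))) (circlepath 0 \<epsilon>)"
    if w: "cmod w = 2 * \<epsilon>" for w
  proof -
    have gw: "g w \<noteq> 0" using nz[of w] w \<epsilon> by simp
    \<comment> \<open>The remainder of the expansion. It is holomorphic on the disc of radius
      \<open>2 * \<epsilon>\<close>: the pole at 0 is cancelled, and injectivity excludes
      \<open>g z = g w\<close> there.\<close>
    define H where "H z = eval_fps F1 (g z) * deriv g z * (of_nat (Suc k1) * g w - of_nat k1 * g z) / (g w ^ Suc k1 * (g w - g z)\<^sup>2)" for z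
    have H: "(H has_contour_integral 0) (circlepath 0 \<epsilon>)"
    proof (rule Cauchy_theorem_disc_simple[where a=0 and e="2*\<epsilon>"])
      have sub: "ball 0 (2 * \<epsilon>) \<subseteq> ball 0 \<delta>" using \<epsilon> by auto
      show "H holomorphic_on ball 0 (2 * \<epsilon>)"
        unfolding H_def using ne[OF _ w, THEN not_sym] gw
        by (intro holomorphic_intros holomorphic_on_subset[OF holo_eval[OF F(1)] sub]
            holomorphic_on_subset[OF holo_deriv sub] holomorphic_on_subset[OF holo sub]) auto
    qed (use \<epsilon> in \<open>auto simp: path_image_circlepath\<close>)
    have S: "((\<lambda>z. \<Sum>j<k1. of_nat (Suc j) / g w ^ (j + 2) * (eval_fps F1 (g z) * g z powi (int j - int k1) * deriv g z)) has_contour_integral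
      (\<Sum>j<k1. of_nat (Suc j) / g w ^ (j + 2) * (2 * of_real pi * \<i> * (if int j - int k1 < 0 then fps_nth F1 (nat (- (int j - int k1) - 1)) else 0)))) (circlepath 0 \<epsilon>)"
      by (intro has_contour_integral_sum has_contour_integral_lmul contour_residue F) (use \<epsilon> in auto)
    have val: "(\<Sum>j<k1. of_nat (Suc j) / g w ^ (j + 2) * (2 * of_real pi * \<i> * (if int j - int k1 < 0 then fps_nth F1 (nat (- (int j - int k1) - 1)) else 0)))
       = (\<Sum>j<k1. of_nat (Suc j) / g w ^ (j + 2) * (c * fps_nth F1 (k1 - Suc j)))"
      by (intro sum.cong refl) (auto simp: c_def nat_diff_distrib' intro!: arg_cong[where f="fps_nth F1"])
    have "((\<lambda>z. (\<Sum>j<k1. of_nat (Suc j) / g w ^ (j + 2) * (eval_fps F1 (g z) * g z powi (int j - int k1) * deriv g z)) + H z) has_contour_integral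
      (\<Sum>j<k1. of_nat (Suc j) / g w ^ (j + 2) * (c * fps_nth F1 (k1 - Suc j)))) (circlepath 0 \<epsilon>)"
      using has_contour_integral_add[OF S H] unfolding val by simp
    then show ?thesis
    proof (rule has_contour_integral_eq)
      fix z assume "z \<in> path_image (circlepath 0 \<epsilon>)"
      then have zz: "cmod z = \<epsilon>" using \<epsilon> by (auto simp: path_image_circlepath)
      then have gz: "g z \<noteq> 0" "g z \<noteq> g w" using nz[of z] ne[OF _ w, of z] \<epsilon> by auto
      have p: "g z powi (int j - int k1) = g z ^ j / g z ^ k1" for j
        using gz by (simp add: power_int_diff)
      have "A z / (g z - g w)\<^sup>2 = A z * ((\<Sum>j<k1. of_nat (Suc j) * g z ^ j / g w ^ (j + 2))
         + g z ^ k1 * (of_nat (Suc k1) * g w - of_nat k1 * g z) / (g w ^ Suc k1 * (g w - g z)\<^sup>2))"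
        using inverse_square_expand[OF gw gz(2), of k1] by (simp add: divide_inverse)
      also have "\<dots> = (\<Sum>j<k1. of_nat (Suc j) / g w ^ (j + 2) * (eval_fps F1 (g z) * g z powi (int j - int k1) * deriv g z)) + H z"
      proof -
        have "A z * (g z ^ k1 * (of_nat (Suc k1) * g w - of_nat k1 * g z) / (g w ^ Suc k1 * (g w - g z)\<^sup>2)) = H z"
          unfolding A_def H_def using gz by (simp del: of_nat_Suc power_Suc)
        moreover have "A z * (of_nat (Suc j) * g z ^ j / g w ^ (j + 2)) =
           of_nat (Suc j) / g w ^ (j + 2) * (eval_fps F1 (g z) * g z powi (int j - int k1) * deriv g z)" for j
          unfolding A_def p by (simp add: field_simps)
        ultimately show ?thesis by (simp only: distrib_left sum_distrib_left)
      qed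
      finally show "(\<Sum>j<k1. of_nat (Suc j) / g w ^ (j + 2) * (eval_fps F1 (g z) * g z powi (int j - int k1) * deriv g z)) + H z
         = A z / (g z - g w)\<^sup>2" ..
    qed
  qed
  have inner': "integral {0..2*pi} (\<lambda>s. f s t) =
     (\<Sum>j<k1. of_nat (Suc j) * (c * fps_nth F1 (k1 - Suc j)) * (eval_fps F2 (g (?w t)) * g (?w t) powi (- int k2 - int j - 2) * deriv g (?w t))) * (\<i> * of_real (2 * \<epsilon>) * cis t)" for t
  proof -
    have gw: "g (?w t) \<noteq> 0" using nz[of "?w t"] w[of t] \<epsilon> by simp
    have p: "g (?w t) powi (- int k2 - int j - 2) = inverse (g (?w t) ^ k2 * g (?w t) ^ (j + 2))" for j
    proof -
      have "- int k2 - int j - 2 = - int (k2 + (j + 2))" by simp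
      then show ?thesis by (simp only: power_int_minus power_int_of_nat power_add)
    qed
    have "((\<lambda>s. A (?z s) / (g (?z s) - g (?w t))\<^sup>2 * (\<i> * of_real \<epsilon> * cis s)) has_integral
       (\<Sum>j<k1. of_nat (Suc j) / g (?w t) ^ (j + 2) * (c * fps_nth F1 (k1 - Suc j)))) {0..2*pi}"
      by (rule has_integral_circlepath[OF inner[OF w]])
    then have h: "((\<lambda>s. (A (?z s) / (g (?z s) - g (?w t))\<^sup>2 * (\<i> * of_real \<epsilon> * cis s)) * (B (?w t) * (\<i> * of_real (2 * \<epsilon>) * cis t))) has_integral
       (\<Sum>j<k1. of_nat (Suc j) / g (?w t) ^ (j + 2) * (c * fps_nth F1 (k1 - Suc j))) * (B (?w t) * (\<i> * of_real (2 * \<epsilon>) * cis t))) {0..2*pi}"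
      by (rule has_integral_mult_left)
    have eqf: "(\<lambda>s. (A (?z s) / (g (?z s) - g (?w t))\<^sup>2 * (\<i> * of_real \<epsilon> * cis s)) * (B (?w t) * (\<i> * of_real (2 * \<epsilon>) * cis t))) = (\<lambda>s. f s t)"
      by (auto simp: f_def mult_ac)
    have "integral {0..2*pi} (\<lambda>s. f s t) = (\<Sum>j<k1. of_nat (Suc j) / g (?w t) ^ (j + 2) * (c * fps_nth F1 (k1 - Suc j))) * (B (?w t) * (\<i> * of_real (2 * \<epsilon>) * cis t))"
      by (rule integral_unique) (use h in \<open>unfold eqf\<close>)
    also have "\<dots> = (\<Sum>j<k1. of_nat (Suc j) / g (?w t) ^ (j + 2) * (c * fps_nth F1 (k1 - Suc j)) * B (?w t)) * (\<i> * of_real (2 * \<epsilon>) * cis t)"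
      by (simp only: sum_distrib_right mult.assoc)
    finally show ?thesis unfolding p B_def
      by (simp add: divide_inverse mult_ac del: of_nat_Suc)
  qed
  have outer: "((\<lambda>t. (\<Sum>j<k1. of_nat (Suc j) * (c * fps_nth F1 (k1 - Suc j)) * (eval_fps F2 (g (?w t)) * g (?w t) powi (- int k2 - int j - 2) * deriv g (?w t))) * (\<i> * of_real (2 * \<epsilon>) * cis t)) has_integral
     (\<Sum>j<k1. of_nat (Suc j) * (c * fps_nth F1 (k1 - Suc j)) * (2 * of_real pi * \<i> * (if - int k2 - int j - 2 < 0 then fps_nth F2 (nat (- (- int k2 - int j - 2) - 1)) else 0)))) {0..2*pi}"
    by (rule has_integral_circlepath[where f="\<lambda>w. (\<Sum>j<k1. of_nat (Suc j) * (c * fps_nth F1 (k1 - Suc j)) * (eval_fps F2 (g w) * g w powi (- int k2 - int j - 2) * deriv g w))"],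
        intro has_contour_integral_sum has_contour_integral_lmul contour_residue F) (use \<epsilon> in auto)
  have "integral {0..2*pi} (\<lambda>s. integral {0..2*pi} (f s)) = integral {0..2*pi} (\<lambda>t. integral {0..2*pi} (\<lambda>s. f s t))"
    using integral_swap_continuous[OF cont_f] by simp
  also have "\<dots> = (\<Sum>j<k1. of_nat (Suc j) * (c * fps_nth F1 (k1 - Suc j)) * (2 * of_real pi * \<i> * (if - int k2 - int j - 2 < 0 then fps_nth F2 (nat (- (- int k2 - int j - 2) - 1)) else 0)))"
    unfolding inner' by (rule integral_unique[OF outer])
  also have "\<dots> = c\<^sup>2 * (\<Sum>j<k1. of_nat (Suc j) * fps_nth F1 (k1 - Suc j) * fps_nth F2 (k2 + Suc j))"
  proof -
    have "nat (- (- int k2 - int j - 2) - 1) = k2 + Suc j" for j by simp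
    then show ?thesis
      unfolding sum_distrib_left c_def by (intro sum.cong refl) (simp add: power2_eq_square mult_ac)
  qed
  also have "(\<Sum>j<k1. of_nat (Suc j) * fps_nth F1 (k1 - Suc j) * fps_nth F2 (k2 + Suc j)) =
     (\<Sum>j=1..k1. of_nat j * fps_nth F1 (k1 - j) * fps_nth F2 (k2 + j))"
    by (rule sum.reindex_bij_witness[where i="\<lambda>j. j - 1" and j=Suc]) auto
  finally have "integral {0..2*pi} (\<lambda>s. integral {0..2*pi} (f s)) = c\<^sup>2 * (\<Sum>j=1..k1. of_nat j * fps_nth F1 (k1 - j) * fps_nth F2 (k2 + j))" .
  moreover have "c \<noteq> 0" by (simp add: c_def)
  moreover have "(\<lambda>s. integral {0..2*pi} (\<lambda>t. (eval_fps F1 (g (?z s)) / g (?z s) ^ k1) * (eval_fps F2 (g (?w t)) / g (?w t) ^ k2) *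
      (deriv g (?z s) * deriv g (?w t) / (g (?z s) - g (?w t))\<^sup>2) * (\<i> * of_real \<epsilon> * cis s) * (\<i> * of_real (2 * \<epsilon>) * cis t)))
     = (\<lambda>s. integral {0..2*pi} (f s))"
    unfolding f_def A_def B_def by (intro ext arg_cong[where f="integral _"]) (simp add: mult_ac)
  ultimately show ?thesis
    unfolding circ_dbl_def c_def[symmetric] by simp
qed

end

section \<open>The covariance kernel in the local coordinate\<close>

context local_coord begin

text \<open>The expression is s/(pq) with three difference quotients of \<open>g\<close>, each
  within 1/8 of 1. Both s and pq have positive real part, so neither is a nonpositive real multiple
  of the other. Hence the logarithm of the kernel stays off its cut.\<close>

lemma ratio_not_nonpos:
  assumes "z \<in> ball 0 \<delta>" "w \<in> ball 0 \<delta>" "z \<noteq> 0" "w \<noteq> 0" "z \<noteq> w"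
  shows "z * w * (g z - g w) / ((z - w) * g z * g w) \<notin> \<real>\<^sub>\<le>\<^sub>0"
proof
  define p where "p = g z / z"
  define q where "q = g w / w"
  define s where "s = (g z - g w) / (z - w)"
  have gz: "g z \<noteq> 0" and gw: "g w \<noteq> 0" using g_nz assms by auto
  have p: "cmod (p - 1) \<le> 1 / 8" and q: "cmod (q - 1) \<le> 1 / 8" and s: "cmod (s - 1) \<le> 1 / 8"
    using g_close[of z 0] g_close[of w 0] g_close[of z w] assms g0 \<delta>
    by (simp_all add: p_def q_def s_def field_simps norm_divide diff_divide_eq_iff)
  have pq: "cmod (p * q - 1) < 1"
  proof -
    have "p * q - 1 = (p - 1) * (q - 1) + (p - 1) + (q - 1)" by (simp add: algebra_simps)
    then have "cmod (p * q - 1) \<le> cmod (p - 1) * cmod (q - 1) + cmod (p - 1) + cmod (q - 1)"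
      unfolding norm_mult[symmetric]
      by (simp only: order_trans[OF norm_triangle_ineq add_right_mono[OF norm_triangle_ineq]])
    also have "\<dots> \<le> 1 / 8 * (1 / 8) + 1 / 8 + 1 / 8"
      using p q by (intro add_mono mult_mono) auto
    finally show ?thesis by simp
  qed
  have Rs: "Re s > 0" using s abs_Re_le_cmod[of "s - 1"] by simp
  have Rpq: "Re (p * q) > 0" using pq abs_Re_le_cmod[of "p * q - 1"] by (simp del: times_complex.sel)
  assume "z * w * (g z - g w) / ((z - w) * g z * g w) \<in> \<real>\<^sub>\<le>\<^sub>0"
  moreover have "z * w * (g z - g w) / ((z - w) * g z * g w) = s / (p * q)"
    using assms gz gw by (simp add: p_def q_def s_def field_simps)
  ultimately obtain t where t: "t \<le> 0" "s / (p * q) = of_real t" by (auto elim!: nonpos_Reals_cases)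
  have "p * q \<noteq> 0" using gz gw assms by (simp add: p_def q_def)
  then have "s = of_real t * (p * q)" using t(2) by (simp add: field_simps)
  then have "Re s = t * Re (p * q)"
    by (simp only: scaleR_conv_of_real[symmetric] scaleR_complex.sel)
  then show False using Rs Rpq t(1) mult_nonpos_nonneg[of t "Re (p * q)"] by simp
qed

text \<open>In the coordinate \<open>1/g\<close> the kernel of the covariance is the universal one: the second summand cancels the
  double pole produced by the denominator \<open>z - w\<close> under the logarithm.\<close>
lemma kernel_deriv:
  assumes Bf: "\<And>z w. z \<in> ball 0 \<delta> \<Longrightarrow> w \<in> ball 0 \<delta> \<Longrightarrow> z \<noteq> 0 \<Longrightarrow> w \<noteq> 0 \<Longrightarrow> z \<noteq> w \<Longrightarrow>
      Bf z w = z * w * (g z - g w) / ((z - w) * g z * g w)"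
    and zw: "z0 \<in> ball 0 \<delta>" "w0 \<in> ball 0 \<delta>" "z0 \<noteq> 0" "w0 \<noteq> 0" "z0 \<noteq> w0"
  shows "deriv (\<lambda>z. deriv (\<lambda>w. Ln (Bf z w)) w0) z0 + 1 / (z0 - w0)\<^sup>2 = deriv g z0 * deriv g w0 / (g z0 - g w0)\<^sup>2"
proof -
  let ?B = "\<lambda>z w. z * w * (g z - g w) / ((z - w) * g z * g w)"
  define D where "D z = 1 / w0 + 1 / (z - w0) - deriv g w0 / (g z - g w0) - deriv g w0 / g w0" for z
  have gw: "g w0 \<noteq> 0" using g_nz zw by blast
  have inner: "deriv (\<lambda>w. Ln (Bf z w)) w0 = D z" if z: "z \<in> ball 0 \<delta>" "z \<noteq> 0" "z \<noteq> w0" for z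
  proof -
    have gz: "g z \<noteq> 0" "g z \<noteq> g w0" using g_nz g_inj z zw by blast+
    have "eventually (\<lambda>w. w \<in> ball 0 \<delta> - {0} - {z}) (nhds w0)"
      using zw z by (intro eventually_nhds_in_open open_Diff) auto
    then have "eventually (\<lambda>w. Ln (Bf z w) = Ln (?B z w)) (nhds w0)"
      by eventually_elim (use Bf z in auto)
    then have "deriv (\<lambda>w. Ln (Bf z w)) w0 = deriv (\<lambda>w. Ln (?B z w)) w0"
      by (rule deriv_cong_ev) simp
    also have "\<dots> = D z"
    proof (rule DERIV_imp_deriv)
      have num: "((\<lambda>w. z * w * (g z - g w)) has_field_derivative z * (g z - g w0) - z * w0 * deriv g w0) (at w0)"
        using zw by (auto intro!: derivative_eq_intros has_deriv)
      have den: "((\<lambda>w. (z - w) * g z * g w) has_field_derivative - g z * g w0 + (z - w0) * g z * deriv g w0) (at w0)"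
        using zw by (auto intro!: derivative_eq_intros has_deriv)
      have nz: "(z - w0) * g z * g w0 \<noteq> 0" using z gz gw by simp
      have "((\<lambda>w. ?B z w) has_field_derivative
          ((z * (g z - g w0) - z * w0 * deriv g w0) * ((z - w0) * g z * g w0) - z * w0 * (g z - g w0) * (- g z * g w0 + (z - w0) * g z * deriv g w0))
          / (((z - w0) * g z * g w0) * ((z - w0) * g z * g w0))) (at w0)"
        by (rule DERIV_divide[OF num den nz])
      then have "((\<lambda>w. Ln (?B z w)) has_field_derivative inverse (?B z w0) *
          (((z * (g z - g w0) - z * w0 * deriv g w0) * ((z - w0) * g z * g w0) - z * w0 * (g z - g w0) * (- g z * g w0 + (z - w0) * g z * deriv g w0))
          / (((z - w0) * g z * g w0) * ((z - w0) * g z * g w0)))) (at w0)"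
        by (intro has_field_derivative_Ln[THEN DERIV_chain2] ratio_not_nonpos) (use z zw in auto)
      moreover have "inverse (?B z w0) *
          (((z * (g z - g w0) - z * w0 * deriv g w0) * ((z - w0) * g z * g w0) - z * w0 * (g z - g w0) * (- g z * g w0 + (z - w0) * g z * deriv g w0))
          / (((z - w0) * g z * g w0) * ((z - w0) * g z * g w0))) = D z"
      proof -
        have gen: "inverse (n / d) * ((n' * d - n * d') / (d * d)) = n' / n - d' / d" if "n \<noteq> 0" "d \<noteq> 0" for n d n' d' :: complex
          using that by (simp add: field_simps)
        have n: "z * w0 * (g z - g w0) \<noteq> 0" using z zw gz by simp
        have "(z * (g z - g w0) - z * w0 * deriv g w0) / (z * w0 * (g z - g w0)) = 1 / w0 - deriv g w0 / (g z - g w0)"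
          using z zw gz by (simp add: diff_divide_distrib)
        moreover have "(- g z * g w0 + (z - w0) * g z * deriv g w0) / ((z - w0) * g z * g w0) = - 1 / (z - w0) + deriv g w0 / g w0"
        proof -
          have "(- G * h + d * G * h') / (d * G * h) = - 1 / d + h' / h" if "d \<noteq> 0" "G \<noteq> 0" "h \<noteq> 0" for G h d h' :: complex
            using that by (simp add: field_simps)
          then show ?thesis using z gz gw by simp
        qed
        ultimately show ?thesis unfolding gen[OF n nz] D_def by simp
      qed
      ultimately show "((\<lambda>w. Ln (?B z w)) has_field_derivative D z) (at w0)" by simp
    qed
    finally show ?thesis .
  qed
  have "eventually (\<lambda>z. z \<in> ball 0 \<delta> - {0} - {w0}) (nhds z0)"
    using zw by (intro eventually_nhds_in_open open_Diff) auto
  then have "eventually (\<lambda>z. deriv (\<lambda>w. Ln (Bf z w)) w0 = D z) (nhds z0)"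
    by eventually_elim (use inner in auto)
  then have "deriv (\<lambda>z. deriv (\<lambda>w. Ln (Bf z w)) w0) z0 = deriv D z0"
    by (rule deriv_cong_ev) simp
  also have "deriv D z0 = - 1 / (z0 - w0)\<^sup>2 + deriv g z0 * deriv g w0 / (g z0 - g w0)\<^sup>2"
  proof (rule DERIV_imp_deriv)
    have ne: "g z0 \<noteq> g w0" using g_inj zw by blast
    then show "(D has_field_derivative - 1 / (z0 - w0)\<^sup>2 + deriv g z0 * deriv g w0 / (g z0 - g w0)\<^sup>2) (at z0)"
      unfolding D_def using zw gw
      by (auto intro!: derivative_eq_intros has_deriv simp: power2_eq_square)
  qed
  finally show ?thesis by simp
qed

text \<open>Here (1+z) H'(1+z) equals 1/g - 1 - 1/z. Each bracket of the integrand thus becomes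
  U(g)/(a g), and the prefactor \<open>a ^ (k1 + k2)\<close> cancels. Under the logarithm the terms
  1/z and 1/w contribute exactly -1, which removes the constant 1.\<close>

lemma cov_kernel_coord:
  assumes Y: "\<And>z. z \<in> ball 0 \<delta> \<Longrightarrow> z \<noteq> 0 \<Longrightarrow> Ci (Ln (1 + z)) = 1 / g z"
    and U: "\<And>z. z \<in> ball 0 \<delta> \<Longrightarrow> z \<noteq> 0 \<Longrightarrow> eval_fps U (g z) = 1 - of_real (1 - a) * g z - of_real (1 - a) * (g z / z)"
    and R: "R \<le> fps_conv_radius U" and \<delta>1: "\<delta> \<le> 1" and a: "a \<noteq> 0" and \<epsilon>: "0 < \<epsilon>" "2 * \<epsilon> < \<delta>"
  shows "cov_kernel a Ci \<epsilon> k1 k2 = (\<Sum>j=1..k1. of_nat j * fps_nth (U ^ k1) (k1 - j) * fps_nth (U ^ k2) (k2 + j))"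
proof -
  let ?P = "\<lambda>k z. (1 / z + 1 + (1 + z) * Hprime Ci (1 + z) / of_real a) ^ k"
  let ?G = "\<lambda>z w. (eval_fps (U ^ k1) (g z) / g z ^ k1) * (eval_fps (U ^ k2) (g w) / g w ^ k2) *
      (deriv g z * deriv g w / (g z - g w)\<^sup>2)"
  let ?Bf = "\<lambda>z w. 1 - z * w * ((1 + z) * Hprime Ci (1 + z) - (1 + w) * Hprime Ci (1 + w)) / (z - w)"
  have Rk: "R \<le> fps_conv_radius (U ^ k)" for k
    using R fps_conv_radius_power[of U k] by (rule order_trans)
  have nz: "1 + z \<noteq> 0" if "z \<in> ball 0 \<delta>" for z :: complex
  proof
    assume "1 + z = 0"
    then have "z = -1" by (simp add: add_eq_0_iff)
    then show False using that \<delta>1 by simp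
  qed
  have H: "(1 + z) * Hprime Ci (1 + z) = 1 / g z - 1 - 1 / z" if "z \<in> ball 0 \<delta>" "z \<noteq> 0" for z
  proof -
    have "(1 + z) * Hprime Ci (1 + z) = Ci (Ln (1 + z)) - (1 + z) / z"
      using nz[OF that(1)] unfolding Hprime_def by (simp add: right_diff_distrib)
    then show ?thesis using that by (simp add: Y add_divide_distrib)
  qed
  have P: "?P k z = of_real (1 / a ^ k) * (eval_fps (U ^ k) (g z) / g z ^ k)" if z: "z \<in> ball 0 \<delta>" "z \<noteq> 0" for z k
  proof -
    have gz: "g z \<noteq> 0" using g_nz z by blast
    have "ereal (cmod (g z)) < fps_conv_radius U" using gR[OF z(1)] R by (rule less_le_trans)
    then have e: "eval_fps (U ^ k) (g z) = eval_fps U (g z) ^ k" by (rule eval_fps_power)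
    have "1 / z + 1 + (1 + z) * Hprime Ci (1 + z) / of_real a = of_real (1 / a) * (eval_fps U (g z) / g z)"
      unfolding H[OF z] U[OF z] using a gz z by (simp add: field_simps)
    then show ?thesis unfolding e by (simp add: power_mult_distrib power_divide)
  qed
  have Bf: "?Bf z w = z * w * (g z - g w) / ((z - w) * g z * g w)"
    if "z \<in> ball 0 \<delta>" "w \<in> ball 0 \<delta>" "z \<noteq> 0" "w \<noteq> 0" "z \<noteq> w" for z w
  proof -
    have "g z \<noteq> 0" "g w \<noteq> 0" "z - w \<noteq> 0" using g_nz that by auto
    then show ?thesis unfolding H[OF that(1,3)] H[OF that(2,4)] using that by (simp add: field_simps)
  qed
  have pt: "?P k1 z * ?P k2 w * (deriv (\<lambda>z'. deriv (\<lambda>w'. Ln (?Bf z' w')) w) z + 1 / (z - w)\<^sup>2) =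
      of_real (1 / a ^ (k1 + k2)) * ?G z w" if "cmod z = \<epsilon>" "cmod w = 2 * \<epsilon>" for z w
  proof -
    have zw: "z \<in> ball 0 \<delta>" "w \<in> ball 0 \<delta>" "z \<noteq> 0" "w \<noteq> 0" "z \<noteq> w" using that \<epsilon> by auto
    have K: "deriv (\<lambda>z'. deriv (\<lambda>w'. Ln (?Bf z' w')) w) z + 1 / (z - w)\<^sup>2 = deriv g z * deriv g w / (g z - g w)\<^sup>2"
      by (rule kernel_deriv[where Bf="?Bf", OF Bf zw])
    show ?thesis
      unfolding P[OF zw(1,3)] P[OF zw(2,4)] K by (simp add: power_add)
  qed
  have "circ_dbl \<epsilon> (2 * \<epsilon>) (\<lambda>z w. ?P k1 z * ?P k2 w * (deriv (\<lambda>z'. deriv (\<lambda>w'. Ln (?Bf z' w')) w) z + 1 / (z - w)\<^sup>2))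
     = of_real (1 / a ^ (k1 + k2)) * circ_dbl \<epsilon> (2 * \<epsilon>) ?G"
  proof -
    have c: "cmod (of_real \<epsilon> * cis s) = \<epsilon>" "cmod (of_real (2 * \<epsilon>) * cis s) = 2 * \<epsilon>" for s
      using \<epsilon> by (auto simp: norm_mult)
    show ?thesis
      unfolding circ_dbl_def pt[OF c] mult.assoc[of "of_real (1 / a ^ (k1 + k2))"] integral_mult_right
      by (simp only: mult.left_commute)
  qed
  then show ?thesis
    unfolding cov_kernel_def using a circ_dbl_residue[OF \<epsilon> Rk[of k1] Rk[of k2], of k1 k2] by simp
qed

end

section \<open>The local coordinate constructed from the Stieltjes transform\<close>

lemma stieltjes_sums:
  fixes m :: "real measure" and z :: complex
  assumes m: "prob_space m" and borel: "sets m = sets borel" and B: "AE x in m. \<bar>x\<bar> \<le> B" "0 < B" "B < cmod z"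
  shows "(\<lambda>k. of_real (integral\<^sup>L m (\<lambda>x. x ^ k)) / z ^ Suc k) sums stieltjes m z"
    and "\<bar>integral\<^sup>L m (\<lambda>x. x ^ k)\<bar> \<le> B ^ k"
proof -
  interpret prob_space m by (rule m)
  have [measurable_cong]: "sets m = sets borel" by (rule borel)
  have int: "integrable m (\<lambda>x. x ^ k)" for k
    by (rule integrable_const_bound[where B="B ^ k"])
       (use B in \<open>auto elim!: eventually_mono simp: power_abs intro!: power_mono\<close>)
  have abs: "integral\<^sup>L m (\<lambda>x. \<bar>x\<bar> ^ k) \<le> B ^ k" for k
  proof -
    have "integral\<^sup>L m (\<lambda>x. \<bar>x\<bar> ^ k) \<le> integral\<^sup>L m (\<lambda>x. B ^ k)"
      by (rule integral_mono_AE)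
         (use B integrable_norm[OF int[of k]] in \<open>auto elim!: eventually_mono simp: power_abs intro!: power_mono\<close>)
    then show ?thesis by (simp add: prob_space)
  qed
  show "\<bar>integral\<^sup>L m (\<lambda>x. x ^ k)\<bar> \<le> B ^ k"
    using integral_norm_bound[of m "\<lambda>x. x ^ k"] abs[of k] by (simp add: power_abs)
  define f where "f k x = complex_of_real (x ^ k) / z ^ Suc k" for k x
  have intf: "integrable m (f k)" for k
    unfolding f_def using int[of k] by (intro integrable_divide integrable_of_real) 
  have z: "z \<noteq> 0" using B by auto
  have sm: "f k x = (of_real x / z) ^ k * (1 / z)" for k x
    using z by (simp add: f_def power_divide)
  have lt: "cmod (of_real x / z) < 1" if "\<bar>x\<bar> \<le> B" for x
    using that B z by (simp add: norm_divide)
  \<comment> \<open>Termwise integration of the geometric series, dominated by the one with ratio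
    \<open>B / cmod z\<close>.\<close>
  have "(\<lambda>k. integral\<^sup>L m (f k)) sums (\<integral>x. (\<Sum>k. f k x) \<partial>m)"
  proof (rule sums_integral[OF intf])
    show "AE x in m. summable (\<lambda>k. norm (f k x))"
      using B(1)
    proof eventually_elim
      case (elim x)
      have "summable (\<lambda>k. cmod (of_real x / z) ^ k * cmod (1 / z))"
        using lt[OF elim] by (intro summable_mult2 summable_geometric) simp
      then show ?case by (simp add: sm norm_mult norm_power norm_divide)
    qed
    have "summable (\<lambda>k. (B / cmod z) ^ k * (1 / cmod z))"
      using B by (intro summable_mult2 summable_geometric) (simp add: divide_less_eq)
    moreover have "norm (\<integral>x. norm (f k x) \<partial>m) \<le> (B / cmod z) ^ k * (1 / cmod z)" for k
    proof -
      have "(\<integral>x. norm (f k x) \<partial>m) = (\<integral>x. \<bar>x\<bar> ^ k \<partial>m) / cmod z ^ Suc k"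
        by (simp add: f_def norm_divide norm_power norm_mult)
      also have "\<dots> \<le> B ^ k / cmod z ^ Suc k" by (intro divide_right_mono abs) simp
      finally show ?thesis by (simp add: power_divide mult.commute)
    qed
    ultimately show "summable (\<lambda>k. \<integral>x. norm (f k x) \<partial>m)"
      by (rule summable_comparison_test'[where N=0])
  qed
  also have "(\<integral>x. (\<Sum>k. f k x) \<partial>m) = stieltjes m z"
    unfolding stieltjes_def
  proof (rule integral_cong_AE)
    show "AE x in m. (\<Sum>k. f k x) = 1 / (z - of_real x)"
      using B(1)
    proof eventually_elim
      case (elim x)
      have "(\<lambda>k. (of_real x / z) ^ k * (1 / z)) sums (1 / (1 - of_real x / z) * (1 / z))"
        by (intro sums_mult2 geometric_sums lt elim)
      moreover have "1 / (1 - of_real x / z) * (1 / z) = 1 / (z - of_real x)"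
        using z by (simp add: field_simps)
      ultimately show ?case unfolding sm by (simp add: sums_iff)
    qed
  qed (simp_all add: f_def)
  also have "(\<lambda>k. integral\<^sup>L m (f k)) = (\<lambda>k. of_real (integral\<^sup>L m (\<lambda>x. x ^ k)) / z ^ Suc k)"
    unfolding f_def by (simp del: of_real_power)
  finally show "(\<lambda>k. of_real (integral\<^sup>L m (\<lambda>x. x ^ k)) / z ^ Suc k) sums stieltjes m z" .
qed

text \<open>The coordinate is the local inverse \<open>\<psi>\<close> of the map sending w to exp of
  the Stieltjes transform at 1/w, minus 1. That map extends to w = 0 with value 0 and derivative 1,
  and the disc is shrunk until \<open>local_coord\<close> applies.\<close>

lemma cov_kernel_eq:
  fixes m :: "real measure" and Ci :: "complex \<Rightarrow> complex" and a :: real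
  defines "mo \<equiv> \<lambda>k. complex_of_real (integral\<^sup>L m (\<lambda>x. x ^ k))"
  defines "U \<equiv> symU mo a"
  assumes m: "prob_space m" and borel: "sets m = sets borel" and cpt: "emeasure m {x. K < \<bar>x\<bar>} = 0"
    and a: "0 < a"
    and Ci_inv: "\<And>u. 0 < cmod u \<Longrightarrow> cmod u < r \<Longrightarrow> stieltjes m (Ci u) = u" and r: "0 < r"
    and Ci_inf: "filterlim Ci at_infinity (at 0)"
  shows "\<exists>\<epsilon>0>0. \<forall>\<epsilon>. 0 < \<epsilon> \<and> \<epsilon> < \<epsilon>0 \<longrightarrow> (\<forall>k1 k2. cov_kernel a Ci \<epsilon> k1 k2 =
     (\<Sum>j=1..k1. of_nat j * fps_nth (U ^ k1) (k1 - j) * fps_nth (U ^ k2) (k2 + j)))"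
proof -
  interpret prob_space m by (rule m)
  define B where "B = max K 1"
  have B: "AE x in m. \<bar>x\<bar> \<le> B" "0 < B"
  proof -
    have "{x. K < \<bar>x\<bar>} \<in> sets m" unfolding borel by simp
    then have "AE x in m. x \<notin> {x. K < \<bar>x\<bar>}" using cpt by (intro AE_not_in) (auto simp: null_sets_def)
    then show "AE x in m. \<bar>x\<bar> \<le> B" by eventually_elim (auto simp: B_def)
  qed (simp add: B_def)
  have mo0: "mo 0 = 1" by (simp add: mo_def prob_space)
  define C where "C = Abs_fps (\<lambda>k. if k = 0 then 0 else mo (k - 1))"
  \<comment> \<open>Half of 1/B, so that even on the boundary circle 1/w stays strictly outside the
    support.\<close>
  define R0 where "R0 = 1 / (2 * B)"
  have R0: "0 < R0" using B by (simp add: R0_def)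
  have C_sums: "(\<lambda>k. fps_nth C k * w ^ k) sums stieltjes m (1 / w)" if "0 < cmod w" "cmod w \<le> R0" for w
  proof -
    have "B < cmod (1 / w)"
    proof -
      have "cmod w < 1 / B" using that B by (simp add: R0_def field_simps)
      then show ?thesis using that B by (simp add: norm_divide field_simps)
    qed
    from stieltjes_sums(1)[OF m borel B this]
    have "(\<lambda>k. fps_nth C (Suc k) * w ^ Suc k) sums stieltjes m (1 / w)"
      by (simp add: C_def mo_def power_divide)
    moreover have "fps_nth C 0 = 0" by (simp add: C_def)
    ultimately show ?thesis using sums_Suc_iff[of "\<lambda>k. fps_nth C k * w ^ k" "stieltjes m (1 / w)"] by simp
  qed
  have radC: "ereal R0 \<le> fps_conv_radius C"
  proof -
    have "summable (\<lambda>k. fps_nth C k * of_real R0 ^ k)"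
      using C_sums[of "of_real R0"] R0 by (auto simp: sums_iff)
    then have "ereal (norm (of_real R0 :: complex)) \<le> conv_radius (fps_nth C)" by (rule conv_radius_geI)
    then show ?thesis using R0 by (simp add: fps_conv_radius_def)
  qed
  have evC: "eval_fps C w = stieltjes m (1 / w)" if "0 < cmod w" "cmod w \<le> R0" for w
    using C_sums[OF that] by (simp add: eval_fps_def sums_iff)
  define EE where "EE w = exp (eval_fps C w)" for w
  define \<phi> where "\<phi> w = EE w - 1" for w
  have Cexp: "eval_fps C has_fps_expansion C"
    by (rule eval_fps_has_fps_expansion) (use radC R0 in \<open>auto intro: less_le_trans[where y="ereal R0"]\<close>)
  have EEexp: "EE has_fps_expansion expC mo"
  proof -
    have "((\<lambda>w. exp (1 * w)) \<circ> eval_fps C) has_fps_expansion (fps_exp 1 oo C)"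
      by (rule has_fps_expansion_compose[OF has_fps_expansion_exp Cexp]) (simp add: C_def)
    then show ?thesis by (simp add: comp_def EE_def[abs_def] expC_def C_def)
  qed
  have holC: "eval_fps C holomorphic_on ball 0 R0"
    by (rule holomorphic_on_eval_fps) (auto simp: in_eball_iff intro!: less_le_trans[OF _ radC])
  have hol\<phi>: "\<phi> holomorphic_on ball 0 R0"
    unfolding \<phi>_def EE_def by (intro holomorphic_intros holC)
  have \<phi>0: "\<phi> 0 = 0" by (simp add: \<phi>_def EE_def eval_fps_at_0 C_def)
  have d\<phi>: "deriv \<phi> 0 = 1"
  proof (rule DERIV_imp_deriv)
    have "(eval_fps C has_field_derivative eval_fps (fps_deriv C) 0) (at 0)"
      by (rule has_field_derivative_eval_fps) (use radC R0 in \<open>auto intro: less_le_trans[where y="ereal R0"]\<close>)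
    moreover have "eval_fps (fps_deriv C) 0 = 1" "eval_fps C 0 = 0"
      by (simp_all add: eval_fps_at_0 C_def mo0)
    ultimately have D: "(eval_fps C has_field_derivative 1) (at 0)" and C0: "eval_fps C 0 = 0" by simp_all
    have "((\<lambda>w. exp (eval_fps C w) - 1) has_field_derivative exp (eval_fps C 0) * 1 - 0) (at 0)"
      by (intro DERIV_diff DERIV_const DERIV_fun_exp D)
    then show "(\<phi> has_field_derivative 1) (at 0)"
      unfolding \<phi>_def[abs_def] EE_def C0 by simp
  qed
  have "\<exists>\<rho>>0. ball 0 \<rho> \<subseteq> ball (0::complex) R0 \<and> inj_on \<phi> (ball 0 \<rho>)"
    by (rule has_complex_derivative_locally_injective[OF hol\<phi>, of 0]) (use R0 d\<phi> in auto)
  then obtain \<rho> where \<rho>: "0 < \<rho>" "ball (0::complex) \<rho> \<subseteq> ball 0 R0" "inj_on \<phi> (ball 0 \<rho>)" by blast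
  have hol\<rho>: "\<phi> holomorphic_on ball 0 \<rho>" using hol\<phi> \<rho>(2) by (rule holomorphic_on_subset)
  obtain \<psi> where \<psi>: "\<psi> holomorphic_on \<phi> ` ball 0 \<rho>" "\<And>z. z \<in> ball 0 \<rho> \<Longrightarrow> deriv \<phi> z * deriv \<psi> (\<phi> z) = 1"
      "\<And>z. z \<in> ball 0 \<rho> \<Longrightarrow> \<psi> (\<phi> z) = z"
    using holomorphic_has_inverse[OF hol\<rho> open_ball \<rho>(3)] by metis
  have opn: "open (\<phi> ` ball 0 \<rho>)" by (rule open_mapping_thm3[OF hol\<rho> open_ball \<rho>(3)])
  have mem0: "0 \<in> \<phi> ` ball 0 \<rho>" using \<phi>0 \<rho>(1) by (metis centre_in_ball image_eqI)
  have \<psi>0: "\<psi> 0 = 0" using \<psi>(3)[of 0] \<phi>0 \<rho>(1) by simp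
  have d\<psi>: "deriv \<psi> 0 = 1" using \<psi>(2)[of 0] d\<phi> \<phi>0 \<rho>(1) by simp
  have cont\<psi>: "isCont \<psi> 0" "isCont (deriv \<psi>) 0"
    using holomorphic_on_imp_continuous_on[OF \<psi>(1)] holomorphic_on_imp_continuous_on[OF holomorphic_deriv[OF \<psi>(1) opn]]
      opn mem0 by (auto simp: continuous_on_eq_continuous_at)
  have t\<psi>: "(\<psi> \<longlongrightarrow> 0) (nhds 0)"
    using cont\<psi>(1)[unfolded isCont_def tendsto_at_iff_tendsto_nhds] \<psi>0 by simp
  have td: "(deriv \<psi> \<longlongrightarrow> 1) (nhds 0)"
    using cont\<psi>(2)[unfolded isCont_def tendsto_at_iff_tendsto_nhds] d\<psi> by simp
  have radV: "0 < fps_conv_radius (symV mo)"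
    using EEexp by (simp add: symV_def has_fps_expansion_def)
  have V0: "fps_nth (symV mo) 0 = 1"
    using expC_coeff(2)[where mo=mo and k=0] mo0 by (simp add: symV_def expC_coeff)
  have Uexp: "(\<lambda>w. 1 - of_real (1 - a) * w - of_real (1 - a) * inverse (eval_fps (symV mo) w)) has_fps_expansion U"
    unfolding U_def symU_def
    by (intro fps_expansion_intros eval_fps_has_fps_expansion radV) (simp add: V0)
  have radU: "0 < fps_conv_radius U" using Uexp by (simp add: has_fps_expansion_def)
  have "eventually (\<lambda>w. eval_fps U w = 1 - of_real (1 - a) * w - of_real (1 - a) * inverse (eval_fps (symV mo) w)) (nhds 0)"
    "eventually (\<lambda>w. eval_fps (expC mo) w = EE w) (nhds 0)"
    using Uexp EEexp by (simp_all add: has_fps_expansion_def)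
  moreover have "eventually (\<lambda>w. ereal (cmod w) < fps_conv_radius (symV mo)) (nhds 0)"
  proof -
    have "((\<lambda>w::complex. ereal (cmod w)) \<longlongrightarrow> ereal (cmod 0)) (nhds 0)"
      by (intro tendsto_intros filterlim_ident)
    then show ?thesis by (rule order_tendstoD(2)) (use radV in \<open>simp add: zero_ereal_def\<close>)
  qed
  ultimately have "eventually (\<lambda>w. w \<noteq> 0 \<longrightarrow> eval_fps U w = 1 - of_real (1 - a) * w - of_real (1 - a) * (w / \<phi> w)) (nhds 0)"
  proof eventually_elim
    case (elim w)
    have "expC mo = 1 + fps_X * symV mo"
    proof (rule fps_ext)
      fix i show "fps_nth (expC mo) i = fps_nth (1 + fps_X * symV mo) i"
        by (cases i) (simp_all add: symV_def expC_coeff(1))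
    qed
    moreover have "ereal (cmod w) < fps_conv_radius (fps_X * symV mo)"
      using elim(3) fps_conv_radius_mult[of fps_X "symV mo"] by (simp add: min_def)
    ultimately have "EE w = 1 + w * eval_fps (symV mo) w"
      using elim(2,3) by (simp add: eval_fps_add eval_fps_mult)
    then have "w / \<phi> w = inverse (eval_fps (symV mo) w)" if "w \<noteq> 0"
      using that by (simp add: \<phi>_def divide_inverse)
    then show ?case using elim(1) by simp
  qed
  then have evU: "eventually (\<lambda>z. \<psi> z \<noteq> 0 \<longrightarrow> eval_fps U (\<psi> z) = 1 - of_real (1 - a) * \<psi> z - of_real (1 - a) * (\<psi> z / \<phi> (\<psi> z))) (nhds 0)"
    by (rule eventually_compose_filterlim[OF _ t\<psi>])
  have ev\<psi>: "eventually (\<lambda>z. \<phi> (\<psi> z) = z \<and> z \<in> \<phi> ` ball 0 \<rho>) (nhds 0)"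
    using eventually_nhds_in_open[OF opn mem0] by eventually_elim (use \<psi>(3) in auto)
  have evd: "eventually (\<lambda>z. cmod (deriv \<psi> z - 1) < 1 / 8) (nhds 0)"
    using tendstoD[OF td, of "1/8"] by (simp add: dist_norm)
  have evR: "eventually (\<lambda>z. ereal (cmod (\<psi> z)) < fps_conv_radius U) (nhds 0)"
  proof -
    have "((\<lambda>z. ereal (cmod (\<psi> z))) \<longlongrightarrow> ereal (cmod 0)) (nhds 0)"
      by (intro tendsto_intros t\<psi>)
    then show ?thesis by (rule order_tendstoD(2)) (use radU in \<open>simp add: zero_ereal_def\<close>)
  qed
  \<comment> \<open>The given \<open>Ci\<close> is identified with 1/\<open>\<psi>\<close>. Since it
    blows up at 0, the point w = 1/Ci(log(1+z)) eventually lies in the disc where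
    \<open>\<phi>\<close> is injective; the inversion property gives \<open>\<phi> w = z\<close>,
    hence \<open>\<psi> z = w\<close>.\<close>
  have evCi: "eventually (\<lambda>z. Ci (Ln (1 + z)) = 1 / \<psi> z) (at 0)"
  proof -
    have Ln0: "filterlim (\<lambda>z. Ln (1 + z)) (at 0) (at 0)"
    proof (rule filterlim_atI)
      show "((\<lambda>z. Ln (1 + z)) \<longlongrightarrow> 0) (at 0)"
        by (rule tendsto_eq_intros refl | simp)+
      have "eventually (\<lambda>z::complex. z \<in> ball 0 1 - {0}) (at 0)"
        by (rule eventually_at_in_open) auto
      then show "eventually (\<lambda>z. Ln (1 + z) \<noteq> 0) (at 0)"
      proof eventually_elim
        case (elim z)
        then have "1 + z \<noteq> 0" by (metis DiffD1 add_eq_0_iff dist_0_norm mem_ball norm_minus_cancel norm_one less_irrefl)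
        then show ?case using elim by (metis DiffD2 add_cancel_left_right exp_Ln exp_zero insertI1)
      qed
    qed
    have "filterlim (\<lambda>z. Ci (Ln (1 + z))) at_infinity (at 0)"
      using filterlim_compose[OF Ci_inf Ln0] .
    then have "eventually (\<lambda>z. cmod (Ci (Ln (1 + z))) > 1 / \<rho>) (at 0)"
      by (simp add: filterlim_at_infinity_conv_norm_at_top filterlim_at_top_dense)
    moreover have "eventually (\<lambda>z. Ln (1 + z) \<in> ball 0 r - {0}) (at 0)"
      using Ln0 eventually_at_in_open[of "ball 0 r" "0::complex"] r by (auto simp: filterlim_iff)
    moreover have "eventually (\<lambda>z::complex. z \<in> ball 0 1 - {0}) (at 0)"
      by (rule eventually_at_in_open) auto
    ultimately show ?thesis
    proof eventually_elim
      case (elim z)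
      define w where "w = 1 / Ci (Ln (1 + z))"
      have Y: "0 < cmod (Ci (Ln (1 + z)))" using elim(1) \<rho>(1) by (meson less_trans zero_less_divide_1_iff)
      have w: "0 < cmod w" "cmod w < \<rho>" "1 / w = Ci (Ln (1 + z))"
        using Y elim(1) \<rho>(1) by (auto simp: w_def norm_divide field_simps)
      have "cmod w < R0" using w(2) \<rho>(2) by (metis mem_ball_0 subsetD)
      then have "eval_fps C w = Ln (1 + z)"
        using evC[of w] w Ci_inv[of "Ln (1 + z)"] elim(2) by auto
      moreover have "1 + z \<noteq> 0" using elim(3) by (metis DiffD1 add_eq_0_iff dist_0_norm mem_ball norm_minus_cancel norm_one less_irrefl)
      ultimately have "\<phi> w = z" by (simp add: \<phi>_def EE_def)
      then have "\<psi> z = w" using \<psi>(3)[of w] w by simp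
      then show ?case using w(3) by simp
    qed
  qed
  then have "eventually (\<lambda>z. z \<noteq> 0 \<longrightarrow> Ci (Ln (1 + z)) = 1 / \<psi> z) (nhds 0)"
    by (simp add: eventually_at_filter)
  with evU ev\<psi> evd evR have "eventually (\<lambda>z. (z \<noteq> 0 \<longrightarrow> Ci (Ln (1 + z)) = 1 / \<psi> z) \<and> \<phi> (\<psi> z) = z \<and> z \<in> \<phi> ` ball 0 \<rho> \<and>
     cmod (deriv \<psi> z - 1) < 1 / 8 \<and> ereal (cmod (\<psi> z)) < fps_conv_radius U \<and>
     (\<psi> z \<noteq> 0 \<longrightarrow> eval_fps U (\<psi> z) = 1 - of_real (1 - a) * \<psi> z - of_real (1 - a) * (\<psi> z / \<phi> (\<psi> z)))) (nhds 0)"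
    by eventually_elim blast
  then obtain \<delta>0 where \<delta>0: "0 < \<delta>0" "\<And>z. dist z 0 < \<delta>0 \<Longrightarrow> (z \<noteq> 0 \<longrightarrow> Ci (Ln (1 + z)) = 1 / \<psi> z) \<and> \<phi> (\<psi> z) = z \<and> z \<in> \<phi> ` ball 0 \<rho> \<and>
     cmod (deriv \<psi> z - 1) < 1 / 8 \<and> ereal (cmod (\<psi> z)) < fps_conv_radius U \<and>
     (\<psi> z \<noteq> 0 \<longrightarrow> eval_fps U (\<psi> z) = 1 - of_real (1 - a) * \<psi> z - of_real (1 - a) * (\<psi> z / \<phi> (\<psi> z)))"
    unfolding eventually_nhds_metric by blast
  \<comment> \<open>A radius of at most 1 keeps \<open>1 + z\<close> away from 0.\<close>
  define \<delta> where "\<delta> = min \<delta>0 1"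
  have \<delta>_bounds: "0 < \<delta>" "\<delta> \<le> 1" using \<delta>0(1) by (auto simp: \<delta>_def)
  have P: "(z \<noteq> 0 \<longrightarrow> Ci (Ln (1 + z)) = 1 / \<psi> z)" "\<phi> (\<psi> z) = z" "z \<in> \<phi> ` ball 0 \<rho>"
     "cmod (deriv \<psi> z - 1) < 1 / 8" "ereal (cmod (\<psi> z)) < fps_conv_radius U"
     "\<psi> z \<noteq> 0 \<Longrightarrow> eval_fps U (\<psi> z) = 1 - of_real (1 - a) * \<psi> z - of_real (1 - a) * (\<psi> z / z)" if "z \<in> ball 0 \<delta>" for z
    using \<delta>0(2)[of z] that by (auto simp: \<delta>_def dist_commute)
  interpret local_coord \<psi> \<delta> "fps_conv_radius U"
  proof
    show "\<psi> holomorphic_on ball 0 \<delta>"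
      by (rule holomorphic_on_subset[OF \<psi>(1)]) (use P(3) in blast)
  qed (use \<delta>_bounds \<psi>0 P(4,5) in \<open>auto intro: less_imp_le\<close>)
  show ?thesis
  \<comment> \<open>Half the radius, since the outer circle has radius
    \<open>2 * \<epsilon>\<close>.\<close>
  proof (intro exI[of _ "\<delta> / 2"] conjI allI impI)
    fix \<epsilon> k1 k2 assume "0 < \<epsilon> \<and> \<epsilon> < \<delta> / 2"
    then show "cov_kernel a Ci \<epsilon> k1 k2 = (\<Sum>j=1..k1. of_nat j * fps_nth (U ^ k1) (k1 - j) * fps_nth (U ^ k2) (k2 + j))"
      using P(1) P(6) g_nz \<delta>_bounds(2) a by (intro cov_kernel_coord) auto
  qed (use \<delta>_bounds in simp)
qed

subsection \<open>Uniqueness of Schur expansions\<close>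

definition root_unity :: "nat \<Rightarrow> nat \<Rightarrow> complex" where
  "root_unity L e = cis (2 * pi * real e / real L)"

lemma root_unity_average:
  assumes "0 < L"
  shows "(\<Sum>e<L. root_unity L e powi d) / of_nat L = (if int L dvd d then 1 else 0)"
proof -
  define y where "y = cis (2 * pi * real_of_int d / real L)"
  have pw: "root_unity L e powi d = y ^ e" for e
  proof -
    have "root_unity L e powi d = cis (real_of_int d * (2 * pi * real e / real L))"
      unfolding root_unity_def by (rule cis_power_int)
    also have "\<dots> = cis (real e * (2 * pi * real_of_int d / real L))" by (simp add: mult_ac)
    also have "\<dots> = y ^ e" unfolding y_def by (rule Complex.DeMoivre[symmetric])
    finally show ?thesis .
  qed
  have yL: "y ^ L = 1"
  proof -
    have "y ^ L = cis (2 * pi * real_of_int d)" unfolding y_def Complex.DeMoivre using assms by simp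
    then show ?thesis by (simp only: cis_multiple_2pi[OF Ints_of_int])
  qed
  have y1: "y = 1 \<longleftrightarrow> int L dvd d"
  proof
    assume "int L dvd d"
    then obtain k where "d = int L * k" by auto
    then have "2 * pi * real_of_int d / real L = 2 * pi * real_of_int k" using assms by simp
    then have "y = cis (2 * pi * real_of_int k)" by (simp only: y_def)
    then show "y = 1" by (simp only: cis_multiple_2pi[OF Ints_of_int])
  next
    assume "y = 1"
    then have "exp (\<i> * of_real (2 * pi * real_of_int d / real L)) = 1" by (simp add: y_def cis_conv_exp)
    then obtain n :: int where "2 * pi * real_of_int d / real L = real_of_int (2 * n) * pi"
      by (auto simp: exp_eq_1)
    then have "real_of_int d = real_of_int n * real L" using assms by (simp add: field_simps)
    then have "d = n * int L" by (metis of_int_eq_iff of_int_mult of_int_of_nat_eq)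
    then show "int L dvd d" by simp
  qed
  show ?thesis
  proof (cases "y = 1")
    case True
    then show ?thesis using y1 assms by (simp add: pw)
  next
    case False
    then have "(\<Sum>e<L. y ^ e) = 0" using yL by (simp add: geometric_sum)
    then show ?thesis using False y1 by (simp add: pw)
  qed
qed

text \<open>A discrete Fourier coefficient, extracting the weight \<open>\<nu>\<close> modulo
  \<open>L\<close> in the first \<open>n\<close> variables. Unlike an integral over the torus, a
  finite average commutes with the infinite sum over signatures by linearity alone.\<close>

fun torus_avg :: "nat \<Rightarrow> nat \<Rightarrow> (nat \<Rightarrow> int) \<Rightarrow> ((nat \<Rightarrow> complex) \<Rightarrow> complex) \<Rightarrow> (nat \<Rightarrow> complex) \<Rightarrow> complex" where
  "torus_avg L 0 \<nu> f x = f x"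
| "torus_avg L (Suc n) \<nu> f x = (\<Sum>e<L. root_unity L e powi (- \<nu> (Suc n)) * torus_avg L n \<nu> f (x(Suc n := root_unity L e))) / of_nat L"

lemma torus_avg_sum: "torus_avg L n \<nu> (\<lambda>y. \<Sum>i\<in>I. f i y) x = (\<Sum>i\<in>I. torus_avg L n \<nu> (f i) x)"
proof (induction n arbitrary: x)
  case (Suc n)
  show ?case
    unfolding torus_avg.simps Suc.IH sum_distrib_left
    by (subst sum.swap) (simp add: sum_divide_distrib)
qed simp

lemma torus_avg_coeff: "torus_avg L n \<nu> (\<lambda>y. c (y (Suc n)) * f y) x = c (x (Suc n)) * torus_avg L n \<nu> f x"
proof -
  \<comment> \<open>The distinguished variable has to stay fixed while the induction lowers
    \<open>n\<close>, so its index is decoupled from \<open>n\<close>.\<close>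
  have "n \<le> k \<Longrightarrow> torus_avg L n \<nu> (\<lambda>y. c (y (Suc k)) * f y) x = c (x (Suc k)) * torus_avg L n \<nu> f x" for k
  proof (induction n arbitrary: x)
    case (Suc n)
    then show ?case by (simp add: sum_distrib_left sum_divide_distrib mult_ac)
  qed simp
  then show ?thesis by simp
qed

lemma torus_avg_const: "torus_avg L n \<nu> (\<lambda>y. c * f y) x = c * torus_avg L n \<nu> f x"
  by (rule torus_avg_coeff[where c="\<lambda>_. c"])

lemma torus_avg_has_sum:
  assumes "\<And>y. (\<And>i. 1 \<le> i \<Longrightarrow> i \<le> n \<Longrightarrow> cmod (y i) = 1) \<Longrightarrow> ((\<lambda>\<mu>. f \<mu> y) has_sum P y) A"
    and "\<And>i. n < i \<Longrightarrow> cmod (x i) = 1"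
  shows "((\<lambda>\<mu>. torus_avg L n \<nu> (f \<mu>) x) has_sum torus_avg L n \<nu> P x) A"
proof -
  have fin: "((\<lambda>\<mu>. \<Sum>e\<in>E. h e \<mu>) has_sum (\<Sum>e\<in>E. s e)) A" if "finite E" "\<And>e. e \<in> E \<Longrightarrow> (h e has_sum s e) A"
    for E and h :: "nat \<Rightarrow> 'a \<Rightarrow> complex" and s
    using that by (induction E rule: finite_induct) (auto intro!: has_sum_add has_sum_0)
  have gen: "k \<le> n \<Longrightarrow> (\<And>i. k < i \<Longrightarrow> i \<le> n \<Longrightarrow> cmod (x i) = 1) \<Longrightarrow> ((\<lambda>\<mu>. torus_avg L k \<nu> (f \<mu>) x) has_sum torus_avg L k \<nu> P x) A" for k x
  proof (induction k arbitrary: x)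
    case 0
    then show ?case using assms(1)[of x] by simp
  next
    case (Suc k)
    have "((\<lambda>\<mu>. (\<Sum>e<L. root_unity L e powi (- \<nu> (Suc k)) * torus_avg L k \<nu> (f \<mu>) (x(Suc k := root_unity L e))) * inverse (of_nat L)) has_sum
       ((\<Sum>e<L. root_unity L e powi (- \<nu> (Suc k)) * torus_avg L k \<nu> P (x(Suc k := root_unity L e))) * inverse (of_nat L))) A"
    proof (intro has_sum_cmult_left fin has_sum_cmult_right Suc.IH)
      fix e i assume "k < i" "i \<le> n"
      then show "cmod ((x(Suc k := root_unity L e)) i) = 1" using Suc.prems(2)[of i] by (auto simp: root_unity_def)
    qed (use Suc.prems in auto)
    then show ?case by (simp add: divide_inverse)
  qed
  show ?thesis by (rule gen[OF order_refl]) auto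
qed

text \<open>The number of Gelfand-Tsetlin patterns with top row \<open>\<mu>\<close> whose weight
  agrees with \<open>\<nu>\<close> modulo \<open>L\<close> in each entry.\<close>

fun weight_count :: "nat \<Rightarrow> nat \<Rightarrow> (nat \<Rightarrow> int) \<Rightarrow> (nat \<Rightarrow> int) \<Rightarrow> real" where
  "weight_count L 0 \<mu> \<nu> = 1"
| "weight_count L (Suc n) \<mu> \<nu> = (\<Sum>\<kappa>\<in>below n \<mu>. if int L dvd (sig_size (Suc n) \<mu> - sig_size n \<kappa> - \<nu> (Suc n)) then weight_count L n \<kappa> \<nu> else 0)"

lemma root_unity_nz: "root_unity L e \<noteq> 0" by (simp add: root_unity_def)

lemma torus_avg_schur:
  assumes "0 < L"
  shows "torus_avg L n \<nu> (schur n \<mu>) x = of_real (weight_count L n \<mu> \<nu>)"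
proof (induction n arbitrary: \<mu> x)
  case (Suc n)
  have "torus_avg L n \<nu> (schur (Suc n) \<mu>) x = (\<Sum>\<kappa>\<in>below n \<mu>. x (Suc n) powi (sig_size (Suc n) \<mu> - sig_size n \<kappa>) * of_real (weight_count L n \<kappa> \<nu>))" for x
  proof -
    have "schur (Suc n) \<mu> = (\<lambda>y. \<Sum>\<kappa>\<in>below n \<mu>. y (Suc n) powi (sig_size (Suc n) \<mu> - sig_size n \<kappa>) * schur n \<kappa> y)"
      by (auto simp: fun_eq_iff)
    then show ?thesis
      by (simp only: torus_avg_sum torus_avg_coeff[where c="\<lambda>z. z powi _"] Suc.IH)
  qed
  then have "torus_avg L (Suc n) \<nu> (schur (Suc n) \<mu>) x =
     (\<Sum>e<L. root_unity L e powi (- \<nu> (Suc n)) * (\<Sum>\<kappa>\<in>below n \<mu>. root_unity L e powi (sig_size (Suc n) \<mu> - sig_size n \<kappa>) * of_real (weight_count L n \<kappa> \<nu>))) / of_nat L"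
    by simp
  also have "\<dots> = (\<Sum>\<kappa>\<in>below n \<mu>. (\<Sum>e<L. root_unity L e powi (sig_size (Suc n) \<mu> - sig_size n \<kappa> - \<nu> (Suc n))) / of_nat L * of_real (weight_count L n \<kappa> \<nu>))"
  proof -
    have p: "root_unity L e powi (- b) * (root_unity L e powi a * c) = root_unity L e powi (a - b) * c" for e a b c
      using root_unity_nz[of L e] by (simp add: power_int_diff power_int_minus divide_inverse)
    show ?thesis
      unfolding sum_distrib_left p
      by (subst sum.swap) (simp add: sum_divide_distrib sum_distrib_right)
  qed
  also have "\<dots> = of_real (weight_count L (Suc n) \<mu> \<nu>)"
    unfolding root_unity_average[OF assms] by (simp, intro sum.cong) auto
  finally show ?case .
qed simp

lemma weight_count_nonneg: "0 \<le> weight_count L n \<mu> \<nu>"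
  by (induction n arbitrary: \<mu>) (auto intro!: sum_nonneg)

lemma weight_count_cong: "(\<And>i. 1 \<le> i \<Longrightarrow> i \<le> n \<Longrightarrow> \<nu> i = \<nu>' i) \<Longrightarrow> weight_count L n \<mu> \<nu> = weight_count L n \<mu> \<nu>'"
proof (induction n arbitrary: \<mu>)
  case (Suc n)
  then have "weight_count L n \<kappa> \<nu> = weight_count L n \<kappa> \<nu>'" for \<kappa> by auto
  then show ?case using Suc.prems[of "Suc n"] by (simp cong: sum.cong if_cong)
qed simp

text \<open>Truncating \<open>\<mu>\<close> row by row gives a pattern whose weight is
  \<open>\<mu>\<close> itself, the highest weight.\<close>

lemma weight_count_diag: "\<mu> \<in> GT n \<Longrightarrow> 1 \<le> weight_count L n \<mu> \<mu>"
proof (induction n arbitrary: \<mu>)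
  case (Suc n)
  define \<kappa> where "\<kappa> = (\<lambda>i. if i \<le> n then \<mu> i else 0)"
  have \<kappa>: "\<kappa> \<in> GT n" "interlace n \<kappa> \<mu>"
    using Suc.prems by (auto simp: \<kappa>_def GT_def interlace_def)
  have sz: "sig_size (Suc n) \<mu> - sig_size n \<kappa> - \<mu> (Suc n) = 0"
    by (simp add: sig_size_def \<kappa>_def)
  have "1 \<le> weight_count L n \<kappa> \<kappa>" using Suc.IH \<kappa> by blast
  also have "weight_count L n \<kappa> \<kappa> = weight_count L n \<kappa> \<mu>" by (rule weight_count_cong) (simp add: \<kappa>_def)
  also have "\<dots> = (if int L dvd (sig_size (Suc n) \<mu> - sig_size n \<kappa> - \<mu> (Suc n)) then weight_count L n \<kappa> \<mu> else 0)"
    unfolding sz by simp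
  also have "\<dots> \<le> weight_count L (Suc n) \<mu> \<mu>"
    unfolding weight_count.simps by (rule member_le_sum) (use \<kappa> finite_below[OF Suc.prems] weight_count_nonneg in auto)
  finally show ?case .
qed simp

definition gt_box :: "nat \<Rightarrow> int \<Rightarrow> (nat \<Rightarrow> int) set" where
  "gt_box n b = {\<mu> \<in> GT n. \<forall>i. 1 \<le> i \<and> i \<le> n \<longrightarrow> \<bar>\<mu> i\<bar> \<le> b}"

lemma below_box: "\<kappa> \<in> below n \<mu> \<Longrightarrow> \<mu> \<in> gt_box (Suc n) b \<Longrightarrow> \<kappa> \<in> gt_box n b"
  unfolding gt_box_def interlace_def
proof (safe)
  fix i assume "\<kappa> \<in> GT n" "\<forall>i. 1 \<le> i \<and> i \<le> n \<longrightarrow> \<mu> (i + 1) \<le> \<kappa> i \<and> \<kappa> i \<le> \<mu> i" "\<mu> \<in> GT (Suc n)"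
    "\<forall>i. 1 \<le> i \<and> i \<le> Suc n \<longrightarrow> \<bar>\<mu> i\<bar> \<le> b" "1 \<le> i" "i \<le> n"
  then have "\<mu> (i + 1) \<le> \<kappa> i" "\<kappa> i \<le> \<mu> i" "\<bar>\<mu> i\<bar> \<le> b" "\<bar>\<mu> (i + 1)\<bar> \<le> b" by auto
  then show "\<bar>\<kappa> i\<bar> \<le> b" by linarith
qed

lemma sig_size_box: "\<mu> \<in> gt_box n b \<Longrightarrow> \<bar>sig_size n \<mu>\<bar> \<le> int n * b"
proof -
  assume "\<mu> \<in> gt_box n b"
  then have "(\<Sum>i=1..n. \<bar>\<mu> i\<bar>) \<le> (\<Sum>i=1..n. b)" by (intro sum_mono) (auto simp: gt_box_def)
  then show ?thesis unfolding sig_size_def by (intro order_trans[OF sum_abs]) simp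
qed

text \<open>A nonzero count comes from a genuine weight \<open>w\<close>. Its entries are
  differences of two row sums, whence the factor \<open>2 * int n\<close>, and interlacing keeps its
  partial sums below those of the top row.\<close>

lemma weight_count_nonzero_weights:
  assumes "weight_count L n \<mu> \<nu> \<noteq> 0" "\<mu> \<in> gt_box n b"
  shows "\<exists>w. (\<forall>i. 1 \<le> i \<and> i \<le> n \<longrightarrow> \<bar>w i\<bar> \<le> (2 * int n) * b \<and> int L dvd (w i - \<nu> i)) \<and>
     (\<forall>j\<le>n. (\<Sum>i=1..j. w i) \<le> (\<Sum>i=1..j. \<mu> i))"
  using assms
proof (induction n arbitrary: \<mu>)
  case (Suc n)
  have b: "0 \<le> b" using Suc.prems(2) by (auto simp: gt_box_def dest!: spec[of _ "Suc n"])
  obtain \<kappa> where \<kappa>: "\<kappa> \<in> below n \<mu>" "int L dvd (sig_size (Suc n) \<mu> - sig_size n \<kappa> - \<nu> (Suc n))" "weight_count L n \<kappa> \<nu> \<noteq> 0"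
  proof -
    have "\<exists>\<kappa>\<in>below n \<mu>. (if int L dvd (sig_size (Suc n) \<mu> - sig_size n \<kappa> - \<nu> (Suc n)) then weight_count L n \<kappa> \<nu> else 0) \<noteq> 0"
    proof (rule ccontr)
      assume "\<not> ?thesis"
      then have "weight_count L (Suc n) \<mu> \<nu> = 0" unfolding weight_count.simps by (intro sum.neutral) blast
      then show False using Suc.prems(1) by simp
    qed
    then show ?thesis using that by (auto split: if_splits)
  qed
  have box: "\<kappa> \<in> gt_box n b" by (rule below_box[OF \<kappa>(1) Suc.prems(2)])
  obtain w where w: "\<And>i. 1 \<le> i \<Longrightarrow> i \<le> n \<Longrightarrow> \<bar>w i\<bar> \<le> (2 * int n) * b \<and> int L dvd (w i - \<nu> i)"
    "\<And>j. j \<le> n \<Longrightarrow> (\<Sum>i=1..j. w i) \<le> (\<Sum>i=1..j. \<kappa> i)"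
    using Suc.IH[OF \<kappa>(3) box] by blast
  define c where "c = sig_size (Suc n) \<mu> - sig_size n \<kappa>"
  define w' where "w' = (\<lambda>i. if i = Suc n then c else w i)"
  have w'c: "w' (Suc n) = c" by (simp add: w'_def)
  have le: "(2 * int n) * b \<le> 2 * int (Suc n) * b" using b by (simp add: algebra_simps)
  have cb: "\<bar>c\<bar> \<le> (2 * int (Suc n)) * b"
  proof -
    have "\<bar>sig_size (Suc n) \<mu>\<bar> \<le> int (Suc n) * b" "\<bar>sig_size n \<kappa>\<bar> \<le> int n * b"
      using sig_size_box[OF Suc.prems(2)] sig_size_box[OF box] by auto
    moreover have "int (Suc n) * b + int n * b \<le> 2 * int (Suc n) * b" using b by (simp add: algebra_simps)
    ultimately show ?thesis unfolding c_def by linarith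
  qed
  have \<kappa>\<mu>: "(\<Sum>i=1..j. \<kappa> i) \<le> (\<Sum>i=1..j. \<mu> i)" if "j \<le> n" for j
    using \<kappa>(1) that by (intro sum_mono) (auto simp: interlace_def)
  show ?case
  proof (intro exI[of _ w'] conjI allI impI)
    fix i assume i: "1 \<le> i \<and> i \<le> Suc n"
    show "\<bar>w' i\<bar> \<le> (2 * int (Suc n)) * b"
      using w(1)[of i] i w'c cb le by (cases "i = Suc n") (auto simp: w'_def)
    show "int L dvd (w' i - \<nu> i)"
      using w(1)[of i] i w'c \<kappa>(2) by (cases "i = Suc n") (auto simp: w'_def c_def)
  next
    fix j assume j: "j \<le> Suc n"
    have eqw: "(\<Sum>i=1..k. w' i) = (\<Sum>i=1..k. w i)" if "k \<le> n" for k
      using that by (intro sum.cong) (auto simp: w'_def)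
    show "(\<Sum>i=1..j. w' i) \<le> (\<Sum>i=1..j. \<mu> i)"
    proof (cases "j = Suc n")
      case True
      have "(\<Sum>i=1..Suc n. w' i) = (\<Sum>i=1..n. w i) + c" using eqw[of n] w'c by simp
      also have "\<dots> \<le> sig_size n \<kappa> + c" using w(2)[of n] by (simp add: sig_size_def)
      also have "\<dots> = (\<Sum>i=1..Suc n. \<mu> i)" by (simp add: c_def sig_size_def)
      finally show ?thesis using True by simp
    next
      case False
      then show ?thesis using j eqw[of j] w(2)[of j] \<kappa>\<mu>[of j] by simp
    qed
  qed
qed simp

lemma finite_gt_box: "finite (gt_box n b)"
proof (rule finite_subset)
  show "gt_box n b \<subseteq> (\<lambda>f i. if 1 \<le> i \<and> i \<le> n then f i else 0) ` (PiE {1..n} (\<lambda>_. {-b..b}))"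
  proof
    fix \<mu> assume \<mu>: "\<mu> \<in> gt_box n b"
    show "\<mu> \<in> (\<lambda>f i. if 1 \<le> i \<and> i \<le> n then f i else 0) ` (PiE {1..n} (\<lambda>_. {-b..b}))"
    proof (rule image_eqI)
      show "\<mu> = (\<lambda>i. if 1 \<le> i \<and> i \<le> n then restrict \<mu> {1..n} i else 0)"
        using \<mu> by (auto simp: gt_box_def GT_def fun_eq_iff not_le Suc_le_eq)
      show "restrict \<mu> {1..n} \<in> (PiE {1..n} (\<lambda>_. {-b..b}))"
        using \<mu> by (force simp: gt_box_def abs_le_iff)
    qed
  qed
qed (auto intro!: finite_imageI finite_PiE)

text \<open>Averaging against a monomial over roots of unity gives identities between nonnegative weight multiplicities.
  Since \<open>c \<ge> 0\<close>, a weight far outside those of \<open>F\<close> forces \<open>c = 0\<close> there; on the remaining finite set the dominance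
  order makes the system triangular.\<close>
lemma schur_expansion_unique:
  fixes c d :: "(nat \<Rightarrow> int) \<Rightarrow> real"
  assumes c: "\<And>\<mu>. \<mu> \<in> GT n \<Longrightarrow> 0 \<le> c \<mu>" and F: "finite F" "F \<subseteq> GT n" and d: "\<And>\<mu>. \<mu> \<notin> F \<Longrightarrow> d \<mu> = 0"
    and eq: "\<And>x. (\<And>i. 1 \<le> i \<Longrightarrow> i \<le> n \<Longrightarrow> cmod (x i) = 1) \<Longrightarrow>
       ((\<lambda>\<mu>. of_real (c \<mu>) * schur n \<mu> x) has_sum (\<Sum>\<mu>\<in>F. of_real (d \<mu>) * schur n \<mu> x)) (GT n)"
  shows "\<mu> \<in> GT n \<Longrightarrow> c \<mu> = d \<mu>"
proof -
  have S: "((\<lambda>\<mu>. c \<mu> * weight_count L n \<mu> \<nu>) has_sum (\<Sum>\<mu>\<in>F. d \<mu> * weight_count L n \<mu> \<nu>)) (GT n)" if L: "0 < L" for L \<nu>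
  proof -
    have "((\<lambda>\<mu>. torus_avg L n \<nu> (\<lambda>x. of_real (c \<mu>) * schur n \<mu> x) (\<lambda>_. 1)) has_sum
        torus_avg L n \<nu> (\<lambda>x. \<Sum>\<mu>\<in>F. of_real (d \<mu>) * schur n \<mu> x) (\<lambda>_. 1)) (GT n)"
      by (rule torus_avg_has_sum[OF eq]) auto
    then have "((\<lambda>\<mu>. complex_of_real (c \<mu> * weight_count L n \<mu> \<nu>)) has_sum complex_of_real (\<Sum>\<mu>\<in>F. d \<mu> * weight_count L n \<mu> \<nu>)) (GT n)"
      by (simp add: torus_avg_sum torus_avg_const torus_avg_schur[OF L])
    from has_sum_Re[OF this] show ?thesis by simp
  qed
  define b where "b = (\<Sum>\<mu>\<in>F. \<Sum>i=1..n. \<bar>\<mu> i\<bar>)"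
  have Fb: "F \<subseteq> gt_box n b"
  proof
    fix \<mu> assume \<mu>: "\<mu> \<in> F"
    have "\<bar>\<mu> i\<bar> \<le> b" if "1 \<le> i \<and> i \<le> n" for i
    proof -
      have "\<bar>\<mu> i\<bar> \<le> (\<Sum>i=1..n. \<bar>\<mu> i\<bar>)" using that by (intro member_le_sum) auto
      also have "\<dots> \<le> b" unfolding b_def using \<mu> F by (intro member_le_sum) (auto intro: sum_nonneg)
      finally show ?thesis .
    qed
    then show "\<mu> \<in> gt_box n b" using \<mu> F by (auto simp: gt_box_def)
  qed
  have b0: "0 \<le> b" unfolding b_def by (intro sum_nonneg) auto
  define b' where "b' = (2 * int n + 1) * b"
  have b': "b \<le> b'" "2 * int n * b \<le> b'" "0 \<le> b'"
    using b0 by (auto simp: b'_def algebra_simps)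
  define T where "T = gt_box n b'"
  have T: "finite T" "T \<subseteq> GT n" "F \<subseteq> T"
    unfolding T_def using Fb b' by (auto simp: finite_gt_box) (auto simp: gt_box_def intro: order_trans)
  have cT: "c \<nu> = 0" if \<nu>: "\<nu> \<in> GT n" "\<nu> \<notin> T" for \<nu>
  proof -
    obtain i where i: "1 \<le> i" "i \<le> n" "b' < \<bar>\<nu> i\<bar>" using \<nu> by (auto simp: T_def gt_box_def not_le)
    \<comment> \<open>With this modulus no weight of a member of \<open>F\<close> is congruent to
      \<open>\<nu>\<close>: the difference at \<open>i\<close> is nonzero and smaller than
      \<open>L\<close>.\<close>
    define L where "L = nat (b' + \<bar>\<nu> i\<bar> + 1)"
    have L: "0 < L" "int L = b' + \<bar>\<nu> i\<bar> + 1" using b' by (auto simp: L_def)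
    have "weight_count L n \<mu> \<nu> = 0" if "\<mu> \<in> F" for \<mu>
    proof (rule ccontr)
      assume "weight_count L n \<mu> \<nu> \<noteq> 0"
      from weight_count_nonzero_weights[OF this] that Fb obtain w where w: "\<bar>w i\<bar> \<le> 2 * int n * b" "int L dvd (w i - \<nu> i)"
        using i by blast
      have "\<bar>w i - \<nu> i\<bar> < int L" "w i - \<nu> i \<noteq> 0" using w(1) b' i(3) L(2) by linarith+
      then show False using w(2) zdvd_imp_le[of "int L" "\<bar>w i - \<nu> i\<bar>"] by auto
    qed
    then have "(\<Sum>\<mu>\<in>F. d \<mu> * weight_count L n \<mu> \<nu>) = 0" by simp
    then have "c \<nu> * weight_count L n \<nu> \<nu> = 0"
      using S[OF L(1), of \<nu>] c \<nu>(1) weight_count_nonneg by (intro nonneg_has_sum_le_0D[where A="GT n"]) auto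
    then show "c \<nu> = 0" using weight_count_diag[OF \<nu>(1), of L] by auto
  qed
  define e where "e \<mu> = c \<mu> - d \<mu>" for \<mu>
  have eT: "(\<Sum>\<mu>\<in>T. e \<mu> * weight_count L n \<mu> \<nu>) = 0" if "0 < L" for L \<nu>
  proof -
    have "((\<lambda>\<mu>. c \<mu> * weight_count L n \<mu> \<nu>) has_sum (\<Sum>\<mu>\<in>F. d \<mu> * weight_count L n \<mu> \<nu>)) T"
      using S[OF that, of \<nu>] by (rule has_sum_cong_neutral[THEN iffD1, rotated -1]) (use T cT in auto)
    then have "(\<Sum>\<mu>\<in>T. c \<mu> * weight_count L n \<mu> \<nu>) = (\<Sum>\<mu>\<in>F. d \<mu> * weight_count L n \<mu> \<nu>)"
      by (rule has_sum_unique[OF has_sum_finite[OF T(1)]])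
    also have "\<dots> = (\<Sum>\<mu>\<in>T. d \<mu> * weight_count L n \<mu> \<nu>)"
      by (rule sum.mono_neutral_left) (use T d in auto)
    finally show ?thesis by (simp add: e_def left_diff_distrib sum_subtractf)
  qed
  have "e \<mu> = 0" if "\<mu> \<in> T" for \<mu>
  proof (rule ccontr)
    assume "e \<mu> \<noteq> 0"
    define W where "W = {\<mu> \<in> T. e \<mu> \<noteq> 0}"
    \<comment> \<open>The sum of all partial sums is strictly monotone for the dominance order, so a
      maximiser is a maximal element.\<close>
    define \<Omega> where "\<Omega> \<mu> = (\<Sum>j\<le>n. \<Sum>i=1..j. \<mu> i)" for \<mu> :: "nat \<Rightarrow> int"
    have fin: "finite (\<Omega> ` W)" and ne: "\<Omega> ` W \<noteq> {}" using T \<open>e \<mu> \<noteq> 0\<close> that by (auto simp: W_def)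
    obtain \<mu>0 where \<mu>0W: "\<mu>0 \<in> W" "Max (\<Omega> ` W) = \<Omega> \<mu>0" using Max_in[OF fin ne] by blast
    have \<mu>0: "\<mu>0 \<in> W" "\<And>\<mu>. \<mu> \<in> W \<Longrightarrow> \<Omega> \<mu> \<le> \<Omega> \<mu>0"
      using \<mu>0W Max_ge[OF fin] by auto
    \<comment> \<open>For entries of the sizes occurring here, congruence modulo this
      \<open>L\<close> is equality.\<close>
    define L where "L = nat (2 * int n * b' + b' + 1)"
    have L: "0 < L" "int L = 2 * int n * b' + b' + 1" using b' by (auto simp: L_def nat_eq_iff add_nonneg_pos)
    have \<mu>0T: "\<mu>0 \<in> gt_box n b'" using \<mu>0 by (simp add: W_def T_def)
    have "weight_count L n \<mu> \<mu>0 = 0" if \<mu>: "\<mu> \<in> W" "\<mu> \<noteq> \<mu>0" for \<mu>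
    proof (rule ccontr)
      assume nz: "weight_count L n \<mu> \<mu>0 \<noteq> 0"
      have \<mu>T: "\<mu> \<in> gt_box n b'" using \<mu> by (simp add: W_def T_def)
      obtain w where w: "\<And>i. 1 \<le> i \<Longrightarrow> i \<le> n \<Longrightarrow> \<bar>w i\<bar> \<le> 2 * int n * b' \<and> int L dvd (w i - \<mu>0 i)"
        "\<And>j. j \<le> n \<Longrightarrow> (\<Sum>i=1..j. w i) \<le> (\<Sum>i=1..j. \<mu> i)"
        using weight_count_nonzero_weights[OF nz \<mu>T] by blast
      have wi: "w i = \<mu>0 i" if i: "1 \<le> i" "i \<le> n" for i
      proof (rule ccontr)
        assume "w i \<noteq> \<mu>0 i"
        moreover have "\<bar>w i - \<mu>0 i\<bar> < int L" using w(1)[OF i] \<mu>0T i L(2) by (auto simp: gt_box_def dest!: spec[of _ i])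
        ultimately show False using w(1)[OF i] zdvd_imp_le[of "int L" "\<bar>w i - \<mu>0 i\<bar>"] by auto
      qed
      have le: "(\<Sum>i=1..j. \<mu>0 i) \<le> (\<Sum>i=1..j. \<mu> i)" if "j \<le> n" for j
      proof -
        have "(\<Sum>i=1..j. \<mu>0 i) = (\<Sum>i=1..j. w i)" using that wi by (intro sum.cong) auto
        then show ?thesis using w(2)[OF that] by simp
      qed
      have "\<Omega> \<mu> = \<Omega> \<mu>0"
        using \<mu>0(2)[OF \<mu>(1)] sum_mono[of "{..n}" "\<lambda>j. \<Sum>i=1..j. \<mu>0 i" "\<lambda>j. \<Sum>i=1..j. \<mu> i"] le by (auto simp: \<Omega>_def intro: antisym)
      then have part: "(\<Sum>i=1..j. \<mu> i) = (\<Sum>i=1..j. \<mu>0 i)" if "j \<le> n" for j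
        using sum_mono_inv[of "\<lambda>j. \<Sum>i=1..j. \<mu>0 i" "{..n}" "\<lambda>j. \<Sum>i=1..j. \<mu> i" j] le that by (simp add: \<Omega>_def)
      have "\<mu> i = \<mu>0 i" for i
      proof (cases "1 \<le> i \<and> i \<le> n")
        case True
        then obtain k where "i = Suc k" by (cases i) auto
        then show ?thesis using part[of i] part[of k] True by simp
      next
        case False
        then show ?thesis using \<mu>T \<mu>0T by (auto simp: gt_box_def GT_def not_le Suc_le_eq)
      qed
      then show False using \<mu>(2) by blast
    qed
    then have "(\<Sum>\<mu>\<in>T. e \<mu> * weight_count L n \<mu> \<mu>0) = (\<Sum>\<mu>\<in>{\<mu>0}. e \<mu> * weight_count L n \<mu> \<mu>0)"
      using \<mu>0 T by (intro sum.mono_neutral_right) (auto simp: W_def)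
    then have "e \<mu>0 * weight_count L n \<mu>0 \<mu>0 = 0" using eT[OF L(1), of \<mu>0] by simp
    moreover have "\<mu>0 \<in> GT n" using \<mu>0T by (simp add: gt_box_def)
    ultimately show False using \<mu>0(1) weight_count_diag[of \<mu>0 n L] by (auto simp: W_def)
  qed
  moreover assume "\<mu> \<in> GT n"
  ultimately show "c \<mu> = d \<mu>"
    using cT[of \<mu>] d[of \<mu>] T by (cases "\<mu> \<in> T") (auto simp: e_def)
qed

text \<open>The weights, which count truncated patterns, do not depend on \<open>g\<close>. So they
  can be determined from Schur functions and then used for arbitrary observables.\<close>

lemma down_representation:
  assumes "l \<in> GT (n + r)"
  shows "\<exists>F w. finite F \<and> F \<subseteq> GT n \<and> (\<forall>\<mu>. \<mu> \<notin> F \<longrightarrow> w \<mu> = 0) \<and> (\<forall>\<mu>. 0 \<le> w \<mu>) \<and> (\<forall>g. down n r g l = (\<Sum>\<mu>\<in>F. complex_of_real (w \<mu>) * g \<mu>))"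
  using assms
proof (induction r arbitrary: l)
  case 0
  then show ?case by (intro exI[of _ "{l}"] exI[of _ "\<lambda>\<mu>. if \<mu> = l then 1 else 0"]) auto
next
  case (Suc r)
  let ?P = "\<lambda>\<kappa> F w. finite F \<and> F \<subseteq> GT n \<and> (\<forall>\<mu>. \<mu> \<notin> F \<longrightarrow> w \<mu> = 0) \<and> (\<forall>\<mu>. 0 \<le> w \<mu>) \<and> (\<forall>g. down n r g \<kappa> = (\<Sum>\<mu>\<in>F. complex_of_real (w \<mu>) * g \<mu>))"
  have "\<exists>p. ?P \<kappa> (fst p) (snd p)" if "\<kappa> \<in> below (n + r) l" for \<kappa>
  proof -
    have "\<kappa> \<in> GT (n + r)" using that by simp
    from Suc.IH[OF this] obtain F w where "?P \<kappa> F w" by blast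
    then have "?P \<kappa> (fst (F, w)) (snd (F, w))" unfolding fst_conv snd_conv .
    then show ?thesis by (rule exI)
  qed
  then have "\<exists>f. \<forall>\<kappa>\<in>below (n + r) l. ?P \<kappa> (fst (f \<kappa>)) (snd (f \<kappa>))"
    by (intro bchoice ballI)
  then obtain f where f: "\<forall>\<kappa>\<in>below (n + r) l. ?P \<kappa> (fst (f \<kappa>)) (snd (f \<kappa>))" ..
  define F where "F \<kappa> = fst (f \<kappa>)" for \<kappa>
  define w where "w \<kappa> = snd (f \<kappa>)" for \<kappa>
  have Fw: "?P \<kappa> (F \<kappa>) (w \<kappa>)" if "\<kappa> \<in> below (n + r) l" for \<kappa>
    unfolding F_def w_def by (rule bspec[OF f that])
  let ?B = "below (n + r) l"
  have fin: "finite ?B" using finite_below[of l "n + r"] Suc.prems by simp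
  let ?F = "\<Union>\<kappa>\<in>?B. F \<kappa>" and ?w = "\<lambda>\<mu>. \<Sum>\<kappa>\<in>?B. w \<kappa> \<mu>"
  have F: "finite ?F" using fin Fw by blast
  have F5: "down n (Suc r) g l = (\<Sum>\<mu>\<in>?F. complex_of_real (?w \<mu>) * g \<mu>)" for g
  proof -
    have "down n (Suc r) g l = (\<Sum>\<kappa>\<in>?B. \<Sum>\<mu>\<in>?F. complex_of_real (w \<kappa> \<mu>) * g \<mu>)"
      unfolding down.simps
    proof (intro sum.cong refl)
      fix \<kappa> assume \<kappa>: "\<kappa> \<in> ?B"
      have "down n r g \<kappa> = (\<Sum>\<mu>\<in>F \<kappa>. complex_of_real (w \<kappa> \<mu>) * g \<mu>)" using Fw[OF \<kappa>] by blast
      also have "\<dots> = (\<Sum>\<mu>\<in>?F. complex_of_real (w \<kappa> \<mu>) * g \<mu>)"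
        by (rule sum.mono_neutral_left) (use F Fw[OF \<kappa>] \<kappa> in auto)
      finally show "down n r g \<kappa> = (\<Sum>\<mu>\<in>?F. complex_of_real (w \<kappa> \<mu>) * g \<mu>)" .
    qed
    also have "\<dots> = (\<Sum>\<mu>\<in>?F. complex_of_real (?w \<mu>) * g \<mu>)"
      by (subst sum.swap) (simp add: sum_distrib_right)
    finally show ?thesis .
  qed
  have F3: "?w \<mu> = 0" if "\<mu> \<notin> ?F" for \<mu>
  proof (rule sum.neutral, rule ballI)
    fix \<kappa> assume \<kappa>: "\<kappa> \<in> ?B"
    then show "w \<kappa> \<mu> = 0" using Fw[OF \<kappa>] that by blast
  qed
  have F4: "0 \<le> ?w \<mu>" for \<mu> by (rule sum_nonneg) (use Fw in blast)
  have F2: "?F \<subseteq> GT n" using Fw by blast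
  show ?case by (intro exI[of _ ?F] exI[of _ ?w] conjI allI impI F F2 F3 F4 F5)
qed

lemma below_nonempty: "l \<in> GT (Suc n) \<Longrightarrow> below n l \<noteq> {}"
proof -
  assume l: "l \<in> GT (Suc n)"
  have "(\<lambda>i. if i \<le> n then l i else 0) \<in> below n l"
    using l by (auto simp: GT_def interlace_def)
  then show ?thesis by blast
qed

lemma schur_one_pos: "l \<in> GT n \<Longrightarrow> \<exists>k>0. schur n l (\<lambda>_. 1) = of_nat k"
proof (induction n arbitrary: l)
  case 0
  then show ?case by (intro exI[of _ 1]) simp
next
  case (Suc n)
  then have "\<forall>\<mu>\<in>below n l. \<exists>k>0. schur n \<mu> (\<lambda>_. 1) = of_nat k" by blast
  then obtain k where k: "\<And>\<mu>. \<mu> \<in> below n l \<Longrightarrow> k \<mu> > 0 \<and> schur n \<mu> (\<lambda>_. 1) = of_nat (k \<mu>)" by metis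
  have "schur (Suc n) l (\<lambda>_. 1) = of_nat (\<Sum>\<mu>\<in>below n l. k \<mu>)" using k by (auto intro!: sum.cong)
  moreover have "0 < (\<Sum>\<mu>\<in>below n l. k \<mu>)"
    using k below_nonempty[OF Suc.prems] finite_below[OF Suc.prems] by (intro sum_pos) auto
  ultimately show ?case by blast
qed

text \<open>By uniqueness of the Schur expansion, \<open>rho\<close> is the number of patterns
  leading from \<open>l\<close> down to the signature, times its dimension, divided by the dimension
  of \<open>l\<close>. Every expectation is then a normalised array sum.\<close>

lemma expectation_eq_down:
  assumes l: "l \<in> GT (n + r)" and nn: "\<And>\<mu>. 0 \<le> rho \<mu>"
    and gf: "\<And>x. (\<And>i. i \<in> {1..n} \<Longrightarrow> cmod (x i) = 1) \<Longrightarrow>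
      ((\<lambda>\<mu>. complex_of_real (rho \<mu>) * schur n \<mu> x / schur n \<mu> (\<lambda>_. 1)) has_sum
        (schur (n + r) l (\<lambda>i. if i \<le> n then x i else 1) / schur (n + r) l (\<lambda>_. 1))) (GT n)"
  shows "complex_of_real (\<Sum>\<^sub>\<infinity>\<mu>\<in>GT n. rho \<mu> * h \<mu>) =
     down n r (\<lambda>\<mu>. complex_of_real (h \<mu>) * schur n \<mu> (\<lambda>_. 1)) l / schur (n + r) l (\<lambda>_. 1)"
proof -
  obtain F w where Fw: "finite F" "F \<subseteq> GT n" "\<And>\<mu>. \<mu> \<notin> F \<Longrightarrow> w \<mu> = 0" "\<And>\<mu>. 0 \<le> w \<mu>"
    "\<And>g. down n r g l = (\<Sum>\<mu>\<in>F. complex_of_real (w \<mu>) * g \<mu>)"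
    using down_representation[OF l] by metis
  obtain kl where kl: "0 < kl" "schur (n + r) l (\<lambda>_. 1) = of_nat kl" using schur_one_pos[OF l] by blast
  define k where "k \<mu> = Re (schur n \<mu> (\<lambda>_. 1))" for \<mu>
  have k: "0 < k \<mu>" "schur n \<mu> (\<lambda>_. 1) = of_real (k \<mu>)" if \<mu>: "\<mu> \<in> GT n" for \<mu>
    using schur_one_pos[OF \<mu>] by (auto simp: k_def)
  have eq: "rho \<mu> / k \<mu> = w \<mu> / real kl" if "\<mu> \<in> GT n" for \<mu>
  proof (rule schur_expansion_unique[OF _ Fw(1,2) _ _ that, of "\<lambda>\<mu>. rho \<mu> / k \<mu>" "\<lambda>\<mu>. w \<mu> / real kl"])
    fix x :: "nat \<Rightarrow> complex" assume x: "\<And>i. 1 \<le> i \<Longrightarrow> i \<le> n \<Longrightarrow> cmod (x i) = 1"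
    have "((\<lambda>\<mu>. complex_of_real (rho \<mu>) * schur n \<mu> x / schur n \<mu> (\<lambda>_. 1)) has_sum
        (schur (n + r) l (\<lambda>i. if i \<le> n then x i else 1) / schur (n + r) l (\<lambda>_. 1))) (GT n)"
      by (rule gf) (use x in auto)
    also have "schur (n + r) l (\<lambda>i. if i \<le> n then x i else 1) / schur (n + r) l (\<lambda>_. 1) =
       (\<Sum>\<mu>\<in>F. complex_of_real (w \<mu> / real kl) * schur n \<mu> x)"
      unfolding schur_down[OF l] Fw(5) kl(2) by (simp add: sum_divide_distrib)
    finally show "((\<lambda>\<mu>. complex_of_real (rho \<mu> / k \<mu>) * schur n \<mu> x) has_sum (\<Sum>\<mu>\<in>F. complex_of_real (w \<mu> / real kl) * schur n \<mu> x)) (GT n)"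
      by (rule has_sum_cong[THEN iffD1, rotated]) (simp add: k(2))
  qed (use nn k Fw(3) in \<open>auto intro!: divide_nonneg_pos\<close>)
  have rho: "rho \<mu> = w \<mu> * k \<mu> / real kl" if "\<mu> \<in> GT n" for \<mu>
    using eq[OF that] k(1)[OF that] by (simp add: field_simps)
  have "(\<Sum>\<^sub>\<infinity>\<mu>\<in>GT n. rho \<mu> * h \<mu>) = (\<Sum>\<^sub>\<infinity>\<mu>\<in>F. w \<mu> * k \<mu> / real kl * h \<mu>)"
    by (rule infsum_cong_neutral) (use Fw rho in auto)
  also have "\<dots> = (\<Sum>\<mu>\<in>F. w \<mu> * k \<mu> / real kl * h \<mu>)" using Fw(1) by simp
  finally have E: "(\<Sum>\<^sub>\<infinity>\<mu>\<in>GT n. rho \<mu> * h \<mu>) = (\<Sum>\<mu>\<in>F. w \<mu> * k \<mu> / real kl * h \<mu>)" .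
  show ?thesis
    unfolding E Fw(5) kl(2) of_real_sum sum_divide_distrib
  proof (intro sum.cong refl)
    fix \<mu> assume "\<mu> \<in> F"
    then have "schur n \<mu> (\<lambda>_. 1) = of_real (k \<mu>)" using k Fw by blast
    then show "complex_of_real (w \<mu> * k \<mu> / real kl * h \<mu>) = complex_of_real (w \<mu>) * (complex_of_real (h \<mu>) * schur n \<mu> (\<lambda>_. 1)) / complex_of_nat kl"
      by (simp add: mult_ac)
  qed
qed

subsection \<open>The limit theorem\<close>

text \<open>Local boundedness holds at every point, by continuity or, at an exceptional point, by
  the one-sided limits together with the value there. Bisection of the interval glues the local
  bounds.\<close>

lemma piecewise_continuous01_bounded:
  assumes "piecewise_continuous01 f"
  shows "\<exists>D. \<forall>x\<in>{0..1}. \<bar>f x\<bar> \<le> D"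
proof -
  from assms obtain S where S': "finite S" "continuous_on ({0..1} - S) f"
    "\<forall>s\<in>S. (0 < s \<longrightarrow> (\<exists>L. (f \<longlongrightarrow> L) (at_left s))) \<and> (s < 1 \<longrightarrow> (\<exists>L. (f \<longlongrightarrow> L) (at_right s)))"
    unfolding piecewise_continuous01_def by (elim exE conjE)
  note S = S'(1,2) S'(3)[rule_format, THEN conjunct1, rule_format] S'(3)[rule_format, THEN conjunct2, rule_format]
  have loc: "\<exists>d>0. \<exists>D. \<forall>x\<in>{0..1}. \<bar>x - s\<bar> < d \<longrightarrow> \<bar>f x\<bar> \<le> D" if s: "s \<in> {0..1}" for s
  proof (cases "s \<in> S")
    case False
    obtain d1 where d1: "0 < d1" "\<And>x. x \<in> {0..1} - S \<Longrightarrow> dist x s < d1 \<Longrightarrow> dist (f x) (f s) < 1"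
    proof -
      have "s \<in> {0..1} - S" using s False by simp
      from continuous_on_iff[THEN iffD1, OF S(2)] this
      have "\<forall>e>0. \<exists>d>0. \<forall>x'\<in>{0..1} - S. dist x' s < d \<longrightarrow> dist (f x') (f s) < e" by (rule bspec)
      then have "\<exists>d>0. \<forall>x'\<in>{0..1} - S. dist x' s < d \<longrightarrow> dist (f x') (f s) < 1" by simp
      then show ?thesis by (elim exE conjE) (rule that, auto)
    qed
    obtain d2 where d2: "0 < d2" "\<And>x. x \<in> S \<Longrightarrow> x \<noteq> s \<Longrightarrow> d2 \<le> dist s x"
      using finite_set_avoid[OF S(1), of s] by metis
    have "\<bar>f x\<bar> \<le> \<bar>f s\<bar> + 1" if x: "x \<in> {0..1}" "\<bar>x - s\<bar> < min d1 d2" for x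
    proof -
      have "x \<notin> S"
      proof
        assume "x \<in> S"
        then have "x \<noteq> s" using False by blast
        then show False using d2(2)[OF \<open>x \<in> S\<close>] x by (simp add: dist_real_def)
      qed
      then have "dist (f x) (f s) < 1" using d1(2)[of x] x by (auto simp: dist_real_def)
      then show ?thesis by (simp add: dist_real_def)
    qed
    then show ?thesis using d1(1) d2(1) by (intro exI[of _ "min d1 d2"] conjI exI[of _ "\<bar>f s\<bar> + 1"]) auto
  next
    case True
    have "\<exists>d>0. \<exists>D. \<forall>x\<in>{0..1}. s - d < x \<and> x < s \<longrightarrow> \<bar>f x\<bar> \<le> D"
    proof (cases "0 < s")
      case pos: True
      obtain L where "(f \<longlongrightarrow> L) (at_left s)" using S(3)[OF True pos] ..
      then have "eventually (\<lambda>x. dist (f x) L < 1) (at_left s)" by (rule tendstoD) simp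
      then obtain b where b: "b < s" "\<And>y. b < y \<Longrightarrow> y < s \<Longrightarrow> dist (f y) L < 1"
        unfolding eventually_at_left_field by blast
      show ?thesis
        by (rule exI[of _ "s - b"], intro conjI exI[of _ "\<bar>L\<bar> + 1"]) (use b in \<open>force simp: dist_real_def\<close>)+
    next
      case False
      then show ?thesis using s by (intro exI[of _ 1] conjI exI[of _ 0]) auto
    qed
    then obtain d1 D1 where d1: "0 < d1" "\<And>x. x \<in> {0..1} \<Longrightarrow> s - d1 < x \<Longrightarrow> x < s \<Longrightarrow> \<bar>f x\<bar> \<le> D1" by blast
    have "\<exists>d>0. \<exists>D. \<forall>x\<in>{0..1}. s < x \<and> x < s + d \<longrightarrow> \<bar>f x\<bar> \<le> D"
    proof (cases "s < 1")
      case lt: True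
      obtain L where "(f \<longlongrightarrow> L) (at_right s)" using S(4)[OF True lt] ..
      then have "eventually (\<lambda>x. dist (f x) L < 1) (at_right s)" by (rule tendstoD) simp
      then obtain b where b: "s < b" "\<And>y. s < y \<Longrightarrow> y < b \<Longrightarrow> dist (f y) L < 1"
        unfolding eventually_at_right_field by blast
      show ?thesis
        by (rule exI[of _ "b - s"], intro conjI exI[of _ "\<bar>L\<bar> + 1"]) (use b in \<open>force simp: dist_real_def\<close>)+
    next
      case False
      then show ?thesis using s by (intro exI[of _ 1] conjI exI[of _ 0]) auto
    qed
    then obtain d2 D2 where d2: "0 < d2" "\<And>x. x \<in> {0..1} \<Longrightarrow> s < x \<Longrightarrow> x < s + d2 \<Longrightarrow> \<bar>f x\<bar> \<le> D2" by blast
    have "\<bar>f x\<bar> \<le> max \<bar>f s\<bar> (max D1 D2)" if x: "x \<in> {0..1}" "\<bar>x - s\<bar> < min d1 d2" for x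
    proof -
      consider "x = s" | "x < s" | "s < x" by linarith
      then show ?thesis using d1(2)[of x] d2(2)[of x] x by cases (auto simp: le_max_iff_disj)
    qed
    then show ?thesis using d1(1) d2(1) by (intro exI[of _ "min d1 d2"] conjI exI[of _ "max \<bar>f s\<bar> (max D1 D2)"]) auto
  qed
  define P where "P a b \<longleftrightarrow> (\<exists>D. \<forall>x\<in>{a..b} \<inter> {0..1}. \<bar>f x\<bar> \<le> D)" for a b
  have "P 0 1"
  proof (rule Bolzano)
    fix a b c :: real assume "P a b" "P b c" "a \<le> b" "b \<le> c"
    then obtain D1 D2 where "\<forall>x\<in>{a..b} \<inter> {0..1}. \<bar>f x\<bar> \<le> D1" "\<forall>x\<in>{b..c} \<inter> {0..1}. \<bar>f x\<bar> \<le> D2"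
      by (auto simp: P_def)
    then have "\<forall>x\<in>{a..c} \<inter> {0..1}. \<bar>f x\<bar> \<le> max D1 D2"
      by (metis IntE IntI atLeastAtMost_iff le_max_iff_disj linear)
    then show "P a c" by (auto simp: P_def)
  next
    fix s :: real assume "0 \<le> s" "s \<le> 1"
    then have "s \<in> {0..1}" by simp
    from loc[OF this] obtain d D where dD: "0 < d" "\<forall>x\<in>{0..1}. \<bar>x - s\<bar> < d \<longrightarrow> \<bar>f x\<bar> \<le> D"
      by (elim exE conjE)
    note d = dD(1) dD(2)[rule_format]
    show "\<exists>d>0. \<forall>a b. a \<le> s \<and> s \<le> b \<and> b - a < d \<longrightarrow> P a b"
    proof (intro exI[of _ d] conjI allI impI)
      fix a b assume ab: "a \<le> s \<and> s \<le> b \<and> b - a < d"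
      show "P a b" unfolding P_def by (rule exI[of _ D]) (use ab in \<open>auto intro!: d(2)\<close>)
    qed (rule d(1))
  qed simp
  then show ?thesis by (auto simp: P_def)
qed

lemma regular_seq_bounded:
  assumes "regular_seq lam"
  shows "\<exists>B. \<forall>N\<ge>1. \<forall>j\<in>{1..N}. \<bar>(real_of_int (lam N j) + real N - real j) / real N\<bar> \<le> B"
proof -
  obtain f C where f: "piecewise_continuous01 f"
    and C: "\<And>N j. N \<ge> 1 \<Longrightarrow> j \<in> {1..N} \<Longrightarrow> \<bar>real_of_int (lam N j) / real N - f (real j / real N)\<bar> < C"
    using assms unfolding regular_seq_def by blast
  obtain D where D: "\<And>x. x \<in> {0..1} \<Longrightarrow> \<bar>f x\<bar> \<le> D" using piecewise_continuous01_bounded[OF f] by blast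
  have "\<bar>(real_of_int (lam N j) + real N - real j) / real N\<bar> \<le> C + D + 1" if N: "N \<ge> 1" "j \<in> {1..N}" for N j
  proof -
    have "\<bar>real_of_int (lam N j) / real N - f (real j / real N)\<bar> < C" by (rule C[OF N])
    moreover have "\<bar>f (real j / real N)\<bar> \<le> D" by (rule D) (use N in auto)
    moreover have "0 \<le> real j / real N" "real j / real N \<le> 1" using N by auto
    moreover have "(real_of_int (lam N j) + real N - real j) / real N = real_of_int (lam N j) / real N + 1 - real j / real N"
      using N by (simp add: field_simps)
    ultimately show ?thesis by linarith
  qed
  then show ?thesis by blast
qed

text \<open>Weak convergence tests bounded functions only, so the monomial is clipped outside an
  interval that carries \<open>m\<close> and, by regularity, contains all scaled positions.\<close>

lemma empirical_moments_converge:
  assumes reg: "regular_seq lam" and m: "prob_space m" and borel: "sets m = sets borel"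
    and cpt: "emeasure m {x. K < \<bar>x\<bar>} = 0" and weak: "weak_conv_emp lam m"
  shows "(\<lambda>N. emp_int N (lam N) (\<lambda>x. x ^ k)) \<longlonglongrightarrow> integral\<^sup>L m (\<lambda>x. x ^ k)"
proof -
  interpret prob_space m by (rule m)
  obtain B0 where B0: "\<And>N j. N \<ge> 1 \<Longrightarrow> j \<in> {1..N} \<Longrightarrow> \<bar>(real_of_int (lam N j) + real N - real j) / real N\<bar> \<le> B0"
    using regular_seq_bounded[OF reg] by blast
  define B where "B = max (max B0 K) 1"
  define g where "g x = (max (- B) (min B x)) ^ k" for x :: real
  have clip: "max (- B) (min B x) = x" if "\<bar>x\<bar> \<le> B" for x using that by auto
  have "continuous_on UNIV g" unfolding g_def by (intro continuous_intros)
  moreover have "bounded (range g)"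
  proof (rule boundedI)
    fix y assume "y \<in> range g"
    then obtain x where "y = (max (- B) (min B x)) ^ k" by (auto simp: g_def)
    moreover have "\<bar>max (- B) (min B x)\<bar> \<le> B" by (auto simp: B_def)
    ultimately show "norm y \<le> B ^ k" by (simp add: power_abs power_mono)
  qed
  ultimately have "(\<lambda>N. emp_int N (lam N) g) \<longlonglongrightarrow> integral\<^sup>L m g" using weak by (simp add: weak_conv_emp_def)
  also have "integral\<^sup>L m g = integral\<^sup>L m (\<lambda>x. x ^ k)"
  proof (rule integral_cong_AE)
    have [measurable_cong]: "sets m = sets borel" by (rule borel)
    show "g \<in> borel_measurable m" unfolding g_def by measurable
    show "(\<lambda>x. x ^ k) \<in> borel_measurable m" by measurable
    have "{x. K < \<bar>x\<bar>} \<in> sets m" unfolding borel by simp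
    then have "AE x in m. x \<notin> {x. K < \<bar>x\<bar>}" using cpt by (intro AE_not_in) (auto simp: null_sets_def)
    then show "AE x in m. g x = x ^ k"
    proof eventually_elim
      case (elim x)
      then have "\<bar>x\<bar> \<le> B" by (auto simp: B_def)
      then show ?case by (simp only: g_def clip)
    qed
  qed
  finally show ?thesis
  proof (rule Lim_transform_eventually)
    show "eventually (\<lambda>N. emp_int N (lam N) g = emp_int N (lam N) (\<lambda>x. x ^ k)) sequentially"
      using eventually_ge_at_top[of 1]
    proof eventually_elim
      case (elim N)
      have "g ((real_of_int (lam N i) + real N - real i) / real N) = ((real_of_int (lam N i) + real N - real i) / real N) ^ k" if "i \<in> {1..N}" for i
      proof -
        have "\<bar>(real_of_int (lam N i) + real N - real i) / real N\<bar> \<le> B" using B0[OF elim that] by (simp add: B_def)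
        then show ?thesis by (simp only: g_def clip)
      qed
      then show ?case by (simp add: emp_int_def)
    qed
  qed
qed

lemma Mof_less: "0 < a \<Longrightarrow> a < 1 \<Longrightarrow> 0 < N \<Longrightarrow> Mof a N < N"
proof -
  assume a: "0 < a" "a < 1" "0 < N"
  have "a * real N < real N" using a by simp
  then show ?thesis using a by (simp add: Mof_def nat_less_iff floor_less_iff)
qed

lemma Mof_ratio:
  assumes "0 < a" "a < 1"
  shows "(\<lambda>N. real (N - Mof a N) / real N) \<longlonglongrightarrow> 1 - a"
proof (rule real_tendsto_sandwich)
  have M: "a * real N - 1 \<le> real (Mof a N)" "real (Mof a N) \<le> a * real N" for N
    using assms by (auto simp: Mof_def)
  have e: "real (N - Mof a N) / real N = 1 - real (Mof a N) / real N" if "0 < N" for N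
    using that Mof_less[OF assms that] by (simp add: of_nat_diff field_simps)
  show "eventually (\<lambda>N. 1 - a \<le> real (N - Mof a N) / real N) sequentially"
    using eventually_gt_at_top[of 0] by eventually_elim (simp add: e, use M(2) in \<open>simp add: field_simps\<close>)
  show "eventually (\<lambda>N. real (N - Mof a N) / real N \<le> 1 - a + 1 / real N) sequentially"
    using eventually_gt_at_top[of 0]
  proof eventually_elim
    case (elim N)
    have "(a * real N - 1) / real N \<le> real (Mof a N) / real N" by (intro divide_right_mono M) simp
    then have "a - 1 / real N \<le> real (Mof a N) / real N" using elim by (simp add: diff_divide_distrib)
    then show ?case unfolding e[OF elim] by linarith
  qed
  have "(\<lambda>N. 1 - a + 1 / real N) \<longlonglongrightarrow> 1 - a + 0" by (intro tendsto_intros lim_1_over_n)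
  then show "(\<lambda>N. 1 - a + 1 / real N) \<longlonglongrightarrow> 1 - a" by simp
qed simp

context coords begin

lemma psum_monom: "psum n \<mu> (monom (1 / of_nat N ^ k) k) = of_real (pk n k \<mu> / real N ^ k)"
proof -
  have "pk n k \<mu> = (\<Sum>m<n. (real_of_int (\<mu> (Suc m)) + real n - real (Suc m)) ^ k)"
    unfolding pk_def by (rule sum.reindex_bij_witness[where i=Suc and j="\<lambda>i. i - 1"]) auto
  then show ?thesis
    by (simp add: psum_def poly_monom pos_def sum_divide_distrib)
qed

text \<open>The change of basis \<open>evdet\<close> and the vacuum determinant of the base rows
  recombine to the dimension of \<open>l\<close>, by which expectations are normalised.\<close>

lemma down_centred:
  assumes l: "l \<in> GT N" and nr: "n + r = N"
  shows "down n r (\<lambda>\<mu>. (\<Prod>k\<leftarrow>ks. of_real (pk n k \<mu> / real N ^ k) - vac_trace N (power_mat r k)) * schur n \<mu> (\<lambda>_. 1)) l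
    = cumG (map (power_mat r) ks) * schur N l (\<lambda>_. 1)"
proof -
  let ?gts = "map (\<lambda>k. (monom (1 / of_nat N ^ k) k, vac_trace N (power_mat r k))) ks"
  let ?v = "\<lambda>i. coord (base_rows N i)"
  have "down n r (\<lambda>\<mu>. (\<Prod>k\<leftarrow>ks. of_real (pk n k \<mu> / real N ^ k) - vac_trace N (power_mat r k)) * schur n \<mu> (\<lambda>_. 1)) l
    = down n r (\<lambda>\<mu>. (\<Prod>(g,t)\<leftarrow>?gts. psum n \<mu> g - t) * schur n \<mu> (\<lambda>_. 1)) l"
    by (simp add: comp_def psum_monom del: of_real_divide)
  also have "\<dots> = theta (eval_det N l) N (map (\<lambda>(g,t). (conj_mult r g, t)) ?gts) (base_rows N)"
    using down_psums[of l n r ?gts] l nr by simp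
  also have "\<dots> = evdet * theta (vac_det N) N (map (\<lambda>(T,t). (zapply (op_mat T), t)) (map (\<lambda>(g,t). (conj_mult r g, t)) ?gts)) ?v"
    by (rule theta_op_mat) (auto simp: linop_conj_mult)
  also have "map (\<lambda>(T,t). (zapply (op_mat T), t)) (map (\<lambda>(g,t). (conj_mult r g, t)) ?gts) = map (\<lambda>A. (zapply A, vac_trace N A)) (map (power_mat r) ks)"
    by (simp add: comp_def power_mat_def)
  also have "theta (vac_det N) N (map (\<lambda>A. (zapply A, vac_trace N A)) (map (power_mat r) ks)) ?v = centred N (map (power_mat r) ks) ?v"
    by (simp only: centred_def)
  also have "\<dots> = cumG (map (power_mat r) ks) * vac_det N ?v"
    by (rule centred_eq_cumG[OF flag_rows_base]) (auto simp: power_mat_def cutmat_op_mat)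
  also have "evdet * (cumG (map (power_mat r) ks) * vac_det N ?v) = cumG (map (power_mat r) ks) * schur N l (\<lambda>_. 1)"
    unfolding schur_one[OF l] eval_det_vac_det by (simp only: mult_ac)
  finally show ?thesis .
qed

end

lemma centred_moment_eq_cumG:
  fixes a :: real and N :: nat
  defines "r \<equiv> N - Mof a N"
  assumes N: "1 \<le> N" and a: "0 < a" "a < 1" and lam: "l \<in> GT N"
    and nn: "\<And>\<mu>. 0 \<le> rho N \<mu>"
    and gf: "\<And>x. (\<And>i. i \<in> {1..Mof a N} \<Longrightarrow> cmod (x i) = 1) \<Longrightarrow>
      ((\<lambda>\<mu>. complex_of_real (rho N \<mu>) * schur (Mof a N) \<mu> x / schur (Mof a N) \<mu> (\<lambda>_. 1)) has_sum
        (schur N l (\<lambda>i. if i \<le> Mof a N then x i else 1) / schur N l (\<lambda>_. 1))) (GT (Mof a N))"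
  shows "complex_of_real (momN rho a N ks) = cumG (map (coords.power_mat N l r) ks)"
proof -
  let ?n = "Mof a N"
  interpret coords N l by standard (use N in simp)
  have nr: "?n + r = N" using Mof_less[OF a, of N] N by (simp add: r_def)
  have E: "complex_of_real (\<Sum>\<^sub>\<infinity>\<mu>\<in>GT ?n. rho N \<mu> * h \<mu>) =
     down ?n r (\<lambda>\<mu>. complex_of_real (h \<mu>) * schur ?n \<mu> (\<lambda>_. 1)) l / schur N l (\<lambda>_. 1)" for h
    using expectation_eq_down[of l ?n r "rho N" h] lam nn gf unfolding nr by blast
  have nz: "schur N l (\<lambda>_. 1) \<noteq> 0" using schur_one_pos[OF lam] by auto
  have NN: "real N ^ k \<noteq> 0" for k using N by simp
  \<comment> \<open>For a single matrix the recursion of \<open>cumG\<close> is an empty sum, so the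
    first centred moment is 0 and the vacuum trace is the normalised mean.\<close>
  have t: "vac_trace N (power_mat r k) = of_real (Ep rho a N k / real N ^ k)" for k
  proof -
    let ?S = "\<lambda>\<mu>. schur ?n \<mu> (\<lambda>_. 1)"
    have "down ?n r (\<lambda>\<mu>. (of_real (pk ?n k \<mu> / real N ^ k) - vac_trace N (power_mat r k)) * ?S \<mu>) l = 0"
      using down_centred[OF lam nr, of "[k]"] by simp
    moreover have "down ?n r ?S l = schur N l (\<lambda>_. 1)"
      using down_centred[OF lam nr, of "[]"] by simp
    moreover have "down ?n r (\<lambda>\<mu>. (of_real (pk ?n k \<mu> / real N ^ k) - vac_trace N (power_mat r k)) * ?S \<mu>) l =
       of_real (1 / real N ^ k) * down ?n r (\<lambda>\<mu>. of_real (pk ?n k \<mu>) * ?S \<mu>) l - vac_trace N (power_mat r k) * down ?n r ?S l"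
      unfolding down_mult_left[symmetric] down_diff[symmetric] by (simp add: left_diff_distrib)
    ultimately have "vac_trace N (power_mat r k) * schur N l (\<lambda>_. 1) = of_real (1 / real N ^ k) * down ?n r (\<lambda>\<mu>. of_real (pk ?n k \<mu>) * ?S \<mu>) l"
      by simp
    moreover have "down ?n r (\<lambda>\<mu>. of_real (pk ?n k \<mu>) * ?S \<mu>) l = of_real (Ep rho a N k) * schur N l (\<lambda>_. 1)"
      using E[of "pk ?n k"] nz by (simp only: Ep_def nonzero_eq_divide_eq not_False_eq_True)
    ultimately have "vac_trace N (power_mat r k) * schur N l (\<lambda>_. 1) = of_real (Ep rho a N k / real N ^ k) * schur N l (\<lambda>_. 1)"
      by simp
    then show ?thesis using nz by (simp only: mult_right_cancel not_False_eq_True)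
  qed
  have "complex_of_real (momN rho a N ks) = down ?n r (\<lambda>\<mu>. complex_of_real (\<Prod>k\<leftarrow>ks. (pk ?n k \<mu> - Ep rho a N k) / real N ^ k) * schur ?n \<mu> (\<lambda>_. 1)) l / schur N l (\<lambda>_. 1)"
    unfolding momN_def by (rule E)
  also have "(\<lambda>\<mu>. complex_of_real (\<Prod>k\<leftarrow>ks. (pk ?n k \<mu> - Ep rho a N k) / real N ^ k) * schur ?n \<mu> (\<lambda>_. 1)) =
     (\<lambda>\<mu>. (\<Prod>k\<leftarrow>ks. of_real (pk ?n k \<mu> / real N ^ k) - vac_trace N (power_mat r k)) * schur ?n \<mu> (\<lambda>_. 1))"
  proof
    fix \<mu>
    have "complex_of_real (\<Prod>k\<leftarrow>ks. (pk ?n k \<mu> - Ep rho a N k) / real N ^ k) = (\<Prod>k\<leftarrow>ks. of_real (pk ?n k \<mu> / real N ^ k) - vac_trace N (power_mat r k))"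
      unfolding t by (induction ks) (simp_all add: diff_divide_distrib)
    then show "complex_of_real (\<Prod>k\<leftarrow>ks. (pk ?n k \<mu> - Ep rho a N k) / real N ^ k) * schur ?n \<mu> (\<lambda>_. 1) =
      (\<Prod>k\<leftarrow>ks. of_real (pk ?n k \<mu> / real N ^ k) - vac_trace N (power_mat r k)) * schur ?n \<mu> (\<lambda>_. 1)" by simp
  qed
  also have "down ?n r \<dots> l = cumG (map (power_mat r) ks) * schur N l (\<lambda>_. 1)"
    by (rule down_centred[OF lam nr])
  finally show ?thesis using nz by simp
qed

lemma covN_eq_momN: "covN rho a N k1 k2 / real N ^ (k1 + k2) = momN rho a N [k1, k2]"
proof -
  have "momN rho a N [k1, k2] = (\<Sum>\<^sub>\<infinity>\<mu>\<in>GT (Mof a N). rho N \<mu> *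
      (pk (Mof a N) k1 \<mu> - Ep rho a N k1) * (pk (Mof a N) k2 \<mu> - Ep rho a N k2) * (1 / real N ^ (k1 + k2)))"
    unfolding momN_def by (simp add: power_add mult_ac)
  then show ?thesis unfolding covN_def infsum_cmult_left' by simp
qed

text \<open>\<open>Ci\<close> is specified by inverting the Stieltjes transform near 0 and by its
  blow-up there, which pins it down on a punctured neighbourhood. One \<open>\<epsilon>0\<close>
  serves all exponents, since it only depends on where the local coordinate exists.\<close>

theorem mainTheorem6:
  fixes lam :: "nat \<Rightarrow> nat \<Rightarrow> int" and m :: "real measure" and a :: real
    and rho :: "nat \<Rightarrow> (nat \<Rightarrow> int) \<Rightarrow> real" and Ci :: "complex \<Rightarrow> complex"
  assumes sig: "\<forall>N\<ge>1. lam N \<in> GT N"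
    and reg: "regular_seq lam"
    and prob: "prob_space m" and borel: "sets m = sets borel"
    and cpt: "\<exists>K. emeasure m {x. K < \<bar>x\<bar>} = 0"
    and weak: "weak_conv_emp lam m"
    and a: "0 < a" "a < 1"
    and rho: "\<forall>N\<ge>1. (\<forall>\<mu>. 0 \<le> rho N \<mu>) \<and> (\<forall>\<mu>. \<mu> \<notin> GT (Mof a N) \<longrightarrow> rho N \<mu> = 0) \<and>
        (rho N has_sum 1) (GT (Mof a N)) \<and>
        (\<forall>x. (\<forall>i\<in>{1..Mof a N}. cmod (x i) = 1) \<longrightarrow>
           ((\<lambda>\<mu>. complex_of_real (rho N \<mu>) * schur (Mof a N) \<mu> x / schur (Mof a N) \<mu> (\<lambda>_. 1))
              has_sum (schur N (lam N) (\<lambda>i. if i \<le> Mof a N then x i else 1) / schur N (lam N) (\<lambda>_. 1)))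
           (GT (Mof a N)))"
    and Ci_inv: "\<exists>r>0. \<forall>u. 0 < cmod u \<and> cmod u < r \<longrightarrow> stieltjes m (Ci u) = u"
    and Ci_inf: "filterlim Ci at_infinity (at 0)"
  shows "\<exists>\<epsilon>0>0. \<forall>\<epsilon>. 0 < \<epsilon> \<and> \<epsilon> < \<epsilon>0 \<longrightarrow>
     (\<forall>k1 k2. 1 \<le> k1 \<and> 1 \<le> k2 \<longrightarrow>
        (\<lambda>N. complex_of_real (covN rho a N k1 k2 / real N ^ (k1 + k2))) \<longlonglongrightarrow> cov_kernel a Ci \<epsilon> k1 k2) \<and>
     (\<forall>ks. (\<forall>k\<in>set ks. 1 \<le> k) \<longrightarrow>
        (\<lambda>N. complex_of_real (momN rho a N ks)) \<longlonglongrightarrow> wick (cov_kernel a Ci \<epsilon>) ks)"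
proof -
  define mo where "mo k = complex_of_real (integral\<^sup>L m (\<lambda>x. x ^ k))" for k
  define r where "r N = N - Mof a N" for N
  obtain K where K: "emeasure m {x. K < \<bar>x\<bar>} = 0" using cpt by blast
  obtain s where s: "0 < s" "\<And>u. 0 < cmod u \<Longrightarrow> cmod u < s \<Longrightarrow> stieltjes m (Ci u) = u" using Ci_inv by blast
  interpret L: regular_limit lam r mo a
  proof
    fix k
    have "(\<lambda>N. complex_of_real (emp_int N (lam N) (\<lambda>x. x ^ k))) \<longlonglongrightarrow> mo k"
      unfolding mo_def by (intro tendsto_of_real empirical_moments_converge[OF reg prob borel K weak])
    then show "(\<lambda>N. (\<Sum>i<N. coords.scaled_pos N (lam N) i ^ k) / of_nat N) \<longlonglongrightarrow> mo k"
    proof (rule Lim_transform_eventually)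
      show "eventually (\<lambda>N. complex_of_real (emp_int N (lam N) (\<lambda>x. x ^ k)) = (\<Sum>i<N. coords.scaled_pos N (lam N) i ^ k) / of_nat N) sequentially"
        using eventually_gt_at_top[of 0]
      proof eventually_elim
        case (elim N)
        then have c: "coords N" by (simp add: coords_def)
        have "(\<Sum>i=1..N. ((real_of_int (lam N i) + real N - real i) / real N) ^ k) =
          (\<Sum>i<N. ((real_of_int (lam N (Suc i)) + real N - real (Suc i)) / real N) ^ k)"
          by (rule sum.reindex_bij_witness[where i=Suc and j="\<lambda>i. i - 1"]) auto
        then show ?case
          by (simp add: emp_int_def coords.scaled_pos_def[OF c] pos_def)
      qed
    qed
  next
    show "mo 0 = 1" using prob_space.prob_space[OF prob] by (simp add: mo_def)
    show "(\<lambda>N. real (r N) / real N) \<longlonglongrightarrow> 1 - a" unfolding r_def by (rule Mof_ratio[OF a])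
    show "0 < r N \<and> r N \<le> N" if "0 < N" for N using Mof_less[OF a that] by (simp add: r_def)
  qed (use a in simp)
  \<comment> \<open>At \<open>N = 0\<close> there are no coordinates; the zero matrix makes the band
    condition hold for every \<open>N\<close>.\<close>
  define A where "A N k = (if N = 0 then (\<lambda>_ _. 0) else coords.power_mat N (lam N) (r N) k)" for N k
  have conv: "zconv k (\<lambda>N. A N k) (toep (L.TU k))" if "1 \<le> k" for k
    unfolding zconv_def
  proof (intro conjI allI)
    fix N show "banded k (A N k)"
      by (cases "N = 0") (auto simp: A_def coords.banded_power_mat[OF L.coordsI], simp add: banded_def)
  next
    fix m n
    show "(\<lambda>N. A N k m n) \<longlonglongrightarrow> toep (L.TU k) m n"
      unfolding toep_def
      by (rule Lim_transform_eventually[OF L.xN_lim])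
         (use that in auto, use eventually_gt_at_top[of 0] in eventually_elim, simp add: A_def)
  qed
  let ?c = "\<lambda>k l. pair_trace (toep (L.TU k)) (toep (L.TU l))"
  have mom: "(\<lambda>N. complex_of_real (momN rho a N ks)) \<longlonglongrightarrow> wick ?c ks" if ks: "\<forall>k\<in>set ks. 1 \<le> k" for ks
  proof -
    have "(\<lambda>N. cumG (map (A N) ks)) \<longlonglongrightarrow> cumG (map (\<lambda>k. toep (L.TU k)) ks)"
    proof (rule tendsto_cumG)
      fix j assume "j < length (map (\<lambda>k. toep (L.TU k)) ks)"
      then show "\<exists>k. zconv k (\<lambda>N. map (A N) ks ! j) (map (\<lambda>k. toep (L.TU k)) ks ! j)"
        using conv[of "ks ! j"] ks by auto
    qed simp
    also have "cumG (map (\<lambda>k. toep (L.TU k)) ks) = wick ?c ks"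
      by (rule cumG_toep[where d="\<lambda>k. k"]) (auto simp: L.TU_def)
    finally show ?thesis
    proof (rule Lim_transform_eventually)
      show "eventually (\<lambda>N. cumG (map (A N) ks) = complex_of_real (momN rho a N ks)) sequentially"
        using eventually_ge_at_top[of 1]
      proof eventually_elim
        case (elim N)
        have "complex_of_real (momN rho a N ks) = cumG (map (coords.power_mat N (lam N) (N - Mof a N)) ks)"
          by (rule centred_moment_eq_cumG[OF elim a]) (use sig rho elim in auto)
        moreover have "A N = coords.power_mat N (lam N) (N - Mof a N)" using elim by (auto simp: A_def r_def fun_eq_iff)
        ultimately show ?case by simp
      qed
    qed
  qed
  obtain \<epsilon>0 where \<epsilon>0: "0 < \<epsilon>0" "\<And>\<epsilon> k1 k2. 0 < \<epsilon> \<Longrightarrow> \<epsilon> < \<epsilon>0 \<Longrightarrow> cov_kernel a Ci \<epsilon> k1 k2 =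
     (\<Sum>j=1..k1. of_nat j * fps_nth (symU mo a ^ k1) (k1 - j) * fps_nth (symU mo a ^ k2) (k2 + j))"
    using cov_kernel_eq[OF prob borel K a(1) s(2) s(1) Ci_inf] unfolding mo_def by blast
  have c: "?c = cov_kernel a Ci \<epsilon>" if "0 < \<epsilon>" "\<epsilon> < \<epsilon>0" for \<epsilon>
  proof (intro ext)
    fix k l
    have "?c k l = (\<Sum>j=1..k. of_nat j * L.TU k (int j) * L.TU l (- int j))"
      by (rule pair_trace_toep) (simp add: L.TU_def)
    also have "\<dots> = cov_kernel a Ci \<epsilon> k l"
      unfolding \<epsilon>0(2)[OF that]
    proof (intro sum.cong refl)
      fix j assume "j \<in> {1..k}"
      then have "nat (int k - int j) = k - j" "nat (int l - - int j) = l + j" by auto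
      then show "of_nat j * L.TU k (int j) * L.TU l (- int j) = of_nat j * fps_nth (symU mo a ^ k) (k - j) * fps_nth (symU mo a ^ l) (l + j)"
        using \<open>j \<in> {1..k}\<close> by (simp add: L.TU_def)
    qed
    finally show "?c k l = cov_kernel a Ci \<epsilon> k l" .
  qed
  show ?thesis
  proof (intro exI[of _ \<epsilon>0] conjI allI impI \<epsilon>0(1))
    fix \<epsilon> :: real and k1 k2 :: nat
    assume "0 < \<epsilon> \<and> \<epsilon> < \<epsilon>0" "1 \<le> k1 \<and> 1 \<le> k2"
    then show "(\<lambda>N. complex_of_real (covN rho a N k1 k2 / real N ^ (k1 + k2))) \<longlonglongrightarrow> cov_kernel a Ci \<epsilon> k1 k2"
      using mom[of "[k1, k2]"] c[of \<epsilon>] by (simp add: covN_eq_momN)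
  next
    fix \<epsilon> :: real and ks :: "nat list" assume "0 < \<epsilon> \<and> \<epsilon> < \<epsilon>0" "\<forall>k\<in>set ks. 1 \<le> k"
    then show "(\<lambda>N. complex_of_real (momN rho a N ks)) \<longlonglongrightarrow> wick (cov_kernel a Ci \<epsilon>) ks"
      using mom[of ks] c[of \<epsilon>] by simp
  qed
qed

end
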